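(* Let $\mathbf{B}$ be the family of probability distributions supported in $[0,1]$. Let $\nu\in\mathbf{B}$ have mean $m(\nu)=\mu$, let $\mathcal{C}$ be a cost distribution with mean $0<\overline c<\infty$, and let $C_\delta\to\infty$ (as $\delta\to0$) be a budget for which $\lim_{\delta\to0}C_\delta/\log(1/\delta)$ exists in $[0,\infty]$. The $KL_{\rm inf}$-based policy $\pi_1^{\rm b}$ with threshold $\beta(n,\delta)=1+\log\left(\frac{2(1+n)}{\delta}\right)$ has the following properties: (a) $\pi_1^{\rm b}\in\hat\Pi^s_{\rm CI}$. (b) If $\lim_{\delta\to0}\frac{C_\delta}{\log(1/\delta)}=k$ with $k\in(0,\infty)$, then its limiting endpoints are $\mu_R^{\pi_1^{\rm b}}(\nu)=\mu_R^*(\nu,k,\overline c)$ and $\mu_L^{\pi_1^{\rm b}}(\nu)=\mu_L^*(\nu,k,\overline c)$, where $\mu_L^*(\nu,k,\overline c)<\mu$ and $\mu_R^*(\nu,k,\overline c)>\mu$ uniquely solve $KL_{\rm inf}(\nu,\mathbf{B},\mu_R^*(\nu,k,\overline c))=KL_{\rm inf}(\nu,\mathbf{B},\mu_L^*(\nu,k,\overline c))=\frac{\overline c}{k}$. (c) If $\lim_{\delta\to0}\frac{C_\delta}{\log(1/\delta)}=\infty$, then $\mu_R^{\pi_1^{\rm b}}(\nu)-\mu_L^{\pi_1^{\rm b}}(\nu)=0$.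
   Context: $m(\kappa)$ denotes the mean of $\kappa$. $KL_{\rm inf}(\nu,\mathbf{B},x)=\inf\{KL(\nu,\kappa):\kappa\in\mathbf{B},\,m(\kappa)\ge x\}$ if $x\ge m(\nu)$, and $=\inf\{KL(\nu,\kappa):\kappa\in\mathbf{B},\,m(\kappa)\le x\}$ if $x<m(\nu)$, where $KL$ is the Kullback–Leibler divergence (infimum over the empty set is $+\infty$). Random costs. $X_1,X_2,\dots$ are i.i.d. from $\nu$; the costs $c_1,c_2,\dots$ are i.i.d. from an unknown distribution $\mathcal{C}$ with positive support and mean $\overline c$, independent of the $X_i$. For a budget $C_\delta$, $\tau_\delta=\sup\{n\in\mathbb{Z}^+:\sum_{i=1}^nc_i\le C_\delta\}$ (with $\tau_\delta=0$ if the set is empty). $\mathbb{P}_\nu$ denotes the joint law of samples and costs. Policies and stability. A policy $\pi$ reports, for each $\delta\in(0,1)$, an interval $[\widehat\mu_L^\pi(\tau_\delta,\delta),\widehat\mu_R^\pi(\tau_\delta,\delta)]$ after observing $X_1,\dots,X_{\tau_\delta}$. $\hat\Pi_{\rm CI}$ is the set of policies such that for every $\nu\in\mathbf{B}$ and every $\delta\in(0,1)$, $\mathbb{P}_\nu(m(\nu)\in[\widehat\mu_L^\pi(\tau_\delta,\delta),\widehat\mu_R^\pi(\tau_\delta,\delta)])\ge1-\delta$. For a given $\nu$, a policy $\pi\in\hat\Pi_{\rm CI}$ is stable if, as $\delta\to0$ (with $C_\delta\to\infty$), under $\mathbb{P}_\nu$, $\widehat\mu_L^\pi(\tau_\delta,\delta)\overset{p}{\to}\mu_L^\pi(\nu)$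 and $\widehat\mu_R^\pi(\tau_\delta,\delta)\overset{p}{\to}\mu_R^\pi(\nu)$, where $\mu_L^\pi(\nu)\le m(\nu)$ and $\mu_R^\pi(\nu)\ge m(\nu)$ are constants ($\infty$ and $-\infty$ included), called the limiting endpoints. $\hat\Pi^s_{\rm CI}$ is the set of stable policies in $\hat\Pi_{\rm CI}$. Policy $\pi_1^{\rm b}$. Let $\hat\nu_n$ be the empirical distribution of $X_1,\dots,X_n$. For $n\ge1$, the right endpoint is $\sup\{q>m(\hat\nu_n):n\,KL_{\rm inf}(\hat\nu_n,\mathbf{B},q)\le\beta(n,\delta)\}$ and the left endpoint is $\inf\{q<m(\hat\nu_n):n\,KL_{\rm inf}(\hat\nu_n,\mathbf{B},q)\le\beta(n,\delta)\}$, each taken to be $m(\hat\nu_n)$ if the corresponding set is empty; for $n=0$ the interval is $[0,1]$. The reported interval is evaluated at $n=\tau_\delta$.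
   Formalization: In (b), the right endpoint claim is made only for μ < 1 and the left one only for μ > 0: for ν the point mass at 1 (resp. 0), KL_inf is infinite beyond μ on that side, so no μ_R* > μ (resp. μ_L* < μ) exists. *)

theory Defs
  imports "HOL-Probability.Probability"
begin

definition prob_unit_interval :: "real measure set" where
  "prob_unit_interval =
     {\<nu>. prob_space \<nu> \<and> sets \<nu> = sets borel \<and> measure \<nu> {0..1} = 1}"

definition mean :: "real measure \<Rightarrow> real" where
  "mean \<nu> = (\<integral>x. x \<partial>\<nu>)"

text \<open>
  The library constant \<^term>\<open>KL_divergence b \<kappa> \<nu>\<close> is real-valued and has the reference measure
  first, so it is \<open>KL(\<nu>, \<kappa>)\<close> when that is finite. The negative part of the log-density of \<open>\<nu>\<close>
  with respect to \<open>\<kappa>\<close> is always \<open>\<nu>\<close>-integrable, hence for \<open>\<nu>\<close> absolutely continuous with respect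
  to \<open>\<kappa>\<close> non-integrability means that the divergence is infinite.
\<close>

definition KL :: "real measure \<Rightarrow> real measure \<Rightarrow> ereal" where
  "KL \<nu> \<kappa> =
     (if absolutely_continuous \<kappa> \<nu> \<and> integrable \<nu> (entropy_density (exp 1) \<kappa> \<nu>)
      then ereal (KL_divergence (exp 1) \<kappa> \<nu>) else \<infinity>)"

definition KL_inf :: "real measure \<Rightarrow> real measure set \<Rightarrow> real \<Rightarrow> ereal" where
  "KL_inf \<nu> B x =
     (if mean \<nu> \<le> x then (INF \<kappa>\<in>{\<kappa>\<in>B. x \<le> mean \<kappa>}. KL \<nu> \<kappa>)
      else (INF \<kappa>\<in>{\<kappa>\<in>B. mean \<kappa> \<le> x}. KL \<nu> \<kappa>))"

definition cost_distribution :: "real measure \<Rightarrow> bool" where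
  "cost_distribution C \<longleftrightarrow>
     prob_space C \<and> sets C = sets borel \<and> (AE c in C. 0 < c) \<and> integrable C (\<lambda>c. c)"

text \<open>
  Outcomes are pairs of a sample sequence and a cost sequence; \<open>X\<^sub>i\<close> and \<open>c\<^sub>i\<close> are the coordinates
  with index \<open>i - 1\<close>.
\<close>

definition joint_law :: "real measure \<Rightarrow> real measure \<Rightarrow> ((nat \<Rightarrow> real) \<times> (nat \<Rightarrow> real)) measure" where
  "joint_law \<nu> C = (\<Pi>\<^sub>M i\<in>UNIV. \<nu>) \<Otimes>\<^sub>M (\<Pi>\<^sub>M i\<in>UNIV. C)"

text \<open>
  \<^term>\<open>Sup {} = (0::nat)\<close>. The set below is infinite only on a null event of \<^const>\<open>joint_law\<close>,
  where \<^const>\<open>Sup\<close> is an unspecified number.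
\<close>

definition num_samples :: "real \<Rightarrow> (nat \<Rightarrow> real) \<Rightarrow> nat" where
  "num_samples b c = Sup {n. 1 \<le> n \<and> (\<Sum>i<n. c i) \<le> b}"

text \<open>
  A policy maps \<open>\<delta>\<close> and the list of observed samples to the left and right endpoint of the
  reported interval. Measurability is part of the notion, since the measure of a non-measurable
  set is \<open>0\<close> by convention.
\<close>

type_synonym policy = "real \<Rightarrow> real list \<Rightarrow> ereal \<times> ereal"

definition policy :: "policy \<Rightarrow> bool" where
  "policy \<pi> \<longleftrightarrow> (\<forall>\<delta>\<in>{0<..<1}. \<forall>n.
     (\<lambda>x. fst (\<pi> \<delta> (map x [0..<n]))) \<in> borel_measurable (\<Pi>\<^sub>M i\<in>{..<n}. borel) \<and>
     (\<lambda>x. snd (\<pi> \<delta> (map x [0..<n]))) \<in> borel_measurable (\<Pi>\<^sub>M i\<in>{..<n}. borel))"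

definition left_endpoint ::
  "policy \<Rightarrow> (real \<Rightarrow> real) \<Rightarrow> real \<Rightarrow> (nat \<Rightarrow> real) \<times> (nat \<Rightarrow> real) \<Rightarrow> ereal" where
  "left_endpoint \<pi> b \<delta> = (\<lambda>(x, c). fst (\<pi> \<delta> (map x [0..<num_samples (b \<delta>) c])))"

definition right_endpoint ::
  "policy \<Rightarrow> (real \<Rightarrow> real) \<Rightarrow> real \<Rightarrow> (nat \<Rightarrow> real) \<times> (nat \<Rightarrow> real) \<Rightarrow> ereal" where
  "right_endpoint \<pi> b \<delta> = (\<lambda>(x, c). snd (\<pi> \<delta> (map x [0..<num_samples (b \<delta>) c])))"

definition CI_policies ::
  "real measure set \<Rightarrow> real measure \<Rightarrow> (real \<Rightarrow> real) \<Rightarrow> policy set" where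
  "CI_policies B C b = {\<pi>. policy \<pi> \<and>
     (\<forall>\<nu>\<in>B. \<forall>\<delta>\<in>{0<..<1}.
        1 - \<delta> \<le> measure (joint_law \<nu> C)
          {\<omega> \<in> space (joint_law \<nu> C).
             ereal (mean \<nu>) \<in> {left_endpoint \<pi> b \<delta> \<omega>..right_endpoint \<pi> b \<delta> \<omega>}})}"

text \<open>Convergence in probability as the index decreases to \<open>0\<close>, to a possibly infinite constant.\<close>

definition tendsto_in_prob :: "'a measure \<Rightarrow> (real \<Rightarrow> 'a \<Rightarrow> ereal) \<Rightarrow> ereal \<Rightarrow> bool" where
  "tendsto_in_prob M Y l \<longleftrightarrow> (case l of
     ereal r \<Rightarrow> \<forall>\<epsilon>>0. ((\<lambda>\<delta>. measure M {\<omega> \<in> space M. ereal \<epsilon> < \<bar>Y \<delta> \<omega> - ereal r\<bar>}) \<longlongrightarrow> 0) (at_right 0)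
   | PInfty \<Rightarrow> \<forall>K. ((\<lambda>\<delta>. measure M {\<omega> \<in> space M. Y \<delta> \<omega> \<le> ereal K}) \<longlongrightarrow> 0) (at_right 0)
   | MInfty \<Rightarrow> \<forall>K. ((\<lambda>\<delta>. measure M {\<omega> \<in> space M. ereal K \<le> Y \<delta> \<omega>}) \<longlongrightarrow> 0) (at_right 0))"

definition is_left_limit ::
  "real measure \<Rightarrow> (real \<Rightarrow> real) \<Rightarrow> real measure \<Rightarrow> policy \<Rightarrow> ereal \<Rightarrow> bool" where
  "is_left_limit C b \<nu> \<pi> l \<longleftrightarrow>
     l \<le> ereal (mean \<nu>) \<and> tendsto_in_prob (joint_law \<nu> C) (left_endpoint \<pi> b) l"

definition is_right_limit ::
  "real measure \<Rightarrow> (real \<Rightarrow> real) \<Rightarrow> real measure \<Rightarrow> policy \<Rightarrow> ereal \<Rightarrow> bool" where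
  "is_right_limit C b \<nu> \<pi> r \<longleftrightarrow>
     ereal (mean \<nu>) \<le> r \<and> tendsto_in_prob (joint_law \<nu> C) (right_endpoint \<pi> b) r"

definition stable_CI_policies ::
  "real measure set \<Rightarrow> real measure \<Rightarrow> (real \<Rightarrow> real) \<Rightarrow> real measure \<Rightarrow> policy set" where
  "stable_CI_policies B C b \<nu> =
     {\<pi> \<in> CI_policies B C b. (\<exists>l. is_left_limit C b \<nu> \<pi> l) \<and> (\<exists>r. is_right_limit C b \<nu> \<pi> r)}"

text \<open>The limiting endpoints; limits in probability are unique, so these are well defined for
  stable policies.\<close>

definition mu_L ::
  "real measure \<Rightarrow> (real \<Rightarrow> real) \<Rightarrow> real measure \<Rightarrow> policy \<Rightarrow> ereal" where
  "mu_L C b \<nu> \<pi> = (THE l. is_left_limit C b \<nu> \<pi> l)"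

definition mu_R ::
  "real measure \<Rightarrow> (real \<Rightarrow> real) \<Rightarrow> real measure \<Rightarrow> policy \<Rightarrow> ereal" where
  "mu_R C b \<nu> \<pi> = (THE r. is_right_limit C b \<nu> \<pi> r)"

definition empirical :: "real list \<Rightarrow> real measure" where
  "empirical xs = distr (uniform_count_measure {..<length xs}) borel (\<lambda>i. xs ! i)"

definition KL_inf_policy :: "real measure set \<Rightarrow> (nat \<Rightarrow> real \<Rightarrow> real) \<Rightarrow> policy" where
  "KL_inf_policy B \<beta> \<delta> xs =
     (let n = length xs; \<nu>' = empirical xs; m = mean \<nu>';
          admissible = (\<lambda>q. ereal (real n) * KL_inf \<nu>' B q \<le> ereal (\<beta> n \<delta>));
          QL = {q. q < m \<and> admissible q};
          QR = {q. m < q \<and> admissible q}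
      in if n = 0 then (0, 1)
         else (if QL = {} then ereal m else (INF q\<in>QL. ereal q),
               if QR = {} then ereal m else (SUP q\<in>QR. ereal q)))"

definition threshold :: "nat \<Rightarrow> real \<Rightarrow> real" where
  "threshold n \<delta> = 1 + ln (2 * (1 + real n) / \<delta>)"

definition mu_L_star :: "real measure set \<Rightarrow> real measure \<Rightarrow> real \<Rightarrow> real \<Rightarrow> real" where
  "mu_L_star B \<nu> k c = (THE x. x < mean \<nu> \<and> KL_inf \<nu> B x = ereal (c / k))"

definition mu_R_star :: "real measure set \<Rightarrow> real measure \<Rightarrow> real \<Rightarrow> real \<Rightarrow> real" where
  "mu_R_star B \<nu> k c = (THE x. mean \<nu> < x \<and> KL_inf \<nu> B x = ereal (c / k))"

end

theory Submission
  imports Defs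
begin

text \<open>
The two sides of the problem are mirror images. With \<open>e = 1\<close> for the right and \<open>e = 0\<close> for the left
endpoint, a constraint on the mean becomes the constraint that the expectation of \<open>\<bar>x - e\<bar>\<close> is at
most \<open>a\<close>, where \<open>a = \<bar>q - e\<bar>\<close> replaces the candidate mean \<open>q\<close>. Everything is proved once for
\<open>e\<close>.

The heart of the matter is convex duality. For \<open>t\<close> in \<open>[0, 1)\<close> the nonnegative function
\<open>bet e a t x = 1 - t + t * \<bar>x - e\<bar> / a\<close> has expectation at most \<open>1\<close> under every distribution that
satisfies the constraint, so the Gibbs inequality bounds the divergence from below by the expected
logarithm of the bet. Conversely the distribution with density \<open>1 / bet\<close> with respect to \<open>\<nu>\<close>,
completed by an atom at \<open>e\<close>, attains this bound for the best \<open>t\<close>, possibly only in the limit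
\<open>t\<close> to \<open>1\<close>. Hence the constrained infimum equals the best expected logarithmic growth (\<open>KL_near_eq_max_growth\<close>). The dual value is a real
number that is continuous and strictly decreasing in \<open>a\<close>, vanishes at the expectation of
\<open>\<bar>x - e\<bar>\<close> and is unbounded near \<open>0\<close>; this gives the unique solutions for a
positive and finite budget ratio (\<open>ex1_KL_near\<close>).

Coverage. The costs are independent of the samples, so it suffices to treat each fixed sample size
\<open>n\<close>. If the true mean is excluded on one side, the wealth of some bet against the true constraint
exceeds \<open>exp (threshold n \<delta>)\<close>. Any such bet is dominated, up to the factor \<open>1 + 1 / n\<close> per round,
by one of the \<open>n + 1\<close> bets with \<open>t = j / (n + 1)\<close> (\<open>bet_le_grid\<close>). The average wealth of these
\<open>n + 1\<close> bets has expectation one, and it is at least \<open>2 / \<delta>\<close> because the threshold pays for the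
factor \<open>exp 1 * (n + 1)\<close>. By Markov's inequality this happens with probability at most \<open>\<delta> / 2\<close>
(\<open>emeasure_miss\<close>).

Limits. By the weak law of large numbers the number of samples is close to the budget divided by the
mean cost (\<open>num_samples_concentration\<close>), so the threshold per sample converges in probability to
\<open>mean C / K\<close>. The same grid reduces the convergence of the empirical dual value to that of finitely
many averages of bounded variables. Since the limiting dual value is strictly monotone, the endpoint,
where it crosses the threshold per sample, converges as well (\<open>above_tendsto_0\<close>,
\<open>below_tendsto_0\<close>, \<open>endpoint_tendsto\<close>).
\<close>

section \<open>Divergence and expected logarithms\<close>

definition lratio :: "real measure \<Rightarrow> real measure \<Rightarrow> real \<Rightarrow> real" where
  "lratio \<nu> \<kappa> x = enn2real (RN_deriv \<kappa> \<nu> x)"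

lemma lratio_measurable [measurable]: "lratio \<nu> \<kappa> \<in> borel_measurable \<kappa>"
  unfolding lratio_def by measurable

lemma entropy_density_lratio: "entropy_density (exp 1) \<kappa> \<nu> x = ln (lratio \<nu> \<kappa> x)"
  by (simp add: entropy_density_def lratio_def log_def)

lemma KL_lratio:
  "KL \<nu> \<kappa> = (if absolutely_continuous \<kappa> \<nu> \<and> integrable \<nu> (\<lambda>x. ln (lratio \<nu> \<kappa> x))
     then ereal (\<integral>x. ln (lratio \<nu> \<kappa> x) \<partial>\<nu>) else \<infinity>)"
proof -
  have "entropy_density (exp 1) \<kappa> \<nu> = (\<lambda>x. ln (lratio \<nu> \<kappa> x))"
    by (rule ext) (rule entropy_density_lratio)
  then show ?thesis by (simp add: KL_def KL_divergence_def)
qed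

locale dominated_pair = \<kappa>: prob_space \<kappa> + \<nu>: prob_space \<nu>
  for \<kappa> \<nu> :: "real measure" +
  assumes sets_\<kappa> [measurable_cong]: "sets \<kappa> = sets borel"
    and sets_\<nu> [measurable_cong]: "sets \<nu> = sets borel"
    and ac: "absolutely_continuous \<kappa> \<nu>"
begin

lemma lratio_borel [measurable]: "lratio \<nu> \<kappa> \<in> borel_measurable borel"
  using lratio_measurable[of \<nu> \<kappa>] measurable_cong_sets[OF sets_\<kappa> refl] by blast

lemma AE_RN: "AE x in \<kappa>. RN_deriv \<kappa> \<nu> x = ennreal (lratio \<nu> \<kappa> x)"
proof -
  have "AE x in \<kappa>. RN_deriv \<kappa> \<nu> x \<noteq> \<infinity>"
    by (rule \<kappa>.RN_deriv_finite) (auto simp: sets_\<kappa> sets_\<nu> ac \<nu>.sigma_finite_measure_axioms)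
  then show ?thesis by eventually_elim (auto simp: lratio_def less_top)
qed

lemma density_lratio: "\<nu> = density \<kappa> (\<lambda>x. ennreal (lratio \<nu> \<kappa> x))"
proof -
  have "density \<kappa> (RN_deriv \<kappa> \<nu>) = \<nu>"
    by (rule \<kappa>.density_RN_deriv) (auto simp: sets_\<kappa> sets_\<nu> ac)
  moreover have "density \<kappa> (RN_deriv \<kappa> \<nu>) = density \<kappa> (\<lambda>x. ennreal (lratio \<nu> \<kappa> x))"
    by (rule density_cong) (use AE_RN in auto)
  ultimately show ?thesis by simp
qed

lemma nn_integral_lratio:
  assumes [measurable]: "f \<in> borel_measurable borel"
  shows "(\<integral>\<^sup>+x. f x \<partial>\<nu>) = (\<integral>\<^sup>+x. ennreal (lratio \<nu> \<kappa> x) * f x \<partial>\<kappa>)"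
  by (subst density_lratio, subst nn_integral_density) auto

lemma AE_lratio_pos: "AE x in \<nu>. 0 < lratio \<nu> \<kappa> x"
  by (subst density_lratio, subst AE_density) (auto simp: lratio_def)

text \<open>
Equality fails in general: where the ratio is \<open>0\<close> the left side sees nothing, since division by \<open>0\<close>
yields \<open>0\<close>, while \<open>\<kappa>\<close> may still have mass there.
\<close>

lemma nn_integral_divide_lratio_le:
  fixes g :: "real \<Rightarrow> real"
  assumes [measurable]: "g \<in> borel_measurable borel" and "\<And>x. 0 \<le> g x"
  shows "(\<integral>\<^sup>+x. ennreal (g x / lratio \<nu> \<kappa> x) \<partial>\<nu>) \<le> (\<integral>\<^sup>+x. ennreal (g x) \<partial>\<kappa>)"
proof -
  have "(\<integral>\<^sup>+x. ennreal (g x / lratio \<nu> \<kappa> x) \<partial>\<nu>)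
      = (\<integral>\<^sup>+x. ennreal (lratio \<nu> \<kappa> x) * ennreal (g x / lratio \<nu> \<kappa> x) \<partial>\<kappa>)"
    by (rule nn_integral_lratio) measurable
  also have "\<dots> \<le> (\<integral>\<^sup>+x. ennreal (g x) \<partial>\<kappa>)"
    by (rule nn_integral_mono) (auto simp: ennreal_mult'[symmetric] lratio_def assms)
  finally show ?thesis .
qed

text \<open>
The Gibbs inequality: apply \<open>ln u \<le> u - 1\<close> to the quotient of \<open>g\<close> and the likelihood ratio, whose
expectation under \<open>\<nu>\<close> is at most the expectation of \<open>g\<close> under \<open>\<kappa>\<close>.
\<close>

lemma integral_ln_le_ln_lratio:
  fixes g :: "real \<Rightarrow> real"
  assumes [measurable]: "g \<in> borel_measurable borel" and pos: "\<And>x. 0 \<le> g x"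
    and gpos: "AE x in \<nu>. 0 < g x"
    and int: "integrable \<nu> (\<lambda>x. ln (g x))" and int': "integrable \<nu> (\<lambda>x. ln (lratio \<nu> \<kappa> x))"
    and le: "(\<integral>\<^sup>+x. ennreal (g x) \<partial>\<kappa>) \<le> 1"
  shows "(\<integral>x. ln (g x) \<partial>\<nu>) \<le> (\<integral>x. ln (lratio \<nu> \<kappa> x) \<partial>\<nu>)"
proof -
  let ?q = "\<lambda>x. g x / lratio \<nu> \<kappa> x"
  have q0: "0 \<le> ?q x" for x by (auto simp: lratio_def pos)
  have le1: "(\<integral>\<^sup>+x. ennreal (?q x) \<partial>\<nu>) \<le> 1"
    using nn_integral_divide_lratio_le[OF assms(1) pos] le by simp
  have intq: "integrable \<nu> ?q"
  proof (rule integrableI_bounded)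
    have "norm (?q x) = ?q x" for x using q0[of x] by (simp only: real_norm_def abs_of_nonneg)
    then show "(\<integral>\<^sup>+x. ennreal (norm (?q x)) \<partial>\<nu>) < \<infinity>"
      using le1 by (auto simp: le_less_trans)
  qed measurable
  have "ennreal (\<integral>x. ?q x \<partial>\<nu>) \<le> 1"
    using le1 nn_integral_eq_integral[OF intq] q0 by auto
  then have q1: "(\<integral>x. ?q x \<partial>\<nu>) \<le> 1" by (simp add: ennreal_le_1)
  have "(\<integral>x. ln (g x) - ln (lratio \<nu> \<kappa> x) \<partial>\<nu>) \<le> (\<integral>x. ?q x - 1 \<partial>\<nu>)"
  proof (rule integral_mono_AE)
    show "AE x in \<nu>. ln (g x) - ln (lratio \<nu> \<kappa> x) \<le> ?q x - 1"
      using gpos AE_lratio_pos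
    proof eventually_elim
      case (elim x)
      then show ?case using ln_le_minus_one[of "?q x"] by (simp add: ln_div)
    qed
  qed (use int int' intq in auto)
  also have "\<dots> = (\<integral>x. ?q x \<partial>\<nu>) - 1" using intq by (simp add: \<nu>.prob_space)
  finally show ?thesis using int int' q1 by simp
qed

text \<open>
On a set where the ratio exceeds \<open>g\<close>, the measure \<open>\<nu> / g\<close> would be strictly larger than \<open>\<kappa>\<close>
unless the set is null.
\<close>

lemma lratio_le:
  fixes g :: "real \<Rightarrow> real"
  assumes [measurable]: "g \<in> borel_measurable borel" and pos: "\<And>x. 0 < g x"
    and le: "\<And>A. A \<in> sets borel \<Longrightarrow> (\<integral>\<^sup>+x. ennreal (1 / g x) * indicator A x \<partial>\<nu>) \<le> emeasure \<kappa> A"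
  shows "AE x in \<nu>. lratio \<nu> \<kappa> x \<le> g x"
proof -
  define A where "A = {x. g x < lratio \<nu> \<kappa> x}"
  have [measurable]: "A \<in> sets borel" unfolding A_def by measurable
  let ?r = "lratio \<nu> \<kappa>"
  have r0: "0 \<le> ?r x" for x by (simp add: lratio_def)
  have "(\<integral>\<^sup>+x. ennreal (?r x / g x) * indicator A x \<partial>\<kappa>) =
     (\<integral>\<^sup>+x. ennreal (?r x) * (ennreal (1 / g x) * indicator A x) \<partial>\<kappa>)"
    by (intro nn_integral_cong) (auto simp: ennreal_mult'[symmetric] r0 mult.assoc[symmetric])
  also have "\<dots> = (\<integral>\<^sup>+x. ennreal (1 / g x) * indicator A x \<partial>\<nu>)"
    by (rule nn_integral_lratio[symmetric]) measurable
  finally have eq: "(\<integral>\<^sup>+x. ennreal (?r x / g x) * indicator A x \<partial>\<kappa>) \<le> emeasure \<kappa> A" 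
    using le[of A] by simp
  have "(\<integral>\<^sup>+x. ennreal (?r x / g x - 1) * indicator A x \<partial>\<kappa>) + emeasure \<kappa> A =
     (\<integral>\<^sup>+x. ennreal (?r x / g x - 1) * indicator A x + indicator A x \<partial>\<kappa>)"
    by (subst nn_integral_add) (auto simp: sets_\<kappa>)
  also have "\<dots> = (\<integral>\<^sup>+x. ennreal (?r x / g x) * indicator A x \<partial>\<kappa>)"
  proof (rule nn_integral_cong)
    fix x
    show "ennreal (?r x / g x - 1) * indicator A x + indicator A x = ennreal (?r x / g x) * indicator A x"
    proof (cases "x \<in> A")
      case True
      then have "1 \<le> ?r x / g x" using pos[of x] by (simp add: A_def field_simps)
      then have "ennreal (?r x / g x - 1) + ennreal 1 = ennreal (?r x / g x)"
        by (subst ennreal_plus[symmetric]) auto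
      then show ?thesis using True by simp
    qed simp
  qed
  also note eq
  finally have "(\<integral>\<^sup>+x. ennreal (?r x / g x - 1) * indicator A x \<partial>\<kappa>) + emeasure \<kappa> A \<le> 0 + emeasure \<kappa> A"
    by simp
  then have "(\<integral>\<^sup>+x. ennreal (?r x / g x - 1) * indicator A x \<partial>\<kappa>) = 0"
    using \<kappa>.emeasure_finite[of A]
    by (metis add.commute ennreal_add_left_cancel_le infinity_ennreal_def le_zero_eq)
  then have "AE x in \<kappa>. ennreal (?r x / g x - 1) * indicator A x = 0"
    by (subst (asm) nn_integral_0_iff_AE) auto
  then have "AE x in \<kappa>. ?r x \<le> g x"
  proof eventually_elim
    case (elim x)
    then show ?case using pos[of x]
      by (auto simp: A_def indicator_def field_simps ennreal_eq_0_iff split: if_splits)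
  qed
  then show ?thesis
    using absolutely_continuous_AE[OF _ ac] sets_\<kappa> sets_\<nu> by auto
qed

end

text \<open>
Upper bounds on the divergence come from this criterion: it suffices that \<open>\<kappa>\<close> dominates the measure
with density \<open>1 / g\<close> with respect to \<open>\<nu>\<close>. Extra mass of \<open>\<kappa>\<close>, such as an added atom, only helps. The
logarithm of the ratio is integrable because it lies between \<open>- 1 / lratio \<nu> \<kappa>\<close> and \<open>ln g\<close>.
\<close>

lemma KL_le:
  fixes g :: "real \<Rightarrow> real"
  assumes "prob_space \<kappa>" "prob_space \<nu>" and s: "sets \<kappa> = sets borel" "sets \<nu> = sets borel"
    and g [measurable]: "g \<in> borel_measurable borel" and pos: "\<And>x. 0 < g x"
    and int: "integrable \<nu> (\<lambda>x. ln (g x))"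
    and le: "\<And>A. A \<in> sets borel \<Longrightarrow> (\<integral>\<^sup>+x. ennreal (1 / g x) * indicator A x \<partial>\<nu>) \<le> emeasure \<kappa> A"
  shows "KL \<nu> \<kappa> \<le> ereal (\<integral>x. ln (g x) \<partial>\<nu>)"
proof -
  note s[measurable_cong]
  have ac: "absolutely_continuous \<kappa> \<nu>"
    unfolding absolutely_continuous_def
  proof
    fix A assume A: "A \<in> null_sets \<kappa>"
    then have [measurable]: "A \<in> sets borel" using s by auto
    have "(\<integral>\<^sup>+x. ennreal (1 / g x) * indicator A x \<partial>\<nu>) = 0"
      using le[of A] A by (auto simp: null_sets_def)
    then have "AE x in \<nu>. ennreal (1 / g x) * indicator A x = 0"
      by (subst (asm) nn_integral_0_iff_AE) auto
    then have "AE x in \<nu>. x \<notin> A"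
    proof eventually_elim
      case (elim x)
      then show ?case using pos[of x] by (auto simp: indicator_def ennreal_eq_0_iff not_le split: if_splits)
    qed
    then show "A \<in> null_sets \<nu>" by (subst (asm) AE_iff_null_sets[symmetric]) (auto simp: s)
  qed
  interpret dominated_pair \<kappa> \<nu>
    using assms ac by (auto simp: dominated_pair_def dominated_pair_axioms_def)
  let ?r = "lratio \<nu> \<kappa>"
  note AE_le = lratio_le[of g, OF g pos le, simplified]
  have i1: "integrable \<nu> (\<lambda>x. 1 / ?r x)"
  proof (rule integrableI_bounded)
    have "(\<integral>\<^sup>+x. ennreal (1 / ?r x) \<partial>\<nu>) \<le> (\<integral>\<^sup>+x. ennreal 1 \<partial>\<kappa>)"
      by (rule nn_integral_divide_lratio_le) auto
    then show "(\<integral>\<^sup>+x. ennreal (norm (1 / ?r x)) \<partial>\<nu>) < \<infinity>"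
      by (auto simp: lratio_def \<kappa>.emeasure_space_1 le_less_trans)
  qed measurable
  have i2: "integrable \<nu> (\<lambda>x. ln (?r x))"
  proof (rule Bochner_Integration.integrable_bound)
    show "integrable \<nu> (\<lambda>x. \<bar>ln (g x)\<bar> + 1 / ?r x)" using int i1 by auto
    show "AE x in \<nu>. norm (ln (?r x)) \<le> norm (\<bar>ln (g x)\<bar> + 1 / ?r x)"
      using AE_le AE_lratio_pos
    proof eventually_elim
      case (elim x)
      have "ln (?r x) \<le> ln (g x)" using elim pos[of x] by simp
      moreover have "- ln (?r x) \<le> 1 / ?r x"
        using ln_le_minus_one[of "1 / ?r x"] elim by (simp add: ln_div)
      moreover have "0 < 1 / ?r x" using elim by simp
      ultimately show ?case by (simp only: real_norm_def)
    qed
  qed measurable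
  have "(\<integral>x. ln (?r x) \<partial>\<nu>) \<le> (\<integral>x. ln (g x) \<partial>\<nu>)"
    by (rule integral_mono_AE[OF i2 int])
       (use AE_le AE_lratio_pos in \<open>eventually_elim, use pos in auto\<close>)
  then show ?thesis using i2 ac by (simp add: KL_lratio)
qed

text \<open>
Lower bounds on the divergence: every nonnegative \<open>g\<close> with expectation at most one under \<open>\<kappa>\<close> is a
bet against \<open>\<kappa>\<close>, and its expected logarithm under \<open>\<nu>\<close> cannot beat that of the likelihood ratio.
\<close>

lemma le_KL:
  fixes g :: "real \<Rightarrow> real"
  assumes "prob_space \<kappa>" "prob_space \<nu>" and s: "sets \<kappa> = sets borel" "sets \<nu> = sets borel"
    and g [measurable]: "g \<in> borel_measurable borel" and pos: "\<And>x. 0 \<le> g x"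
    and gpos: "AE x in \<nu>. 0 < g x"
    and int: "integrable \<nu> (\<lambda>x. ln (g x))"
    and le: "(\<integral>\<^sup>+x. ennreal (g x) \<partial>\<kappa>) \<le> 1"
  shows "ereal (\<integral>x. ln (g x) \<partial>\<nu>) \<le> KL \<nu> \<kappa>"
proof (cases "absolutely_continuous \<kappa> \<nu> \<and> integrable \<nu> (\<lambda>x. ln (lratio \<nu> \<kappa> x))")
  case True
  interpret dominated_pair \<kappa> \<nu>
    using assms True by (auto simp: dominated_pair_def dominated_pair_axioms_def)
  show ?thesis using integral_ln_le_ln_lratio[OF g pos gpos int _ le] True
    by (simp add: KL_lratio)
qed (auto simp: KL_lratio)

text \<open>
If \<open>\<kappa>'\<close> contains \<open>\<kappa>\<close> with weight \<open>r\<close>, the likelihood ratio grows at most by the factor \<open>1 / r\<close>.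
\<close>

lemma KL_mix_le:
  assumes "prob_space \<kappa>" "prob_space \<kappa>'" "prob_space \<nu>"
    and s: "sets \<kappa> = sets borel" "sets \<kappa>' = sets borel" "sets \<nu> = sets borel"
    and r: "0 < r" "r \<le> 1"
    and le: "\<And>A. A \<in> sets borel \<Longrightarrow> ennreal r * emeasure \<kappa> A \<le> emeasure \<kappa>' A"
  shows "KL \<nu> \<kappa>' \<le> KL \<nu> \<kappa> + ereal (ln (1 / r))"
proof (cases "absolutely_continuous \<kappa> \<nu> \<and> integrable \<nu> (\<lambda>x. ln (lratio \<nu> \<kappa> x))")
  case True
  interpret dominated_pair \<kappa> \<nu>
    using assms True by (auto simp: dominated_pair_def dominated_pair_axioms_def)
  let ?g = "\<lambda>x. if 0 < lratio \<nu> \<kappa> x then lratio \<nu> \<kappa> x / r else 1"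
  have ae: "AE x in \<nu>. ln (?g x) = ln (lratio \<nu> \<kappa> x) + ln (1 / r)"
    using AE_lratio_pos by eventually_elim (use r in \<open>auto simp: ln_div\<close>)
  have int: "integrable \<nu> (\<lambda>x. ln (?g x))"
    by (subst integrable_cong_AE[OF _ _ ae]) (use True in auto)
  have eq: "(\<integral>x. ln (?g x) \<partial>\<nu>) = (\<integral>x. ln (lratio \<nu> \<kappa> x) \<partial>\<nu>) + ln (1 / r)"
    by (subst integral_cong_AE[OF _ _ ae]) (use True in \<open>auto simp: \<nu>.prob_space\<close>)
  have "KL \<nu> \<kappa>' \<le> ereal (\<integral>x. ln (?g x) \<partial>\<nu>)"
  proof (rule KL_le)
    fix A :: "real set" assume A [measurable]: "A \<in> sets borel"
    have "(\<integral>\<^sup>+x. ennreal (1 / ?g x) * indicator A x \<partial>\<nu>)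
      = (\<integral>\<^sup>+x. ennreal (lratio \<nu> \<kappa> x) * (ennreal (1 / ?g x) * indicator A x) \<partial>\<kappa>)"
      by (rule nn_integral_lratio) measurable
    also have "\<dots> \<le> (\<integral>\<^sup>+x. ennreal r * indicator A x \<partial>\<kappa>)"
      by (intro nn_integral_mono)
        (use r in \<open>auto simp: indicator_def ennreal_mult'[symmetric] lratio_def\<close>)
    also have "\<dots> = ennreal r * emeasure \<kappa> A" by (auto simp: nn_integral_cmult sets_\<kappa>)
    also have "\<dots> \<le> emeasure \<kappa>' A" using A by (rule le)
    finally show "(\<integral>\<^sup>+x. ennreal (1 / ?g x) * indicator A x \<partial>\<nu>) \<le> emeasure \<kappa>' A" .
  qed (use assms int in \<open>auto\<close>)
  then show ?thesis using eq True by (simp add: KL_lratio)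
qed (auto simp: KL_lratio)

section \<open>Duality for the constrained divergence\<close>

lemma prob_unit_interval_iff:
  "\<nu> \<in> prob_unit_interval \<longleftrightarrow>
     prob_space \<nu> \<and> sets \<nu> = sets borel \<and> (AE x in \<nu>. x \<in> {0..1})"
proof -
  have "measure \<nu> {0..1} = 1 \<longleftrightarrow> (AE x in \<nu>. x \<in> {0..1})" if "prob_space \<nu>" "sets \<nu> = sets borel"
  proof -
    interpret prob_space \<nu> by fact
    show ?thesis by (subst AE_in_set_eq_1) (auto simp: that)
  qed
  then show ?thesis by (auto simp: prob_unit_interval_def)
qed

text \<open>
For \<open>e = 1\<close> and \<open>e = 0\<close> and distributions on the unit interval this is \<open>1 - mean \<nu>\<close> and
\<open>mean \<nu>\<close>, see \<open>gap_mean\<close> below.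
\<close>

definition gap :: "real measure \<Rightarrow> real \<Rightarrow> real" where
  "gap \<nu> e = (\<integral>x. \<bar>x - e\<bar> \<partial>\<nu>)"

definition KL_near :: "real measure \<Rightarrow> real \<Rightarrow> real \<Rightarrow> ereal" where
  "KL_near \<nu> e a = (INF \<kappa>\<in>{\<kappa>\<in>prob_unit_interval. gap \<kappa> e \<le> a}. KL \<nu> \<kappa>)"

text \<open>
The wealth after one round when the fraction \<open>t\<close> of one unit is staked on a ticket that pays
\<open>\<bar>x - e\<bar> / a\<close> per unit. The ticket is fair or unfavourable exactly when the gap is at most \<open>a\<close>.
\<close>

definition bet :: "real \<Rightarrow> real \<Rightarrow> real \<Rightarrow> real \<Rightarrow> real" where
  "bet e a t x = 1 - t + t * (\<bar>x - e\<bar> / a)"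

definition growth :: "real measure \<Rightarrow> real \<Rightarrow> real \<Rightarrow> real \<Rightarrow> real" where
  "growth \<nu> e a t = (\<integral>x. ln (bet e a t x) \<partial>\<nu>)"

text \<open>
Excluding \<open>t = 1\<close> does not change the supremum, but keeps the logarithms bounded, so that the value
is a real number.
\<close>

definition max_growth :: "real measure \<Rightarrow> real \<Rightarrow> real \<Rightarrow> real" where
  "max_growth \<nu> e a = (SUP t\<in>{0..<1}. growth \<nu> e a t)"

text \<open>
The measure with density \<open>h\<close> with respect to \<open>\<nu>\<close>, plus an atom of mass \<open>w\<close> at \<open>e\<close>. It is
encoded as the image of a density on two copies of \<open>\<nu>\<close>, the second of which is collapsed to the
point \<open>e\<close>.
\<close>

definition thin_and_add_atom ::
  "real measure \<Rightarrow> (real \<Rightarrow> real) \<Rightarrow> real \<Rightarrow> real \<Rightarrow> real measure" where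
  "thin_and_add_atom \<nu> h w e =
     distr (density (count_space UNIV \<Otimes>\<^sub>M \<nu>) (\<lambda>(b, x). ennreal (if b then h x else w)))
       borel (\<lambda>(b, x). if b then x else e)"

lemma sets_thin_and_add_atom [simp, measurable_cong]:
  "sets (thin_and_add_atom \<nu> h w e) = sets borel"
  by (simp add: thin_and_add_atom_def)

lemma nn_integral_thin_and_add_atom:
  assumes "prob_space \<nu>" and s [measurable_cong]: "sets \<nu> = sets borel"
    and [measurable]: "h \<in> borel_measurable borel" "f \<in> borel_measurable borel"
  shows "(\<integral>\<^sup>+x. f x \<partial>thin_and_add_atom \<nu> h w e)
    = (\<integral>\<^sup>+x. ennreal (h x) * f x \<partial>\<nu>) + ennreal w * f e"
proof -
  interpret prob_space \<nu> by fact
  have [measurable]: "Measurable.pred (count_space UNIV \<Otimes>\<^sub>M \<nu>) (\<lambda>p. fst p :: bool)"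
    using measurable_fst[of "count_space UNIV" \<nu>] by simp
  have 1: "(\<lambda>(b, x). ennreal (if b then h x else w)) \<in> borel_measurable (count_space UNIV \<Otimes>\<^sub>M \<nu>)"
    unfolding split_beta by measurable
  have 2: "(\<lambda>(b, x). if b then x else e) \<in> (count_space UNIV \<Otimes>\<^sub>M \<nu>) \<rightarrow>\<^sub>M borel"
    unfolding split_beta by measurable
  note 1[measurable] 2[measurable]
  have "(\<integral>\<^sup>+x. f x \<partial>thin_and_add_atom \<nu> h w e)
     = (\<integral>\<^sup>+p. (case p of (b, x) \<Rightarrow> ennreal (if b then h x else w)) * f (case p of (b, x) \<Rightarrow> if b then x else e)
         \<partial>(count_space UNIV \<Otimes>\<^sub>M \<nu>))"
    unfolding thin_and_add_atom_def
    by (subst nn_integral_distr, measurable, subst nn_integral_density) auto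
  also have "\<dots> = (\<integral>\<^sup>+b. \<integral>\<^sup>+x. ennreal (if b then h x else w) * f (if b then x else e) \<partial>\<nu>
      \<partial>count_space UNIV)"
    by (subst nn_integral_fst[symmetric]) auto
  also have "\<dots> = (\<integral>\<^sup>+x. ennreal (h x) * f x \<partial>\<nu>) + ennreal w * f e"
    by (subst nn_integral_count_space_finite) (auto simp: UNIV_bool emeasure_space_1 add.commute)
  finally show ?thesis .
qed

lemma emeasure_thin_and_add_atom:
  assumes "prob_space \<nu>" and s [measurable_cong]: "sets \<nu> = sets borel"
    and "h \<in> borel_measurable borel" and "A \<in> sets borel"
  shows "emeasure (thin_and_add_atom \<nu> h w e) A
    = (\<integral>\<^sup>+x. ennreal (h x) * indicator A x \<partial>\<nu>) + ennreal w * indicator A e"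
proof -
  have "emeasure (thin_and_add_atom \<nu> h w e) A
      = (\<integral>\<^sup>+x. indicator A x \<partial>thin_and_add_atom \<nu> h w e)"
    using assms(4) by simp
  also have "\<dots> = (\<integral>\<^sup>+x. ennreal (h x) * indicator A x \<partial>\<nu>) + ennreal w * indicator A e"
    by (rule nn_integral_thin_and_add_atom[OF assms(1-3)]) (use assms(4) in measurable)
  finally show ?thesis .
qed

lemma thin_and_add_atom_in_unit:
  assumes \<nu>: "\<nu> \<in> prob_unit_interval" and e: "e \<in> {0..1}"
    and [measurable]: "h \<in> borel_measurable borel" and h: "\<And>x. 0 \<le> h x"
    and int: "integrable \<nu> h" and w: "0 \<le> w" and total: "(\<integral>x. h x \<partial>\<nu>) + w = 1"
  shows "thin_and_add_atom \<nu> h w e \<in> prob_unit_interval"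
proof -
  have p: "prob_space \<nu>" and s[measurable_cong]: "sets \<nu> = sets borel" and ae: "AE x in \<nu>. x \<in> {0..1}"
    using \<nu> by (auto simp: prob_unit_interval_iff)
  let ?M = "thin_and_add_atom \<nu> h w e"
  have tot: "(\<integral>\<^sup>+x. ennreal (h x) \<partial>\<nu>) + ennreal w = 1"
    using total int h w
    by (subst nn_integral_eq_integral) (auto simp flip: ennreal_plus simp: integral_nonneg_AE)
  have sp: "space ?M = UNIV" by (simp add: thin_and_add_atom_def)
  have "emeasure ?M (space ?M) = 1"
    unfolding sp using tot by (subst emeasure_thin_and_add_atom[OF p s]) auto
  then interpret M: prob_space ?M by (rule prob_spaceI)
  have "(\<integral>\<^sup>+x. ennreal (h x) * indicator {0..1} x \<partial>\<nu>) = (\<integral>\<^sup>+x. ennreal (h x) \<partial>\<nu>)"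
    by (rule nn_integral_cong_AE) (use ae in \<open>auto simp: indicator_def\<close>)
  then have "emeasure ?M {0..1} = 1"
    using tot e by (subst emeasure_thin_and_add_atom[OF p s]) auto
  then have "measure ?M {0..1} = 1" by (simp add: measure_def)
  then show ?thesis using M.prob_space_axioms by (simp add: prob_unit_interval_def)
qed

lemma gap_eq_nn_integral:
  assumes "\<nu> \<in> prob_unit_interval" "e \<in> {0..1}"
  shows "(\<integral>\<^sup>+x. ennreal \<bar>x - e\<bar> \<partial>\<nu>) = ennreal (gap \<nu> e)" "integrable \<nu> (\<lambda>x. \<bar>x - e\<bar>)"
    "0 \<le> gap \<nu> e" "gap \<nu> e \<le> 1"
proof -
  have p: "prob_space \<nu>" and s[measurable_cong]: "sets \<nu> = sets borel" and ae: "AE x in \<nu>. x \<in> {0..1}"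
    using assms by (auto simp: prob_unit_interval_iff)
  interpret prob_space \<nu> by fact
  have b: "AE x in \<nu>. \<bar>x - e\<bar> \<le> 1" using ae by eventually_elim (use assms in auto)
  show i: "integrable \<nu> (\<lambda>x. \<bar>x - e\<bar>)"
    by (rule integrable_const_bound[where B=1]) (use b in auto)
  show "(\<integral>\<^sup>+x. ennreal \<bar>x - e\<bar> \<partial>\<nu>) = ennreal (gap \<nu> e)"
    unfolding gap_def by (rule nn_integral_eq_integral) (use i in auto)
  show "0 \<le> gap \<nu> e" by (simp add: gap_def)
  have "gap \<nu> e \<le> (\<integral>x. 1 \<partial>\<nu>)" unfolding gap_def
    by (rule integral_mono_AE[OF i]) (use b in auto)
  then show "gap \<nu> e \<le> 1" by (simp add: prob_space)
qed

lemma KL_near_le_KL: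
  assumes "\<kappa> \<in> prob_unit_interval" "gap \<kappa> e \<le> a"
  shows "KL_near \<nu> e a \<le> KL \<nu> \<kappa>"
  unfolding KL_near_def by (rule INF_lower) (use assms in auto)

lemma KL_near_antimono: "a \<le> a' \<Longrightarrow> KL_near \<nu> e a' \<le> KL_near \<nu> e a"
  unfolding KL_near_def by (rule INF_superset_mono) auto

lemma KL_near_neg:
  assumes "e \<in> {0..1}" "a < 0" shows "KL_near \<nu> e a = \<infinity>"
proof -
  have "{\<kappa>\<in>prob_unit_interval. gap \<kappa> e \<le> a} = {}"
    using gap_eq_nn_integral(3)[OF _ assms(1)] assms(2) by force
  then show ?thesis by (simp only: KL_near_def) (simp add: top_ereal_def)
qed

text \<open>
Moving the fraction \<open>1 - a' / a\<close> of a competitor to the point \<open>e\<close> scales its gap from \<open>a\<close> to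
\<open>a'\<close>. The resulting bound makes the constrained divergence continuous in \<open>a\<close>.
\<close>

lemma KL_near_scale:
  assumes \<nu>: "\<nu> \<in> prob_unit_interval" and e: "e \<in> {0..1}" and a: "0 < a'" "a' \<le> a"
  shows "KL_near \<nu> e a' \<le> KL_near \<nu> e a + ereal (ln (a / a'))"
proof -
  define r where "r = a' / a"
  have r: "0 < r" "r \<le> 1" using a by (auto simp: r_def)
  have "KL_near \<nu> e a' - ereal (ln (a / a')) \<le> KL \<nu> \<kappa>"
    if \<kappa>: "\<kappa> \<in> prob_unit_interval" "gap \<kappa> e \<le> a" for \<kappa>
  proof -
    have p: "prob_space \<kappa>" "sets \<kappa> = sets borel" using \<kappa> by (auto simp: prob_unit_interval_iff)
    interpret prob_space \<kappa> by fact
    let ?k = "thin_and_add_atom \<kappa> (\<lambda>_. r) (1 - r) e"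
    have k: "?k \<in> prob_unit_interval"
      by (rule thin_and_add_atom_in_unit) (use \<kappa> e r prob_space in auto)
    note p(2)[measurable_cong]
    have "ennreal (gap ?k e) = ennreal r * ennreal (gap \<kappa> e)"
      unfolding gap_eq_nn_integral(1)[OF k e, symmetric] gap_eq_nn_integral(1)[OF \<kappa>(1) e, symmetric]
      by (subst nn_integral_thin_and_add_atom[OF p]) (auto simp: nn_integral_cmult)
    also have "\<dots> = ennreal (r * gap \<kappa> e)" using r by (simp add: ennreal_mult')
    finally have "gap ?k e = r * gap \<kappa> e"
      using gap_eq_nn_integral(3)[OF k e] gap_eq_nn_integral(3)[OF \<kappa>(1) e] r by simp
    also have "\<dots> \<le> r * a" using \<kappa>(2) r by (intro mult_left_mono) auto
    finally have g: "gap ?k e \<le> a'" using a by (simp add: r_def)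
    have "KL_near \<nu> e a' \<le> KL \<nu> ?k" using k g by (rule KL_near_le_KL)
    also have "\<dots> \<le> KL \<nu> \<kappa> + ereal (ln (1 / r))"
    proof (rule KL_mix_le)
      show "ennreal r * emeasure \<kappa> A \<le> emeasure ?k A" if "A \<in> sets borel" for A
        using that by (subst emeasure_thin_and_add_atom[OF p]) (auto simp: nn_integral_cmult p)
    qed (use \<nu> k p r in \<open>auto simp: prob_unit_interval_iff\<close>)
    also have "ln (1 / r) = ln (a / a')" by (simp add: r_def)
    finally show ?thesis by (simp add: ereal_minus_le)
  qed
  then have "KL_near \<nu> e a' - ereal (ln (a / a')) \<le> KL_near \<nu> e a"
    unfolding KL_near_def[of \<nu> e a] by (intro INF_greatest) auto
  then show ?thesis by (simp add: ereal_minus_le)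
qed

lemma bet_measurable [measurable]: "bet e a t \<in> borel_measurable borel"
  unfolding bet_def by measurable

lemma bet_ge: "0 < a \<Longrightarrow> 0 \<le> t \<Longrightarrow> 1 - t \<le> bet e a t x"
  by (simp add: bet_def)

lemma bet_pos: "0 < a \<Longrightarrow> 0 \<le> t \<Longrightarrow> t < 1 \<Longrightarrow> 0 < bet e a t x"
  using bet_ge[of a t e x] by simp

lemma bet_le:
  assumes "0 < a" "a \<le> 1" "0 \<le> t" "t \<le> 1" "x \<in> {0..1}" "e \<in> {0..1}"
  shows "bet e a t x \<le> 1 / a"
proof -
  have "bet e a t x \<le> (1 - t) * (1 / a) + t * (1 / a)"
    unfolding bet_def
  proof (intro add_mono mult_left_mono)
    show "1 - t \<le> (1 - t) * (1 / a)"
      using assms mult_left_mono[of 1 "1 / a" "1 - t"] by simp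
  qed (use assms in \<open>auto simp: field_simps\<close>)
  then show ?thesis by (simp flip: add_divide_distrib)
qed

locale unit_side =
  fixes \<nu> :: "real measure" and e :: real
  assumes \<nu>: "\<nu> \<in> prob_unit_interval" and e: "e \<in> {0..1}"
begin

sublocale prob_space \<nu> using \<nu> by (auto simp: prob_unit_interval_iff)

lemma sets_\<nu> [measurable_cong]: "sets \<nu> = sets borel"
  and AE_unit: "AE x in \<nu>. x \<in> {0..1}"
  using \<nu> by (auto simp: prob_unit_interval_iff)

lemmas gap_bounds = gap_eq_nn_integral(3,4)[OF \<nu> e]

lemma ln_bet_bounds:
  assumes a: "0 < a" "a \<le> 1" and t: "0 \<le> t" "t < 1" and x: "x \<in> {0..1}"
  shows "ln (1 - t) \<le> ln (bet e a t x)" "ln (bet e a t x) \<le> ln (1 / a)"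
  using bet_ge[of a t e x] bet_pos[of a t e x] bet_le[of a t x e] assms e by auto

lemma integrable_ln_bet:
  assumes a: "0 < a" "a \<le> 1" and t: "0 \<le> t" "t < 1"
  shows "integrable \<nu> (\<lambda>x. ln (bet e a t x))"
proof (rule integrable_const_bound)
  show "AE x in \<nu>. norm (ln (bet e a t x)) \<le> \<bar>ln (1 - t)\<bar> + \<bar>ln (1 / a)\<bar>"
    using AE_unit by eventually_elim (use ln_bet_bounds[OF a t] in force)
qed measurable

lemma growth_le:
  assumes a: "0 < a" "a \<le> 1" and t: "0 \<le> t" "t < 1"
  shows "growth \<nu> e a t \<le> ln (1 / a)"
proof -
  have "growth \<nu> e a t \<le> (\<integral>x. ln (1 / a) \<partial>\<nu>)"
    unfolding growth_def
    by (rule integral_mono_AE[OF integrable_ln_bet[OF assms]])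
      (use AE_unit ln_bet_bounds(2)[OF a t] in auto)
  then show ?thesis by (simp add: prob_space)
qed

lemma growth_bdd: "0 < a \<Longrightarrow> a \<le> 1 \<Longrightarrow> bdd_above (growth \<nu> e a ` {0..<1})"
  by (rule bdd_aboveI2[where M="ln (1 / a)"]) (use growth_le in auto)

lemma growth_le_max_growth:
  "0 < a \<Longrightarrow> a \<le> 1 \<Longrightarrow> 0 \<le> t \<Longrightarrow> t < 1 \<Longrightarrow> growth \<nu> e a t \<le> max_growth \<nu> e a"
  unfolding max_growth_def by (rule cSUP_upper[OF _ growth_bdd]) auto

lemma max_growth_leI:
  assumes "\<And>t. 0 \<le> t \<Longrightarrow> t < 1 \<Longrightarrow> growth \<nu> e a t \<le> v" shows "max_growth \<nu> e a \<le> v"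
  unfolding max_growth_def by (rule cSUP_least) (use assms in auto)

lemma growth_0: "growth \<nu> e a 0 = 0"
  by (simp add: growth_def bet_def)

lemma max_growth_nonneg: "0 < a \<Longrightarrow> a \<le> 1 \<Longrightarrow> 0 \<le> max_growth \<nu> e a"
  using growth_le_max_growth[of a 0] growth_0 by simp

text \<open>
Weak duality: a bet is unfavourable under every feasible competitor.
\<close>

lemma growth_le_KL_near:
  assumes a: "0 < a" "a \<le> 1" and t: "0 \<le> t" "t < 1"
  shows "ereal (growth \<nu> e a t) \<le> KL_near \<nu> e a"
  unfolding KL_near_def
proof (rule INF_greatest)
  fix \<kappa> assume "\<kappa> \<in> {\<kappa>\<in>prob_unit_interval. gap \<kappa> e \<le> a}"
  then have \<kappa>: "\<kappa> \<in> prob_unit_interval" and g: "gap \<kappa> e \<le> a" by auto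
  then have p: "prob_space \<kappa>" and s[measurable_cong]: "sets \<kappa> = sets borel"
    by (auto simp: prob_unit_interval_iff)
  interpret \<kappa>: prob_space \<kappa> by fact
  have i: "integrable \<kappa> (\<lambda>x. \<bar>x - e\<bar>)" using gap_eq_nn_integral(2)[OF \<kappa> e] .
  then have i': "integrable \<kappa> (bet e a t)" unfolding bet_def by auto
  have "(\<integral>x. bet e a t x \<partial>\<kappa>) = 1 - t + t * (gap \<kappa> e / a)"
    using i by (simp add: bet_def gap_def \<kappa>.prob_space)
  also have "\<dots> \<le> 1"
    using g a t mult_left_mono[of "gap \<kappa> e / a" 1 t] by (simp add: field_simps)
  finally have b: "(\<integral>x. bet e a t x \<partial>\<kappa>) \<le> 1" .
  show "ereal (growth \<nu> e a t) \<le> KL \<nu> \<kappa>"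
    unfolding growth_def
  proof (rule le_KL)
    show "(\<integral>\<^sup>+x. ennreal (bet e a t x) \<partial>\<kappa>) \<le> 1"
      using b bet_pos[OF a(1) t] by (subst nn_integral_eq_integral[OF i']) (auto simp: less_imp_le ennreal_le_1)
  qed (use p s sets_\<nu> prob_space_axioms bet_pos[OF a(1) t] integrable_ln_bet[OF a t]
      in \<open>auto simp: less_imp_le\<close>)
qed

lemma max_growth_le_KL_near:
  assumes a: "0 < a" "a \<le> 1"
  shows "ereal (max_growth \<nu> e a) \<le> KL_near \<nu> e a"
proof (cases "KL_near \<nu> e a")
  case (real r)
  then show ?thesis using growth_le_KL_near[OF a] by (auto intro!: max_growth_leI)
next
  case MInf
  then show ?thesis using growth_le_KL_near[OF a, of 0] by auto
qed auto

text \<open>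
Since \<open>bet - 1 = t * (\<bar>x - e\<bar> / a - 1)\<close>, the derivative of \<open>growth\<close> in \<open>t\<close> equals
\<open>(1 - inv_bet a t) / t\<close>. Comparing \<open>inv_bet\<close> with \<open>1\<close> therefore replaces differentiation under the
integral sign.
\<close>

definition inv_bet :: "real \<Rightarrow> real \<Rightarrow> real" where
  "inv_bet a t = (\<integral>x. 1 / bet e a t x \<partial>\<nu>)"

lemma inverse_bet_le: "0 < a \<Longrightarrow> 0 \<le> t \<Longrightarrow> t < 1 \<Longrightarrow> 1 / bet e a t x \<le> 1 / (1 - t)"
  using bet_ge[of a t e x] bet_pos[of a t e x] by (simp add: field_simps)

lemma integrable_inv_bet:
  assumes "0 < a" "0 \<le> t" "t < 1"
  shows "integrable \<nu> (\<lambda>x. 1 / bet e a t x)"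
  by (rule integrable_const_bound[where B="1 / (1 - t)"])
    (use bet_pos[OF assms] inverse_bet_le[OF assms] in \<open>auto simp: less_imp_le\<close>)

text \<open>
The competitor is \<open>\<nu>\<close> divided by the bet, with the missing mass placed at \<open>e\<close>, where it does not
contribute to the gap. At a stationary point of the growth, where \<open>inv_bet a t = 1\<close>, its gap is
exactly \<open>a\<close>.
\<close>

lemma KL_near_le_growth:
  assumes a: "0 < a" "a \<le> 1" and t: "0 < t" "t < 1" and le: "inv_bet a t \<le> 1"
  shows "KL_near \<nu> e (a * (1 - (1 - t) * inv_bet a t) / t) \<le> ereal (growth \<nu> e a t)"
proof -
  let ?h = "\<lambda>x. 1 / bet e a t x"
  let ?k = "thin_and_add_atom \<nu> ?h (1 - inv_bet a t) e"
  have t0: "0 \<le> t" using t by simp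
  note pos = bet_pos[of a t e, OF a(1) t0 t(2)]
  note i = integrable_inv_bet[OF a(1) t0 t(2)]
  have k: "?k \<in> prob_unit_interval"
    by (rule thin_and_add_atom_in_unit[OF \<nu> e])
      (use pos i le in \<open>auto simp: inv_bet_def less_imp_le\<close>)
  have id: "?h x * \<bar>x - e\<bar> = a / t * (1 - (1 - t) * ?h x)" for x
  proof -
    have "bet e a t x - (1 - t) = t / a * \<bar>x - e\<bar>" by (simp add: bet_def)
    moreover have "1 - (1 - t) * ?h x = (bet e a t x - (1 - t)) * ?h x"
      using pos[of x] by (simp add: diff_divide_distrib)
    ultimately show ?thesis using t a by simp
  qed
  have "ennreal (gap ?k e) = (\<integral>\<^sup>+x. ennreal (?h x * \<bar>x - e\<bar>) \<partial>\<nu>)"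
    unfolding gap_eq_nn_integral(1)[OF k e, symmetric] using pos
    by (subst nn_integral_thin_and_add_atom[OF prob_space_axioms sets_\<nu>])
      (auto simp: ennreal_mult''[symmetric] less_imp_le)
  also have "\<dots> = ennreal (\<integral>x. ?h x * \<bar>x - e\<bar> \<partial>\<nu>)"
  proof (rule nn_integral_eq_integral)
    show "integrable \<nu> (\<lambda>x. ?h x * \<bar>x - e\<bar>)" unfolding id
      by (intro integrable_mult_right Bochner_Integration.integrable_diff integrable_const i)
  qed (use pos in \<open>auto simp: less_imp_le\<close>)
  finally have "gap ?k e = (\<integral>x. ?h x * \<bar>x - e\<bar> \<partial>\<nu>)"
    using gap_eq_nn_integral(3)[OF k e] pos
    by (subst (asm) ennreal_inj) (auto simp: less_imp_le intro!: integral_nonneg_AE)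
  also have "\<dots> = a / t * (1 - (1 - t) * inv_bet a t)"
  proof -
    have "(\<integral>x. 1 - (1 - t) * ?h x \<partial>\<nu>) = 1 - (1 - t) * inv_bet a t"
      unfolding inv_bet_def by (subst Bochner_Integration.integral_diff)
        (auto simp: prob_space i intro!: integrable_mult_right simp del: times_divide_eq_right)
    then show ?thesis unfolding id by (simp only: integral_mult_right_zero)
  qed
  finally have g: "gap ?k e \<le> a * (1 - (1 - t) * inv_bet a t) / t" by simp
  have "KL_near \<nu> e (a * (1 - (1 - t) * inv_bet a t) / t) \<le> KL \<nu> ?k"
    using k g by (rule KL_near_le_KL)
  also have "\<dots> \<le> ereal (growth \<nu> e a t)"
    unfolding growth_def
  proof (rule KL_le)
    show "(\<integral>\<^sup>+x. ennreal (1 / bet e a t x) * indicator A x \<partial>\<nu>) \<le> emeasure ?k A" if "A \<in> sets borel" for A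
      using that by (subst emeasure_thin_and_add_atom[OF prob_space_axioms sets_\<nu>]) auto
  qed (use k sets_\<nu> prob_space_axioms pos integrable_ln_bet[OF a t0 t(2)] in \<open>auto simp: prob_unit_interval_iff\<close>)
  finally show ?thesis .
qed

lemma continuous_on_inv_bet:
  assumes a: "0 < a" and v: "v < 1"
  shows "continuous_on {0..v} (inv_bet a)"
  unfolding continuous_on_sequentially comp_def
proof safe
  fix u :: "nat \<Rightarrow> real" and l assume l: "l \<in> {0..v}" and u: "\<forall>n. u n \<in> {0..v}" "u \<longlonglongrightarrow> l"
  show "(\<lambda>n. inv_bet a (u n)) \<longlonglongrightarrow> inv_bet a l"
    unfolding inv_bet_def
  proof (rule integral_dominated_convergence)
    show "integrable \<nu> (\<lambda>_. 1 / (1 - v))" by simp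
    show "AE x in \<nu>. (\<lambda>n. 1 / bet e a (u n) x) \<longlonglongrightarrow> 1 / bet e a l x"
    proof (rule AE_I2)
      fix x
      have "bet e a l x \<noteq> 0" using bet_pos[of a l e x] l v a by auto
      then show "(\<lambda>n. 1 / bet e a (u n) x) \<longlonglongrightarrow> 1 / bet e a l x"
        unfolding bet_def by (intro tendsto_intros u) auto
    qed
    show "AE x in \<nu>. norm (1 / bet e a (u n) x) \<le> 1 / (1 - v)" for n
    proof (rule AE_I2)
      fix x
      have un: "0 \<le> u n" "u n \<le> v" using u by auto
      have "1 / bet e a (u n) x \<le> 1 / (1 - u n)" using inverse_bet_le[of a "u n" x] a un v by simp
      also have "\<dots> \<le> 1 / (1 - v)" using un v by (simp add: field_simps)
      finally show "norm (1 / bet e a (u n) x) \<le> 1 / (1 - v)"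
        using bet_pos[of a "u n" e x] a un v by simp
    qed
  qed measurable
qed

text \<open>
If the gap of \<open>\<nu>\<close> exceeds \<open>a\<close>, the bet is favourable, and the growth increases for small \<open>t\<close>. The
range of \<open>t\<close> comes from the expansion \<open>1 / (1 + u) = 1 - u + u\<^sup>2 / (1 + u)\<close> with
\<open>u = t * (\<bar>x - e\<bar> / a - 1)\<close>.
\<close>

lemma inv_bet_less_1:
  assumes a: "0 < a" "a < gap \<nu> e"
  obtains t where "0 < t" "t < 1" "inv_bet a t < 1" "\<And>u. 0 < u \<Longrightarrow> u \<le> t \<Longrightarrow> inv_bet a u < 1"
proof -
  define d where "d = gap \<nu> e / a - 1"
  have d: "0 < d" using a by (simp add: d_def field_simps)
  (* 1/2 keeps the bet away from 0; the second bound makes the quadratic term of the expansion,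
     at most 2 * u^2 / a^2, at most half of the linear term u * d. *)
  define t where "t = min (1/2) (d * a\<^sup>2 / 4)"
  have a1: "a \<le> 1" using a gap_bounds by simp
  have t: "0 < t" "t \<le> 1/2" "t \<le> d * a\<^sup>2 / 4" using d a by (auto simp: t_def)
  have *: "inv_bet a u < 1" if u: "0 < u" "u \<le> t" for u
  proof -
    have u1: "u < 1" "u \<le> 1/2" "0 \<le> u" using u t by auto
    have pt: "1 / bet e a u x \<le> 1 - u * (\<bar>x - e\<bar> / a - 1) + 2 * u\<^sup>2 * (1 / a)\<^sup>2" if x: "x \<in> {0..1}" for x
    proof -
      define y where "y = \<bar>x - e\<bar> / a - 1"
      have b: "bet e a u x = 1 + u * y" by (simp add: bet_def y_def algebra_simps)
      have p: "1 / 2 \<le> 1 + u * y" using bet_ge[of a u e x] u u1 a b by simp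
      have "0 \<le> \<bar>x - e\<bar> / a" "\<bar>x - e\<bar> / a \<le> 1 / a" using x e a by (auto simp: field_simps)
      moreover have "1 \<le> 1 / a" using a a1 by simp
      ultimately have "\<bar>y\<bar> \<le> 1 / a" unfolding y_def by linarith
      then have y2: "y\<^sup>2 \<le> (1 / a)\<^sup>2" using power_mono[of "\<bar>y\<bar>" "1/a" 2] by simp
      have "1 / (1 + u * y) = 1 - u * y + u\<^sup>2 * y\<^sup>2 / (1 + u * y)"
        using p by (simp add: field_simps power2_eq_square)
      also have "u\<^sup>2 * y\<^sup>2 / (1 + u * y) \<le> u\<^sup>2 * y\<^sup>2 / (1/2)"
        using p by (intro divide_left_mono) auto
      also have "\<dots> \<le> 2 * u\<^sup>2 * (1 / a)\<^sup>2" using mult_left_mono[OF y2, of "2 * u\<^sup>2"] by simp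
      finally show ?thesis by (simp add: b y_def)
    qed
    have i: "integrable \<nu> (\<lambda>x. \<bar>x - e\<bar>)" by (rule gap_eq_nn_integral(2)[OF \<nu> e])
    have "inv_bet a u \<le> (\<integral>x. 1 - u * (\<bar>x - e\<bar> / a - 1) + 2 * u\<^sup>2 * (1 / a)\<^sup>2 \<partial>\<nu>)"
      unfolding inv_bet_def
      by (rule integral_mono_AE[OF integrable_inv_bet]) (use a u u1 i pt AE_unit in auto)
    also have "\<dots> = 1 - u * d + 2 * u\<^sup>2 * (1 / a)\<^sup>2"
      using i by (simp add: prob_space d_def gap_def)
    also have "\<dots> = 1 - u * (d - 2 * u / a\<^sup>2)" by (simp add: field_simps power2_eq_square)
    also have "\<dots> < 1"
    proof -
      have "2 * u \<le> d * a\<^sup>2 / 2" using u t by simp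
      then have "2 * u / a\<^sup>2 \<le> d / 2" using a by (simp add: field_simps)
      then show ?thesis using u d by simp
    qed
    finally show ?thesis .
  qed
  show ?thesis by (rule that[of t]) (use t * in auto)
qed

lemma KL_near_gap: "KL_near \<nu> e (gap \<nu> e) \<le> 0"
proof -
  have "KL_near \<nu> e (gap \<nu> e) \<le> KL \<nu> \<nu>" by (rule KL_near_le_KL) (use \<nu> in auto)
  also have "\<dots> \<le> ereal (\<integral>x. ln 1 \<partial>\<nu>)"
    by (rule KL_le) (use prob_space_axioms sets_\<nu> in auto)
  finally show ?thesis by (simp add: zero_ereal_def)
qed

text \<open>
Strong duality. If the growth is stationary at some \<open>t\<close> below \<open>1\<close>, the competitor of
\<open>KL_near_le_growth\<close> is feasible and closes the gap. Otherwise, by the intermediate value theorem,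
\<open>inv_bet\<close> stays below \<open>1\<close>, so the growth increases up to the boundary \<open>t = 1\<close>. There the competitor
has gap at most \<open>a / t\<close>, and repairing this by \<open>KL_near_scale\<close> costs only \<open>ln (1 / t)\<close>, which
vanishes as \<open>t\<close> tends to \<open>1\<close>.
\<close>

theorem KL_near_eq_max_growth:
  assumes a: "0 < a" "a \<le> gap \<nu> e"
  shows "KL_near \<nu> e a = ereal (max_growth \<nu> e a)"
proof (rule antisym)
  have a1: "a \<le> 1" using a gap_bounds by simp
  show "ereal (max_growth \<nu> e a) \<le> KL_near \<nu> e a" using a(1) a1 by (rule max_growth_le_KL_near)
  show "KL_near \<nu> e a \<le> ereal (max_growth \<nu> e a)"
  proof (cases "a = gap \<nu> e")
    case True
    have "ereal 0 \<le> ereal (max_growth \<nu> e a)" using max_growth_nonneg[OF a(1) a1] by simp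
    then show ?thesis using KL_near_gap unfolding True[symmetric] zero_ereal_def
      by (rule order_trans[rotated])
  next
    case False
    then have less: "a < gap \<nu> e" using a by simp
    obtain s where s: "0 < s" "s < 1" "inv_bet a s < 1" by (rule inv_bet_less_1[OF a(1) less])
    show ?thesis
    proof (cases "\<exists>t\<in>{0<..<1}. inv_bet a t = 1")
      case True
      then obtain t where t: "0 < t" "t < 1" "inv_bet a t = 1" by auto
      have "KL_near \<nu> e a \<le> ereal (growth \<nu> e a t)"
        using KL_near_le_growth[OF a(1) a1 t(1,2)] t by simp
      also have "\<dots> \<le> ereal (max_growth \<nu> e a)" using growth_le_max_growth[OF a(1) a1] t by simp
      finally show ?thesis .
    next
      case False
      have lt: "inv_bet a t < 1" if t: "0 < t" "t < 1" for t
      proof (rule ccontr)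
        assume "\<not> inv_bet a t < 1"
        then have gt: "1 < inv_bet a t" using False t by force
        have conn: "connected (inv_bet a ` {min s t..max s t})"
        proof (rule connected_continuous_image)
          have "max s t < 1" "0 \<le> min s t" using s t by auto
          then show "continuous_on {min s t..max s t} (inv_bet a)"
            by (intro continuous_on_subset[OF continuous_on_inv_bet[OF a(1), of "max s t"]]) auto
        qed simp
        have mem: "inv_bet a s \<in> inv_bet a ` {min s t..max s t}"
          "inv_bet a t \<in> inv_bet a ` {min s t..max s t}" by auto
        have "1 \<in> inv_bet a ` {min s t..max s t}"
          using s(3) gt by (intro connectedD_interval[OF conn mem]) auto
        then obtain u where "u \<in> {min s t..max s t}" "inv_bet a u = 1" by (metis imageE)
        then have "0 < u" "u < 1" "inv_bet a u = 1" using s t by auto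
        then show False using False by (metis greaterThanLessThan_iff)
      qed
      have "KL_near \<nu> e a \<le> ereal (max_growth \<nu> e a + ln (1 / t))" if t: "0 < t" "t < 1" for t
      proof -
        let ?a' = "a * (1 - (1 - t) * inv_bet a t) / t"
        have "0 \<le> inv_bet a t" unfolding inv_bet_def
          by (intro integral_nonneg_AE AE_I2) (use bet_pos[of a t e] a t in \<open>auto simp: less_imp_le\<close>)
        then have "?a' \<le> a / t" using a t by (intro divide_right_mono) (auto simp: mult_le_cancel_left1)
        have "KL_near \<nu> e a \<le> KL_near \<nu> e (a / t) + ereal (ln (a / t / a))"
          using a t by (intro KL_near_scale[OF \<nu> e]) (auto simp: field_simps)
        also have "\<dots> \<le> KL_near \<nu> e ?a' + ereal (ln (a / t / a))"
          by (intro add_right_mono KL_near_antimono) fact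
        also have "\<dots> \<le> ereal (growth \<nu> e a t) + ereal (ln (a / t / a))"
          using lt[OF t] by (intro add_right_mono KL_near_le_growth[OF a(1) a1 t]) auto
        also have "\<dots> \<le> ereal (max_growth \<nu> e a + ln (1 / t))"
          using growth_le_max_growth[OF a(1) a1, of t] t a by simp
        finally show ?thesis .
      qed
      then have ev: "\<forall>\<^sub>F t in at_left 1. KL_near \<nu> e a \<le> ereal (max_growth \<nu> e a + ln (1 / t))"
        using eventually_at_left_real[of 0 "1::real"] by (auto elim!: eventually_mono)
      have "((\<lambda>t. ereal (max_growth \<nu> e a + ln (1 / t))) \<longlongrightarrow> ereal (max_growth \<nu> e a + ln (1 / 1))) (at_left 1)"
        by (intro tendsto_intros) auto
      then show ?thesis using tendsto_lowerbound[OF _ ev] by simp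
    qed
  qed
qed

section \<open>Monotonicity and solvability of the dual problem\<close>

lemma max_growth_pos:
  assumes a: "0 < a" "a < gap \<nu> e"
  shows "0 < max_growth \<nu> e a"
proof -
  have a1: "a \<le> 1" using a gap_bounds by simp
  obtain t where t: "0 < t" "t < 1" "inv_bet a t < 1" by (rule inv_bet_less_1[OF a])
  have "1 - inv_bet a t = (\<integral>x. 1 - 1 / bet e a t x \<partial>\<nu>)"
    using integrable_inv_bet[of a t] a t unfolding inv_bet_def
    by (subst Bochner_Integration.integral_diff) (auto simp: prob_space)
  also have "\<dots> \<le> growth \<nu> e a t"
    unfolding growth_def
  proof (rule integral_mono)
    show "1 - 1 / bet e a t x \<le> ln (bet e a t x)" for x
      using ln_le_minus_one[of "1 / bet e a t x"] bet_pos[of a t e x] a t by (simp add: ln_div)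
  qed (use integrable_inv_bet[of a t] integrable_ln_bet[of a t] a a1 t in auto)
  also have "\<dots> \<le> max_growth \<nu> e a" using growth_le_max_growth a a1 t by simp
  finally show ?thesis using t by simp
qed

lemma growth_le_linear:
  assumes a: "0 < a" "a \<le> 1" and t: "0 \<le> t" "t < 1"
  shows "growth \<nu> e a t \<le> t / a"
proof -
  have i: "integrable \<nu> (\<lambda>x. \<bar>x - e\<bar>)" by (rule gap_eq_nn_integral(2)[OF \<nu> e])
  then have ib: "integrable \<nu> (bet e a t)" unfolding bet_def by auto
  have "growth \<nu> e a t \<le> (\<integral>x. bet e a t x - 1 \<partial>\<nu>)"
    unfolding growth_def
    by (rule integral_mono[OF integrable_ln_bet[OF a t]])
      (use ib ln_le_minus_one bet_pos a t in auto)
  also have "\<dots> = t * (gap \<nu> e / a) - t" using i by (simp add: bet_def gap_def prob_space)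
  also have "\<dots> \<le> t * (1 / a)"
  proof -
    have "gap \<nu> e / a \<le> 1 / a" using a gap_bounds by (intro divide_right_mono) auto
    then have "t * (gap \<nu> e / a) \<le> t * (1 / a)" using t by (intro mult_left_mono) auto
    then show ?thesis using t by simp
  qed
  finally show ?thesis by simp
qed

text \<open>
A bet at the level \<open>a'\<close> with stake \<open>t\<close> is, up to the constant factor \<open>1 - q\<close> below one, a bet at the
cheaper level \<open>a\<close> with another stake \<open>t'\<close>. The gain \<open>- ln (1 - q)\<close> is bounded away from zero,
because by \<open>growth_le_linear\<close> only stakes bounded away from zero come near a positive supremum.
\<close>

lemma max_growth_strict_antimono:
  assumes a: "0 < a" "a < a'" "a' \<le> gap \<nu> e"
  shows "max_growth \<nu> e a' < max_growth \<nu> e a"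
proof (cases "max_growth \<nu> e a' = 0")
  case True
  then show ?thesis using max_growth_pos[of a] a by simp
next
  case False
  have a1: "a \<le> 1" "a' \<le> 1" "0 < a'" using a gap_bounds by auto
  define d where "d = max_growth \<nu> e a' / 2"
  have d: "0 < d" using False max_growth_nonneg[of a'] a1 by (simp add: d_def)
  define s where "s = a' * d * (1 - a / a')"
  have s: "0 < s" using d a a1 by (simp add: s_def)
  have "max_growth \<nu> e a' \<le> max d (max_growth \<nu> e a - s)"
  proof (rule max_growth_leI)
    fix t :: real assume t: "0 \<le> t" "t < 1"
    show "growth \<nu> e a' t \<le> max d (max_growth \<nu> e a - s)"
    proof (cases "growth \<nu> e a' t \<le> d")
      case False
      (* t' and 1 / (1 - q) are determined by bet e a t' = bet e a' t / (1 - q). *)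
      define q where "q = t * (1 - a / a')"
      define t' where "t' = t * (a / a') / (1 - q)"
      have rho: "0 < 1 - a / a'" "1 - a / a' < 1" "0 < a / a'" using a a1 by auto
      have q: "0 \<le> q" "q < 1"
      proof -
        show "0 \<le> q" using rho t by (simp add: q_def)
        have "q \<le> t" using mult_left_mono[of "1 - a / a'" 1 t] t rho by (simp add: q_def)
        then show "q < 1" using t by simp
      qed
      have t'1: "1 - t' = (1 - t) / (1 - q)"
      proof -
        have "1 - t' = ((1 - q) - t * (a / a')) / (1 - q)"
          using q by (simp add: t'_def diff_divide_distrib)
        also have "(1 - q) - t * (a / a') = 1 - t" by (simp add: q_def algebra_simps)
        finally show ?thesis .
      qed
      have t': "0 \<le> t'" "t' < 1"
      proof -
        show "0 \<le> t'" unfolding t'_def using t q a by (intro divide_nonneg_pos mult_nonneg_nonneg) auto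
        have "0 < 1 - t'" unfolding t'1 using t q by simp
        then show "t' < 1" by simp
      qed
      have bet: "bet e a t' x = bet e a' t x / (1 - q)" for x
      proof -
        have "t' * (\<bar>x - e\<bar> / a) = t * (\<bar>x - e\<bar> / a') / (1 - q)"
          using a q by (simp add: t'_def field_simps)
        then show ?thesis unfolding bet_def t'1 by (simp add: add_divide_distrib)
      qed
      have "t / a' > d" using False growth_le_linear[of a' t] a1 t by simp
      then have "a' * d \<le> t" using a1 by (simp add: field_simps)
      then have sq: "s \<le> q" unfolding s_def q_def using rho by (intro mult_right_mono) auto
      have "growth \<nu> e a t' = growth \<nu> e a' t - ln (1 - q)"
        unfolding growth_def bet
        using bet_pos[of a' t e] a1 t q integrable_ln_bet[of a' t]
        by (simp add: ln_div less_imp_neq[symmetric] prob_space)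
      moreover have "ln (1 - q) \<le> - q" using ln_le_minus_one[of "1 - q"] q by simp
      ultimately have "growth \<nu> e a' t \<le> growth \<nu> e a t' - s" using sq by simp
      also have "\<dots> \<le> max_growth \<nu> e a - s" using growth_le_max_growth[of a t'] a a1 t' by simp
      finally show ?thesis by simp
    qed simp
  qed
  moreover have "d < max_growth \<nu> e a'" using d by (simp add: d_def)
  ultimately show ?thesis using s by (auto simp: max_def split: if_splits)
qed

lemma max_growth_antimono:
  "0 < a \<Longrightarrow> a \<le> a' \<Longrightarrow> a' \<le> gap \<nu> e \<Longrightarrow> max_growth \<nu> e a' \<le> max_growth \<nu> e a"
  using max_growth_strict_antimono[of a a'] by (cases "a = a'") auto

lemma max_growth_scale:
  assumes a: "0 < a" "a \<le> a'" "a' \<le> gap \<nu> e"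
  shows "max_growth \<nu> e a \<le> max_growth \<nu> e a' + ln (a' / a)"
  using KL_near_scale[OF \<nu> e a(1,2)] a by (simp add: KL_near_eq_max_growth)

lemma max_growth_gap: "0 < gap \<nu> e \<Longrightarrow> max_growth \<nu> e (gap \<nu> e) = 0"
  using KL_near_gap KL_near_eq_max_growth[of "gap \<nu> e"] max_growth_nonneg[of "gap \<nu> e"] gap_bounds
  by (simp add: zero_ereal_def)

text \<open>
Staking one half loses at most the factor \<open>1 / 2\<close>, and wins at least \<open>c / (2 * a)\<close> on the event
\<open>c < \<bar>x - e\<bar>\<close>, which has positive probability.
\<close>

lemma max_growth_unbounded:
  assumes "0 < gap \<nu> e"
  shows "\<exists>a. 0 < a \<and> a < gap \<nu> e \<and> v < max_growth \<nu> e a"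
proof -
  have "\<not> (AE x in \<nu>. \<bar>x - e\<bar> \<le> gap \<nu> e / 2)"
  proof
    assume *: "AE x in \<nu>. \<bar>x - e\<bar> \<le> gap \<nu> e / 2"
    have "gap \<nu> e \<le> (\<integral>x. gap \<nu> e / 2 \<partial>\<nu>)"
      unfolding gap_def[of \<nu> e] by (rule integral_mono_AE) (use * gap_eq_nn_integral(2)[OF \<nu> e] in \<open>auto simp: gap_def\<close>)
    then show False using assms by (simp add: prob_space)
  qed
  define c where "c = gap \<nu> e / 2"
  define S where "S = {x. c < \<bar>x - e\<bar>}"
  have [measurable]: "S \<in> sets borel" unfolding S_def by measurable
  define p where "p = prob S"
  have c: "0 < c" using assms by (simp add: c_def)
  have "emeasure \<nu> S \<noteq> 0"
  proof
    assume "emeasure \<nu> S = 0"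
    then have "AE x in \<nu>. x \<notin> S" by (intro AE_not_in) (auto simp: null_sets_def sets_\<nu>)
    then have "AE x in \<nu>. \<bar>x - e\<bar> \<le> gap \<nu> e / 2"
      by eventually_elim (auto simp: S_def c_def)
    then show False using \<open>\<not> (AE x in \<nu>. \<bar>x - e\<bar> \<le> gap \<nu> e / 2)\<close> by contradiction
  qed
  then have p: "0 < p" unfolding p_def by (simp add: emeasure_eq_measure zero_less_measure_iff)
  (* Chosen such that p * ln (c / a) is at least |v| + 1 + ln 2; the term ln 2 pays for the
     factor 1 / 2 that is lost when half of the wealth is not staked. *)
  define a where "a = min c (c / exp ((\<bar>v\<bar> + 1 + ln 2) / p))"
  have a: "0 < a" "a \<le> c" "a < gap \<nu> e" using c by (auto simp: a_def c_def)
  have a1: "a \<le> 1" using a gap_bounds by simp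
  have "exp ((\<bar>v\<bar> + 1 + ln 2) / p) \<le> c / a"
  proof -
    have "a \<le> c / exp ((\<bar>v\<bar> + 1 + ln 2) / p)" by (simp add: a_def)
    then show ?thesis using a by (simp add: field_simps)
  qed
  then have "(\<bar>v\<bar> + 1 + ln 2) / p \<le> ln (c / a)"
    using a c by (subst ln_ge_iff) auto
  then have big: "\<bar>v\<bar> + 1 + ln 2 \<le> p * ln (c / a)" using p by (simp add: field_simps)
  have intS: "integrable \<nu> (indicat_real S)" by (rule integrable_const_bound[where B=1]) auto
  then have "- ln 2 + p * ln (c / a) = (\<integral>x. - ln 2 + indicator S x * ln (c / a) \<partial>\<nu>)"
    by (subst Bochner_Integration.integral_add) (auto simp: prob_space p_def sets_\<nu>)
  also have "\<dots> \<le> growth \<nu> e a (1/2)"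
    unfolding growth_def
  proof (rule integral_mono)
    show "- ln 2 + indicator S x * ln (c / a) \<le> ln (bet e a (1/2) x)" for x
    proof (cases "x \<in> S")
      case True
      have "(1/2) * (c / a) \<le> bet e a (1/2) x"
      proof -
        have "c / a \<le> \<bar>x - e\<bar> / a" using True a by (intro divide_right_mono) (auto simp: S_def)
        then show ?thesis unfolding bet_def by simp
      qed
      then have "ln ((1/2) * (c / a)) \<le> ln (bet e a (1/2) x)" using a c by (intro ln_mono) auto
      moreover have "ln ((1/2) * (c / a)) = ln (1/2) + ln (c / a)" using a c by (intro ln_mult_pos) auto
      ultimately show ?thesis using True by (simp add: ln_div)
    next
      case False
      have "ln (1/2) \<le> ln (bet e a (1/2) x)" using bet_ge[of a "1/2" e x] a by (intro ln_mono) auto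
      then show ?thesis using False by (simp add: ln_div)
    qed
  qed (use integrable_ln_bet[of a "1/2"] a a1 intS in auto)
  also have "\<dots> \<le> max_growth \<nu> e a" using growth_le_max_growth[of a "1/2"] a a1 by simp
  finally have "v < max_growth \<nu> e a" using big by linarith
  then show ?thesis using a by auto
qed

lemma continuous_on_max_growth: "continuous_on {0<..gap \<nu> e} (max_growth \<nu> e)"
  unfolding continuous_on_def
proof
  fix a assume a: "a \<in> {0<..gap \<nu> e}"
  show "(max_growth \<nu> e \<longlongrightarrow> max_growth \<nu> e a) (at a within {0<..gap \<nu> e})"
  proof (rule LIM_zero_cancel, rule Lim_null_comparison)
    show "\<forall>\<^sub>F x in at a within {0<..gap \<nu> e}. norm (max_growth \<nu> e x - max_growth \<nu> e a) \<le> norm (ln x - ln a)"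
      unfolding eventually_at_filter
    proof (rule always_eventually, safe)
      fix x assume x: "x \<in> {0<..gap \<nu> e}"
      show "norm (max_growth \<nu> e x - max_growth \<nu> e a) \<le> norm (ln x - ln a)"
      proof (cases "x \<le> a")
        case True
        then show ?thesis using max_growth_scale[of x a] max_growth_antimono[of x a] a x by (simp add: ln_div)
      next
        case False
        then show ?thesis using max_growth_scale[of a x] max_growth_antimono[of a x] a x by (simp add: ln_div)
      qed
    qed
    show "((\<lambda>x. norm (ln x - ln a)) \<longlongrightarrow> 0) (at a within {0<..gap \<nu> e})"
      using a by (intro tendsto_norm_zero LIM_zero tendsto_intros) auto
  qed
qed

lemma ex_max_growth_eq:
  assumes "0 < gap \<nu> e" "0 < v"
  shows "\<exists>a. 0 < a \<and> a < gap \<nu> e \<and> max_growth \<nu> e a = v"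
proof -
  obtain a0 where a0: "0 < a0" "a0 < gap \<nu> e" "v < max_growth \<nu> e a0"
    using max_growth_unbounded[OF assms(1)] by auto
  have "\<exists>a\<ge>a0. a \<le> gap \<nu> e \<and> max_growth \<nu> e a = v"
    by (rule IVT2') (use a0 assms max_growth_gap in \<open>auto intro: continuous_on_subset[OF continuous_on_max_growth]\<close>)
  then obtain a where a: "a0 \<le> a" "a \<le> gap \<nu> e" "max_growth \<nu> e a = v" by auto
  then have "a \<noteq> gap \<nu> e" using max_growth_gap assms by auto
  then show ?thesis using a a0 by (intro exI[of _ a]) auto
qed

lemma KL_near_eq_realD:
  assumes "0 < gap \<nu> e" "a < gap \<nu> e" "KL_near \<nu> e a = ereal v"
  shows "0 < a \<and> max_growth \<nu> e a = v"
proof -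
  have "0 < a"
  proof (rule ccontr)
    assume "\<not> 0 < a"
    obtain a' where "0 < a'" "a' < gap \<nu> e" "v < max_growth \<nu> e a'"
      using max_growth_unbounded[OF assms(1)] by auto
    moreover from this have "KL_near \<nu> e a' \<le> KL_near \<nu> e a"
      using \<open>\<not> 0 < a\<close> by (intro KL_near_antimono) auto
    ultimately show False using assms(3) by (simp add: KL_near_eq_max_growth)
  qed
  then show ?thesis using assms KL_near_eq_max_growth[of a] by simp
qed

text \<open>
The candidate \<open>a\<close> is not assumed to be positive: at \<open>0\<close> and below the constrained divergence is
infinite.
\<close>

theorem ex1_KL_near:
  assumes "0 < gap \<nu> e" "0 < v"
  shows "\<exists>!a. a < gap \<nu> e \<and> KL_near \<nu> e a = ereal v"
proof -
  obtain a where a: "0 < a" "a < gap \<nu> e" "max_growth \<nu> e a = v"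
    using ex_max_growth_eq[OF assms] by auto
  show ?thesis
  proof (rule ex1I[of _ a])
    show "a < gap \<nu> e \<and> KL_near \<nu> e a = ereal v" using a by (simp add: KL_near_eq_max_growth)
    fix a' assume "a' < gap \<nu> e \<and> KL_near \<nu> e a' = ereal v"
    then have a': "0 < a'" "a' < gap \<nu> e" "max_growth \<nu> e a' = v"
      using KL_near_eq_realD[OF assms(1), of a' v] by auto
    show "a' = a"
      using max_growth_strict_antimono[of a a'] max_growth_strict_antimono[of a' a] a a' by fastforce
  qed
qed

end

section \<open>A finite grid of bets\<close>

text \<open>
Rounding \<open>N * t\<close> up to \<open>j\<close> gives a bet whose two coefficients \<open>1 - j / (N + 1)\<close> and
\<open>j / (N + 1)\<close> are both at least \<open>N / (N + 1)\<close> times the original ones. The same grid serves the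
coverage bound, the law of large numbers and measurability.
\<close>

lemma bet_le_grid:
  assumes N: "0 < N" and t: "0 \<le> t" "t \<le> 1" and a: "0 < a"
  shows "\<exists>j\<le>N. \<forall>x. bet e a t x \<le> (1 + 1 / real N) * bet e a (real j / real (N + 1)) x"
proof -
  define j where "j = nat \<lceil>real N * t\<rceil>"
  have j1: "real N * t \<le> real j" "real j \<le> real N * t + 1"
    using t of_int_ceiling_le_add_one[of "real N * t"] by (auto simp: j_def)
  have "real N * t \<le> real N" using t mult_left_mono[of t 1 "real N"] by simp
  then have jN: "j \<le> N" unfolding j_def by (simp add: ceiling_le_iff)
  have 1: "1 - t \<le> (1 + 1 / real N) * (1 - real j / real (N + 1))"
  proof -
    have "1 - real j / real (N + 1) = (real (N + 1) - real j) / real (N + 1)"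
      by (simp add: diff_divide_distrib)
    moreover have "1 + 1 / real N = real (N + 1) / real N" using N by (simp add: field_simps)
    ultimately have "(1 + 1 / real N) * (1 - real j / real (N + 1)) = (real (N + 1) - real j) / real N"
      by simp
    moreover have "1 - t \<le> (real (N + 1) - real j) / real N" using N j1 by (simp add: field_simps)
    ultimately show ?thesis by simp
  qed
  have 2: "t \<le> (1 + 1 / real N) * (real j / real (N + 1))"
  proof -
    have "1 + 1 / real N = real (N + 1) / real N" using N by (simp add: field_simps)
    then have "(1 + 1 / real N) * (real j / real (N + 1)) = real j / real N" by simp
    moreover have "t \<le> real j / real N" using N j1 by (simp add: field_simps)
    ultimately show ?thesis by simp
  qed
  have "bet e a t x \<le> (1 + 1 / real N) * bet e a (real j / real (N + 1)) x" for x
  proof -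
    have "0 \<le> \<bar>x - e\<bar> / a" using a by simp
    from mult_right_mono[OF 2 this] 1 show ?thesis
      unfolding bet_def by (simp add: distrib_left)
  qed
  then show ?thesis using jN by auto
qed

lemma (in unit_side) growth_le_grid:
  assumes N: "0 < N" and t: "0 \<le> t" "t < 1" and a: "0 < a" "a \<le> 1"
  shows "\<exists>j\<le>N. growth \<nu> e a t \<le> growth \<nu> e a (real j / real (N + 1)) + ln (1 + 1 / real N)"
proof -
  obtain j where j: "j \<le> N"
      "\<And>x. bet e a t x \<le> (1 + 1 / real N) * bet e a (real j / real (N + 1)) x"
    using bet_le_grid[OF N t(1) less_imp_le[OF t(2)] a(1), of e] by auto
  have tj: "0 \<le> real j / real (N + 1)" "real j / real (N + 1) < 1" using j by auto
  have N1: "0 < 1 + 1 / real N" using N by (simp add: add_pos_nonneg)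
  have "growth \<nu> e a t \<le> (\<integral>x. ln (bet e a (real j / real (N + 1)) x) + ln (1 + 1 / real N) \<partial>\<nu>)"
    unfolding growth_def
  proof (rule integral_mono)
    fix x
    have "ln (bet e a t x) \<le> ln ((1 + 1 / real N) * bet e a (real j / real (N + 1)) x)"
      using j(2)[of x] bet_pos[of a t e x] a t by (intro ln_mono) auto
    also have "\<dots> = ln (bet e a (real j / real (N + 1)) x) + ln (1 + 1 / real N)"
      using bet_pos[OF a(1) tj, of e x] N1 by (subst ln_mult_pos) auto
    finally show "ln (bet e a t x) \<le> ln (bet e a (real j / real (N + 1)) x) + ln (1 + 1 / real N)" .
  qed (use integrable_ln_bet[OF a t] integrable_ln_bet[OF a tj] in auto)
  also have "\<dots> = growth \<nu> e a (real j / real (N + 1)) + ln (1 + 1 / real N)"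
    using integrable_ln_bet[OF a tj] by (simp add: growth_def prob_space)
  finally show ?thesis using j(1) by auto
qed

lemma (in unit_side) max_growth_le_iff_grid:
  assumes a: "0 < a" "a \<le> 1"
  shows "max_growth \<nu> e a \<le> v \<longleftrightarrow> (\<forall>N>0. \<forall>j\<le>N. growth \<nu> e a (real j / real (N + 1)) \<le> v)"
proof
  assume "max_growth \<nu> e a \<le> v"
  moreover have "growth \<nu> e a (real j / real (N + 1)) \<le> max_growth \<nu> e a" if "j \<le> N" for j N
    using that by (intro growth_le_max_growth a) auto
  ultimately show "\<forall>N>0. \<forall>j\<le>N. growth \<nu> e a (real j / real (N + 1)) \<le> v"
    by (meson order_trans)
next
  assume *: "\<forall>N>0. \<forall>j\<le>N. growth \<nu> e a (real j / real (N + 1)) \<le> v"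
  show "max_growth \<nu> e a \<le> v"
  proof (rule max_growth_leI)
    fix t :: real assume t: "0 \<le> t" "t < 1"
    have le: "growth \<nu> e a t \<le> v + ln (1 + 1 / real (Suc N))" for N
      using growth_le_grid[of "Suc N", OF _ t a] * by (meson add_right_mono order_trans zero_less_Suc)
    have "(\<lambda>N. v + ln (1 + 1 / real (Suc N))) \<longlonglongrightarrow> v + ln (1 + 0)"
      by (intro tendsto_intros LIMSEQ_inverse_real_of_nat[unfolded inverse_eq_divide]) auto
    then have "growth \<nu> e a t \<le> v + ln (1 + 0)"
      by (rule LIMSEQ_le_const) (use le in auto)
    then show "growth \<nu> e a t \<le> v" by simp
  qed
qed

section \<open>Endpoints of the reported interval\<close>

lemma KL_near_outside:
  assumes "sets \<nu> = sets borel" "\<not> (AE x in \<nu>. x \<in> {0..1})"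
  shows "KL_near \<nu> e a = \<infinity>"
proof -
  have "KL \<nu> \<kappa> = \<infinity>" if "\<kappa> \<in> prob_unit_interval" for \<kappa>
  proof -
    have "AE x in \<kappa>. x \<in> {0..1}" "sets \<kappa> = sets borel" using that by (auto simp: prob_unit_interval_iff)
    then have "\<not> absolutely_continuous \<kappa> \<nu>"
      using absolutely_continuous_AE[of \<nu> \<kappa> "\<lambda>x. x \<in> {0..1}"] assms by auto
    then show ?thesis by (simp add: KL_def)
  qed
  then show ?thesis unfolding KL_near_def by (intro INF_eqI) auto
qed

lemma gap_mean:
  assumes "\<nu> \<in> prob_unit_interval"
  shows "gap \<nu> 1 = 1 - mean \<nu>" "gap \<nu> 0 = mean \<nu>"
proof -
  have p: "prob_space \<nu>" and s[measurable_cong]: "sets \<nu> = sets borel" and ae: "AE x in \<nu>. x \<in> {0..1}"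
    using assms by (auto simp: prob_unit_interval_iff)
  interpret prob_space \<nu> by fact
  have i: "integrable \<nu> (\<lambda>x. x)"
  proof (rule integrable_const_bound[where B=1])
    show "AE x in \<nu>. norm x \<le> 1" using ae by eventually_elim auto
  qed measurable
  have "gap \<nu> 1 = (\<integral>x. 1 - x \<partial>\<nu>)" unfolding gap_def
    by (rule integral_cong_AE, measurable) (use ae in \<open>eventually_elim, auto\<close>)
  then show "gap \<nu> 1 = 1 - mean \<nu>" using i by (simp add: mean_def prob_space)
  show "gap \<nu> 0 = mean \<nu>" unfolding gap_def mean_def
    by (rule integral_cong_AE, measurable) (use ae in \<open>eventually_elim, auto\<close>)
qed

lemma KL_inf_eq_KL_near:
  "mean \<nu> \<le> q \<Longrightarrow> KL_inf \<nu> prob_unit_interval q = KL_near \<nu> 1 (1 - q)"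
  "q < mean \<nu> \<Longrightarrow> KL_inf \<nu> prob_unit_interval q = KL_near \<nu> 0 q"
proof -
  have "{\<kappa>\<in>prob_unit_interval. q \<le> mean \<kappa>} = {\<kappa>\<in>prob_unit_interval. gap \<kappa> 1 \<le> 1 - q}"
    "{\<kappa>\<in>prob_unit_interval. mean \<kappa> \<le> q} = {\<kappa>\<in>prob_unit_interval. gap \<kappa> 0 \<le> q}"
    by (auto simp: gap_mean)
  then show "mean \<nu> \<le> q \<Longrightarrow> KL_inf \<nu> prob_unit_interval q = KL_near \<nu> 1 (1 - q)"
    "q < mean \<nu> \<Longrightarrow> KL_inf \<nu> prob_unit_interval q = KL_near \<nu> 0 q"
    by (auto simp: KL_inf_def KL_near_def)
qed

text \<open>
The distance from \<open>e\<close> to the reported endpoint on the side of \<open>e\<close>, when \<open>v\<close> is the threshold per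
sample. Inserting the gap covers the case that no candidate is admissible.
\<close>

definition near_endpoint :: "real measure \<Rightarrow> real \<Rightarrow> real \<Rightarrow> real" where
  "near_endpoint \<nu> e v = Inf (insert (gap \<nu> e) {a. a < gap \<nu> e \<and> KL_near \<nu> e a \<le> ereal v})"

context unit_side
begin

lemma admissible_nonneg:
  assumes "KL_near \<nu> e a \<le> ereal v" shows "0 \<le> a"
  using KL_near_neg[OF e, of a \<nu>] assms by (cases "a < 0") auto

lemma near_endpoint_bdd: "bdd_below (insert (gap \<nu> e) {a. a < gap \<nu> e \<and> KL_near \<nu> e a \<le> ereal v})"
  unfolding bdd_below_def by (rule exI[of _ 0]) (use gap_bounds admissible_nonneg in auto)

lemma near_endpoint_bounds: "0 \<le> near_endpoint \<nu> e v" "near_endpoint \<nu> e v \<le> gap \<nu> e"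
proof -
  show "0 \<le> near_endpoint \<nu> e v" unfolding near_endpoint_def
    by (rule cInf_greatest) (use gap_bounds admissible_nonneg in auto)
  show "near_endpoint \<nu> e v \<le> gap \<nu> e" unfolding near_endpoint_def
    by (rule cInf_lower[OF _ near_endpoint_bdd]) simp
qed

lemma near_endpoint_eq_Inf:
  assumes "{a. a < gap \<nu> e \<and> KL_near \<nu> e a \<le> ereal v} \<noteq> {}" (is "?S \<noteq> {}")
  shows "near_endpoint \<nu> e v = Inf ?S" "bdd_below ?S"
proof -
  show b: "bdd_below ?S" using near_endpoint_bdd[of v] by simp
  obtain q where "q \<in> ?S" using assms by auto
  then have "Inf ?S \<le> gap \<nu> e" using cInf_lower[OF _ b, of q] by auto
  then show "near_endpoint \<nu> e v = Inf ?S"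
    using cInf_insert[OF assms b] by (simp add: near_endpoint_def inf_absorb2)
qed

lemma near_endpoint_le:
  assumes "0 < a" "a < gap \<nu> e" "max_growth \<nu> e a \<le> v"
  shows "near_endpoint \<nu> e v \<le> a"
  unfolding near_endpoint_def
  by (rule cInf_lower[OF _ near_endpoint_bdd]) (use assms KL_near_eq_max_growth[of a] in auto)

lemma near_endpoint_ge:
  assumes "0 < a" "a \<le> gap \<nu> e" "v < max_growth \<nu> e a"
  shows "a \<le> near_endpoint \<nu> e v"
  unfolding near_endpoint_def
proof (rule cInf_greatest)
  fix x assume "x \<in> insert (gap \<nu> e) {a. a < gap \<nu> e \<and> KL_near \<nu> e a \<le> ereal v}"
  then show "a \<le> x"
  proof (elim insertE CollectE conjE)
    assume x: "x < gap \<nu> e" "KL_near \<nu> e x \<le> ereal v"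
    show "a \<le> x"
    proof (rule ccontr)
      assume "\<not> a \<le> x"
      then have "KL_near \<nu> e a \<le> ereal v" using KL_near_antimono[of x a \<nu> e] x by auto
      then show False using assms KL_near_eq_max_growth[of a] by simp
    qed
  qed (use assms in simp)
qed simp

text \<open>
A description by countably many conditions, from which measurability follows.
\<close>

lemma near_endpoint_less_iff:
  "near_endpoint \<nu> e v < c \<longleftrightarrow>
    gap \<nu> e < c \<or> (\<exists>a\<in>\<rat>. 0 < a \<and> a < c \<and> a < gap \<nu> e \<and> max_growth \<nu> e a \<le> v)"
proof
  assume "near_endpoint \<nu> e v < c"
  then obtain a where a: "a \<in> insert (gap \<nu> e) {a. a < gap \<nu> e \<and> KL_near \<nu> e a \<le> ereal v}" "a < c"
    unfolding near_endpoint_def by (subst (asm) cInf_less_iff[OF _ near_endpoint_bdd]) auto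
  show "gap \<nu> e < c \<or> (\<exists>a\<in>\<rat>. 0 < a \<and> a < c \<and> a < gap \<nu> e \<and> max_growth \<nu> e a \<le> v)"
  proof (cases "a = gap \<nu> e")
    case False
    then have a': "a < gap \<nu> e" "KL_near \<nu> e a \<le> ereal v" "0 \<le> a" using a admissible_nonneg by auto
    obtain q where q: "q \<in> \<rat>" "a < q" "q < min c (gap \<nu> e)"
      using Rats_dense_in_real[of a "min c (gap \<nu> e)"] a a' by auto
    have "KL_near \<nu> e q \<le> ereal v" using KL_near_antimono[of a q \<nu> e] a' q by auto
    then have "max_growth \<nu> e q \<le> v" using KL_near_eq_max_growth[of q] q a' by simp
    then show ?thesis using q a' by auto
  qed (use a in auto)
next
  assume "gap \<nu> e < c \<or> (\<exists>a\<in>\<rat>. 0 < a \<and> a < c \<and> a < gap \<nu> e \<and> max_growth \<nu> e a \<le> v)"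
  then show "near_endpoint \<nu> e v < c"
    using near_endpoint_bounds(2)[of v] near_endpoint_le[of _ v] by force
qed

end

section \<open>Empirical distributions and measurability of the policy\<close>

lemma empirical_basic:
  assumes "xs \<noteq> []"
  shows "prob_space (empirical xs)" "sets (empirical xs) = sets borel"
proof -
  interpret U: prob_space "uniform_count_measure {..<length xs}"
    by (rule prob_space_uniform_count_measure) (use assms in auto)
  show "prob_space (empirical xs)" unfolding empirical_def by (rule U.prob_space_distr) simp
qed (simp add: empirical_def)

lemma integral_empirical:
  fixes f :: "real \<Rightarrow> real"
  assumes [measurable]: "f \<in> borel_measurable borel"
  shows "(\<integral>x. f x \<partial>empirical xs) = (\<Sum>i<length xs. f (xs ! i)) / real (length xs)"
  unfolding empirical_def
  by (subst integral_distr) (auto simp: integral_uniform_count_measure)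

lemma AE_empirical:
  assumes [measurable]: "Measurable.pred borel P" and "xs \<noteq> []"
  shows "(AE x in empirical xs. P x) \<longleftrightarrow> (\<forall>x\<in>set xs. P x)"
proof -
  have "(AE x in empirical xs. P x) \<longleftrightarrow> (AE i in uniform_count_measure {..<length xs}. P (xs ! i))"
    unfolding empirical_def by (subst AE_distr_iff) auto
  also have "\<dots> \<longleftrightarrow> (\<forall>i<length xs. P (xs ! i))"
    unfolding uniform_count_measure_def AE_point_measure using assms(2)
    by (auto simp: ennreal_zero_less_divide)
  also have "\<dots> \<longleftrightarrow> (\<forall>x\<in>set xs. P x)" by (metis in_set_conv_nth)
  finally show ?thesis .
qed

lemma empirical_in_unit_iff:
  assumes "xs \<noteq> []"
  shows "empirical xs \<in> prob_unit_interval \<longleftrightarrow> set xs \<subseteq> {0..1}"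
  using empirical_basic[OF assms] AE_empirical[of "\<lambda>x. x \<in> {0..1}" xs] assms
  by (auto simp: prob_unit_interval_iff)

text \<open>
A sample outside of the unit interval has probability zero but matters for measurability: it is
charged by the empirical distribution and by no competitor, so no candidate is admissible.
\<close>

lemma KL_inf_policy_outside:
  assumes "xs \<noteq> []" "\<not> set xs \<subseteq> {0..1}"
  shows "KL_inf_policy prob_unit_interval \<beta> \<delta> xs
    = (ereal (mean (empirical xs)), ereal (mean (empirical xs)))"
proof -
  have "\<not> (AE x in empirical xs. x \<in> {0..1})"
    using AE_empirical[of "\<lambda>x. x \<in> {0..1}" xs] assms by auto
  then have "KL_near (empirical xs) e a = \<infinity>" for e a
    using KL_near_outside empirical_basic[OF assms(1)] by blast
  then have "KL_inf (empirical xs) prob_unit_interval q = \<infinity>" for q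
    by (metis KL_inf_eq_KL_near not_less)
  then show ?thesis using assms(1) unfolding KL_inf_policy_def Let_def by simp
qed

lemma INF_ereal_eq_Inf:
  fixes S :: "real set"
  assumes "S \<noteq> {}" "bdd_below S" shows "(INF q\<in>S. ereal q) = ereal (Inf S)"
  using ereal_Inf'[OF assms(2,1)] by simp

lemma KL_inf_policy_inside:
  fixes \<beta> :: "nat \<Rightarrow> real \<Rightarrow> real" and \<delta> :: real
  assumes xs: "xs \<noteq> []" "set xs \<subseteq> {0..1}"
  defines "v \<equiv> \<beta> (length xs) \<delta> / real (length xs)"
  shows "KL_inf_policy prob_unit_interval \<beta> \<delta> xs =
    (ereal (near_endpoint (empirical xs) 0 v), ereal (1 - near_endpoint (empirical xs) 1 v))"
proof -
  let ?E = "empirical xs" and ?n = "length xs"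
  have E: "?E \<in> prob_unit_interval" using empirical_in_unit_iff xs by blast
  interpret L: unit_side ?E 0 by unfold_locales (use E in auto)
  interpret R: unit_side ?E 1 by unfold_locales (use E in auto)
  have n: "0 < ?n" using xs by simp
  have adm: "ereal (real ?n) * k \<le> ereal (\<beta> ?n \<delta>) \<longleftrightarrow> k \<le> ereal v" for k
    using n by (cases k) (auto simp: v_def field_simps)
  let ?m = "mean ?E"
  define QL where "QL = {q. q < ?m \<and> ereal (real ?n) * KL_inf ?E prob_unit_interval q \<le> ereal (\<beta> ?n \<delta>)}"
  define QR where "QR = {q. ?m < q \<and> ereal (real ?n) * KL_inf ?E prob_unit_interval q \<le> ereal (\<beta> ?n \<delta>)}"
  have QL: "QL = {a. a < gap ?E 0 \<and> KL_near ?E 0 a \<le> ereal v}"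
    unfolding QL_def adm using KL_inf_eq_KL_near(2) gap_mean[OF E] by auto
  have "QR = {q. 1 - q < gap ?E 1 \<and> KL_near ?E 1 (1 - q) \<le> ereal v}"
    unfolding QR_def adm using KL_inf_eq_KL_near(1) gap_mean[OF E] by auto
  then have QR: "QR = (\<lambda>a. 1 - a) ` {a. a < gap ?E 1 \<and> KL_near ?E 1 a \<le> ereal v}"
    by (auto simp: image_iff intro!: exI[of _ "1 - _"])
  have "KL_inf_policy prob_unit_interval \<beta> \<delta> xs = (if QL = {} then ereal ?m else (INF q\<in>QL. ereal q),
     if QR = {} then ereal ?m else (SUP q\<in>QR. ereal q))"
    unfolding KL_inf_policy_def Let_def QL_def QR_def using n by simp
  moreover have "(if QL = {} then ereal ?m else (INF q\<in>QL. ereal q)) = ereal (near_endpoint ?E 0 v)"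
  proof (cases "QL = {}")
    case True
    then show ?thesis unfolding near_endpoint_def QL[symmetric] by (simp add: gap_mean[OF E])
  next
    case False
    then show ?thesis
      using L.near_endpoint_eq_Inf[of v] unfolding QL[symmetric] by (simp add: INF_ereal_eq_Inf)
  qed
  moreover have "(if QR = {} then ereal ?m else (SUP q\<in>QR. ereal q)) = ereal (1 - near_endpoint ?E 1 v)"
  proof -
    define S where "S = {a. a < gap ?E 1 \<and> KL_near ?E 1 a \<le> ereal v}"
    show ?thesis
    proof (cases "S = {}")
      case True
      then show ?thesis unfolding near_endpoint_def QR S_def[symmetric] by (simp add: gap_mean[OF E])
    next
      case False
      note S = R.near_endpoint_eq_Inf[of v, folded S_def, OF False]
      have "(SUP q\<in>QR. ereal q) = (SUP a\<in>S. ereal 1 - ereal a)"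
        unfolding QR S_def[symmetric] by (simp add: image_image)
      also have "\<dots> = ereal 1 - (INF a\<in>S. ereal a)"
        using False by (intro SUP_ereal_minus_right) auto
      also have "\<dots> = ereal (1 - Inf S)" using INF_ereal_eq_Inf[OF False S(2)] by simp
      finally show ?thesis using False S(1) by (simp add: QR S_def[symmetric])
    qed
  qed
  ultimately show ?thesis by simp
qed

abbreviation sample :: "nat \<Rightarrow> (nat \<Rightarrow> real) \<Rightarrow> real list" where
  "sample n x \<equiv> map x [0..<n]"

definition in_unit :: "nat \<Rightarrow> (nat \<Rightarrow> real) \<Rightarrow> bool" where
  "in_unit n x \<longleftrightarrow> (\<forall>i<n. x i \<in> {0..1})"

abbreviation emp :: "nat \<Rightarrow> (nat \<Rightarrow> real) \<Rightarrow> real measure" where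
  "emp n x \<equiv> empirical (sample n x)"

lemma in_unit_sample: "in_unit n x \<longleftrightarrow> set (sample n x) \<subseteq> {0..1}"
  by (auto simp: in_unit_def image_subset_iff)

lemma unit_side_empirical:
  "0 < n \<Longrightarrow> in_unit n x \<Longrightarrow> e \<in> {0..1} \<Longrightarrow> unit_side (emp n x) e"
  using empirical_in_unit_iff[of "sample n x"] by unfold_locales (auto simp: in_unit_sample)

lemma gap_empirical: "gap (emp n x) e = (\<Sum>i<n. \<bar>x i - e\<bar>) / real n"
  unfolding gap_def by (subst integral_empirical) auto

lemma growth_empirical:
  "growth (emp n x) e a t = (\<Sum>i<n. ln (bet e a t (x i))) / real n"
  unfolding growth_def by (subst integral_empirical) auto

lemma mean_empirical: "mean (emp n x) = (\<Sum>i<n. x i) / real n"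
  unfolding mean_def by (subst integral_empirical) auto

lemma in_unit_measurable:
  assumes [measurable]: "\<And>i. i < n \<Longrightarrow> (\<lambda>x. x i) \<in> borel_measurable M"
  shows "Measurable.pred M (in_unit n)"
  unfolding in_unit_def by measurable

lemma near_endpoint_empirical_measurable:
  assumes coord [measurable]: "\<And>i. i < n \<Longrightarrow> (\<lambda>x. x i) \<in> borel_measurable M" and n: "0 < n"
    and e: "e \<in> {0..1}"
  shows "(\<lambda>x. if in_unit n x then near_endpoint (emp n x) e v else 0)
    \<in> borel_measurable M"
  unfolding borel_measurable_iff_less
proof
  note in_unit_measurable[OF coord, measurable]
  fix c
  define g where "g x = (\<Sum>i<n. \<bar>x i - e\<bar>) / real n" for x
  define D where "D q x \<longleftrightarrow> (\<forall>N. \<forall>j. 0 < N \<longrightarrow> j \<le> N \<longrightarrow>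
     (\<Sum>i<n. ln (bet e q (real j / real (N + 1)) (x i))) / real n \<le> v)" for q x
  have [measurable]: "g \<in> borel_measurable M" unfolding g_def by measurable
  have [measurable]: "Measurable.pred M (D q)" for q unfolding D_def by measurable
  define P where "P x \<longleftrightarrow> g x < c \<or>
    (\<exists>q::rat. 0 < real_of_rat q \<and> real_of_rat q < c \<and> real_of_rat q < g x \<and> D (real_of_rat q) x)" for x
  have [measurable]: "Measurable.pred M P" unfolding P_def by measurable
  have P: "near_endpoint (emp n x) e v < c \<longleftrightarrow> P x" if x: "in_unit n x" for x
  proof -
    interpret E: unit_side "emp n x" e by (rule unit_side_empirical[OF n x e])
    have g: "gap (emp n x) e = g x" by (simp add: g_def gap_empirical)
    have D: "max_growth (emp n x) e q \<le> v \<longleftrightarrow> D q x" if q: "0 < q" "q < g x" for q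
    proof -
      have "q \<le> 1" using q E.gap_bounds(2) unfolding g by simp
      from E.max_growth_le_iff_grid[OF q(1) this, of v] show ?thesis
        unfolding growth_empirical D_def by blast
    qed
    show ?thesis
    proof
      assume "near_endpoint (emp n x) e v < c"
      then consider "g x < c" | a where "a \<in> \<rat>" "0 < a" "a < c" "a < g x" "max_growth (emp n x) e a \<le> v"
        unfolding E.near_endpoint_less_iff g by blast
      then show "P x"
      proof cases
        case (2 a)
        then obtain q where "a = real_of_rat q" by (auto elim: Rats_cases)
        then show ?thesis using 2 D[of a] unfolding P_def by blast
      qed (simp add: P_def)
    next
      assume "P x"
      then consider "g x < c" | q where "0 < real_of_rat q" "real_of_rat q < c" "real_of_rat q < g x" "D (real_of_rat q) x"
        unfolding P_def by blast
      then show "near_endpoint (emp n x) e v < c"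
      proof cases
        case (2 q)
        then show ?thesis unfolding E.near_endpoint_less_iff g using D[of "real_of_rat q"]
          by (intro disjI2 bexI[of _ "real_of_rat q"]) auto
      qed (simp add: E.near_endpoint_less_iff g)
    qed
  qed
  have "{x \<in> space M. (if in_unit n x then near_endpoint (emp n x) e v else 0) < c}
    = {x \<in> space M. (in_unit n x \<and> P x) \<or> (\<not> in_unit n x \<and> 0 < c)}"
    using P by auto
  also have "\<dots> \<in> sets M" by measurable
  finally show "{x \<in> space M. (if in_unit n x then near_endpoint (emp n x) e v else 0) < c} \<in> sets M" .
qed

lemma KL_inf_policy_sample:
  fixes \<beta> :: "nat \<Rightarrow> real \<Rightarrow> real"
  assumes "0 < n"
  shows "KL_inf_policy prob_unit_interval \<beta> \<delta> (sample n x) =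
    (if in_unit n x
     then (ereal (near_endpoint (emp n x) 0 (\<beta> n \<delta> / real n)),
           ereal (1 - near_endpoint (emp n x) 1 (\<beta> n \<delta> / real n)))
     else (ereal (mean (emp n x)), ereal (mean (emp n x))))"
  using KL_inf_policy_inside[of "sample n x" \<beta> \<delta>] KL_inf_policy_outside[of "sample n x" \<beta> \<delta>] assms
  by (auto simp: in_unit_sample)

lemma KL_inf_policy_measurable:
  assumes coord [measurable]: "\<And>i. i < n \<Longrightarrow> (\<lambda>x. x i) \<in> borel_measurable M"
  shows "(\<lambda>x. fst (KL_inf_policy prob_unit_interval \<beta> \<delta> (sample n x))) \<in> borel_measurable M" (is "?L \<in> _")
    and "(\<lambda>x. snd (KL_inf_policy prob_unit_interval \<beta> \<delta> (sample n x))) \<in> borel_measurable M" (is "?R \<in> _")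
proof -
  note in_unit_measurable[OF coord, measurable]
  have "?L \<in> borel_measurable M \<and> ?R \<in> borel_measurable M"
  proof (cases "n = 0")
    case True
    then show ?thesis by (simp add: KL_inf_policy_def Let_def)
  next
    case False
    then have n: "0 < n" by simp
    let ?f = "\<lambda>e x. if in_unit n x then near_endpoint (emp n x) e (\<beta> n \<delta> / real n) else 0"
    have m [measurable]: "?f 0 \<in> borel_measurable M" "?f 1 \<in> borel_measurable M"
      by (intro near_endpoint_empirical_measurable[OF coord n]; simp)+
    have 0: "?L = (\<lambda>x. ereal (if in_unit n x then ?f 0 x else (\<Sum>i<n. x i) / real n))"
      and 1: "?R = (\<lambda>x. ereal (if in_unit n x then 1 - ?f 1 x else (\<Sum>i<n. x i) / real n))"
      by (auto simp: KL_inf_policy_sample[OF n] mean_empirical)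
    show ?thesis unfolding 0 1 by measurable
  qed
  then show "?L \<in> borel_measurable M" "?R \<in> borel_measurable M" by auto
qed

lemma policy_KL_inf_policy: "policy (KL_inf_policy prob_unit_interval \<beta>)"
  unfolding policy_def by (auto intro!: KL_inf_policy_measurable measurable_component_singleton)

section \<open>Independent coordinates\<close>

abbreviation iid :: "real measure \<Rightarrow> (nat \<Rightarrow> real) measure" where
  "iid M \<equiv> \<Pi>\<^sub>M i\<in>UNIV. M"

lemma prob_space_iid: "prob_space M \<Longrightarrow> prob_space (iid M)"
  by (rule prob_space_PiM)

lemma iid_coord_measurable:
  "sets M = sets borel \<Longrightarrow> (\<lambda>x. x i) \<in> borel_measurable (iid M)"
  using measurable_component_singleton[of i UNIV "\<lambda>_. M"] measurable_cong_sets[of _ _ M borel] by auto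

lemma iid_distr_coord:
  assumes M: "prob_space M"
  shows "distr (iid M) M (\<lambda>x. x i) = M"
proof -
  interpret prob_space M by fact
  interpret P: product_prob_space "\<lambda>_::nat. M" UNIV by unfold_locales
  show ?thesis by (rule P.PiM_component) simp
qed

lemma iid_integral_coord:
  fixes f :: "real \<Rightarrow> real"
  assumes M: "prob_space M" and f: "integrable M f"
  shows "integrable (iid M) (\<lambda>x. f (x i))"
    and "(\<integral>x. f (x i) \<partial>(iid M)) = (\<integral>x. f x \<partial>M)"
proof -
  note d = iid_distr_coord[OF M, of i]
  show "integrable (iid M) (\<lambda>x. f (x i))"
    by (rule integrable_distr[of "\<lambda>\<omega>. \<omega> i" _ M]) (use f d in auto)
  show "(\<integral>x. f (x i) \<partial>(iid M)) = (\<integral>x. f x \<partial>M)"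
    using integral_distr[of "\<lambda>\<omega>. \<omega> i" "iid M" M f] f d by simp
qed

lemma iid_indep_vars:
  assumes M: "prob_space M" and f: "f \<in> borel_measurable M" and n: "0 < n"
  shows "prob_space.indep_vars (iid M) (\<lambda>_. borel) (\<lambda>i x. f (x i)) {..<n}"
proof -
  interpret prob_space M by fact
  interpret P: product_prob_space "\<lambda>_::nat. M" UNIV by unfold_locales
  have "P.indep_vars (\<lambda>_. M) (\<lambda>i x. x i) {..<n}"
  proof (subst P.indep_vars_iff_distr_eq_PiM')
    show "distr (iid M) (\<Pi>\<^sub>M i\<in>{..<n}. M) (\<lambda>x. \<lambda>i\<in>{..<n}. x i) =
        (\<Pi>\<^sub>M i\<in>{..<n}. distr (iid M) M (\<lambda>x. x i))"
      by (simp add: P.distr_PiM_restrict_finite iid_distr_coord[OF M])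
  qed (use n in auto)
  from P.indep_vars_compose2[OF this, of "\<lambda>_. f"] f show ?thesis by simp
qed

lemma iid_nn_integral_prod:
  fixes f :: "real \<Rightarrow> ennreal"
  assumes M: "prob_space M" and f: "f \<in> borel_measurable M" and n: "0 < n"
  shows "(\<integral>\<^sup>+x. (\<Prod>i<n. f (x i)) \<partial>(iid M)) = (\<integral>\<^sup>+x. f x \<partial>M) ^ n"
proof -
  interpret prob_space "iid M" by (rule prob_space_iid[OF M])
  have "(\<integral>\<^sup>+x. f (x i) \<partial>(iid M)) = (\<integral>\<^sup>+x. f x \<partial>M)" for i
    using nn_integral_distr[of "\<lambda>x. x i" "iid M" M f] f iid_distr_coord[OF M, of i]
    by simp
  then show ?thesis
    by (subst indep_vars_nn_integral[OF _ iid_indep_vars[OF M f n]]) auto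
qed

lemma iid_AE:
  assumes M: "prob_space M" and "AE x in M. P x"
  shows "AE x in (iid M). \<forall>i. P (x i)"
  unfolding AE_all_countable
  by (rule allI, rule AE_PiM_component) (use assms in auto)

section \<open>Coverage at a fixed sample size\<close>

abbreviation rate :: "nat \<Rightarrow> real \<Rightarrow> real" where
  "rate n \<delta> \<equiv> threshold n \<delta> / real n"

context unit_side
begin

abbreviation S :: "(nat \<Rightarrow> real) measure" where "S \<equiv> iid \<nu>"

text \<open>
The average wealth after \<open>n\<close> rounds of the \<open>n + 1\<close> bets of the grid, all at the level of the true
gap.
\<close>

definition mixture :: "nat \<Rightarrow> (nat \<Rightarrow> real) \<Rightarrow> real" where
  "mixture n x = (\<Sum>j\<le>n. \<Prod>i<n. bet e (gap \<nu> e) (real j / real (n + 1)) (x i)) / real (n + 1)"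

lemma coord_measurable [measurable]: "(\<lambda>x. x i) \<in> borel_measurable S"
  by (rule iid_coord_measurable[OF sets_\<nu>])

lemma AE_in_unit: "AE x in S. \<forall>n. in_unit n x"
  using iid_AE[OF prob_space_axioms AE_unit] by eventually_elim (auto simp: in_unit_def)

lemma nn_integral_mixture:
  assumes g: "0 < gap \<nu> e" and n: "0 < n"
  shows "(\<integral>\<^sup>+x. ennreal (mixture n x) \<partial>S) \<le> 1"
proof -
  let ?a = "gap \<nu> e"
  define t where "t j = real j / real (n + 1)" for j
  have mixture: "mixture n x = (\<Sum>j\<le>n. \<Prod>i<n. bet e (gap \<nu> e) (t j) (x i)) / real (n + 1)" for x
    by (simp add: mixture_def t_def)
  have t: "0 \<le> t j" "t j < 1" if "j \<le> n" for j using that by (auto simp: t_def)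
  have b: "(\<integral>\<^sup>+x. ennreal (bet e ?a (t j) x) \<partial>\<nu>) = 1" if j: "j \<le> n" for j
  proof -
    have i: "integrable \<nu> (\<lambda>x. \<bar>x - e\<bar>)" by (rule gap_eq_nn_integral(2)[OF \<nu> e])
    then have i': "integrable \<nu> (bet e ?a (t j))" unfolding bet_def by auto
    have "(\<integral>x. bet e ?a (t j) x \<partial>\<nu>) = 1 - t j + t j * (?a / ?a)"
      using i unfolding bet_def gap_def by (simp add: prob_space)
    then have "(\<integral>x. bet e ?a (t j) x \<partial>\<nu>) = 1" using g by simp
    then show ?thesis using bet_pos[OF g t[OF j], of e]
      by (subst nn_integral_eq_integral[OF i']) (auto simp: less_imp_le)
  qed
  have pos: "0 \<le> bet e ?a (t j) y" if "j \<le> n" for j y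
    using bet_pos[OF g t[OF that], of e y] by (auto simp: less_imp_le)
  have "(\<integral>\<^sup>+x. ennreal (mixture n x) \<partial>S)
     = (\<integral>\<^sup>+x. ennreal (1 / real (n + 1)) * (\<Sum>j\<le>n. \<Prod>i<n. ennreal (bet e ?a (t j) (x i))) \<partial>S)"
  proof (rule nn_integral_cong)
    fix x
    have "ennreal (mixture n x) = ennreal (1 / real (n + 1)) *
        ennreal (\<Sum>j\<le>n. \<Prod>i<n. bet e ?a (t j) (x i))"
      unfolding mixture by (subst ennreal_mult'[symmetric]) auto
    also have "ennreal (\<Sum>j\<le>n. \<Prod>i<n. bet e ?a (t j) (x i)) = (\<Sum>j\<le>n. \<Prod>i<n. ennreal (bet e ?a (t j) (x i)))"
    proof (subst sum_ennreal[symmetric])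
      show "(\<Sum>j\<le>n. ennreal (\<Prod>i<n. bet e ?a (t j) (x i))) = (\<Sum>j\<le>n. \<Prod>i<n. ennreal (bet e ?a (t j) (x i)))"
        by (intro sum.cong refl, subst prod_ennreal) (auto simp: pos)
    qed (auto intro!: prod_nonneg pos)
    finally show "ennreal (mixture n x) = ennreal (1 / real (n + 1)) *
        (\<Sum>j\<le>n. \<Prod>i<n. ennreal (bet e ?a (t j) (x i)))" .
  qed
  also have "\<dots> = ennreal (1 / real (n + 1)) * (\<Sum>j\<le>n. (\<integral>\<^sup>+x. (\<Prod>i<n. ennreal (bet e ?a (t j) (x i))) \<partial>S))"
    by (subst nn_integral_cmult, measurable, subst nn_integral_sum) auto
  also have "(\<Sum>j\<le>n. (\<integral>\<^sup>+x. (\<Prod>i<n. ennreal (bet e ?a (t j) (x i))) \<partial>S)) = (\<Sum>j\<le>n. 1)"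
    by (intro sum.cong refl, subst iid_nn_integral_prod[OF prob_space_axioms _ n]) (auto simp: b sets_\<nu> cong: measurable_cong_sets)
  also have "ennreal (1 / real (n + 1)) * (\<Sum>j\<le>n. 1) = ennreal (1 / real (n + 1)) * ennreal (real (n + 1))"
    by (simp flip: ennreal_of_nat_eq_real_of_nat)
  also have "\<dots> = 1" by (subst ennreal_mult'[symmetric]) auto
  finally show ?thesis by simp
qed

text \<open>
The constants of the threshold are spent here: \<open>1\<close> bounds the total loss \<open>n * ln (1 + 1 / n)\<close> of
rounding to the grid, \<open>ln (n + 1)\<close> is the loss of averaging, and \<open>ln (2 / \<delta>)\<close> is what remains.
\<close>

lemma mixture_ge:
  assumes n: "0 < n" and x: "in_unit n x" and \<delta>: "0 < \<delta>"
    and miss: "gap \<nu> e < near_endpoint (emp n x) e (rate n \<delta>)"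
    and g: "0 < gap \<nu> e"
  shows "2 / \<delta> \<le> mixture n x"
proof -
  let ?a = "gap \<nu> e" and ?E = "emp n x"
  interpret E: unit_side ?E e by (rule unit_side_empirical[OF n x e])
  define v where "v = threshold n \<delta> / real n"
  have "?a < gap ?E e" using miss E.near_endpoint_bounds(2) by (rule less_le_trans)
  then have nle: "\<not> max_growth ?E e ?a \<le> v"
    using E.near_endpoint_le[OF g] miss by (fastforce simp: v_def)
  have "\<exists>t. 0 \<le> t \<and> t < 1 \<and> v < growth ?E e ?a t"
    using nle E.max_growth_leI[of ?a v] by (meson not_less)
  then obtain t where t: "0 \<le> t" "t < 1" "v < growth ?E e ?a t" by auto
  have a1: "?a \<le> 1" using gap_bounds by simp
  obtain j where j: "j \<le> n" "growth ?E e ?a t \<le> growth ?E e ?a (real j / real (n + 1)) + ln (1 + 1 / real n)"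
    using E.growth_le_grid[OF n t(1,2) g a1] by auto
  define s where "s j = real j / real (n + 1)" for j
  have s: "0 \<le> s j" "s j < 1" if "j \<le> n" for j using that by (auto simp: s_def)
  have mixture: "mixture n x = (\<Sum>j\<le>n. \<Prod>i<n. bet e (gap \<nu> e) (s j) (x i)) / real (n + 1)"
    by (simp add: mixture_def s_def)
  let ?b = "\<lambda>j i. bet e ?a (s j) (x i)"
  have pos: "0 < ?b j i" if "j \<le> n" for i j
    using bet_pos[OF g s[OF that], of e "x i"] .
  have "threshold n \<delta> = real n * v" using n by (simp add: v_def)
  also have "\<dots> < real n * (growth ?E e ?a (s j) + ln (1 + 1 / real n))"
    using n t j unfolding s_def by (intro mult_strict_left_mono) auto
  also have "\<dots> = (\<Sum>i<n. ln (?b j i)) + real n * ln (1 + 1 / real n)"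
    using n unfolding growth_empirical by (simp add: distrib_left)
  also have "\<dots> \<le> (\<Sum>i<n. ln (?b j i)) + 1"
  proof -
    have "ln (1 + 1 / real n) \<le> 1 / real n" by (rule ln_add_one_self_le_self) simp
    then show ?thesis using n by (simp add: field_simps)
  qed
  also have "(\<Sum>i<n. ln (?b j i)) = ln (\<Prod>i<n. ?b j i)"
    by (subst ln_prod) (use pos[OF j(1)] in \<open>auto simp: less_imp_neq[symmetric]\<close>)
  also have "\<dots> \<le> ln (\<Sum>j\<le>n. \<Prod>i<n. ?b j i)"
  proof (rule ln_mono)
    show "0 < (\<Prod>i<n. ?b j i)" using pos[OF j(1)] by (intro prod_pos) auto
    show "(\<Prod>i<n. ?b j i) \<le> (\<Sum>j\<le>n. \<Prod>i<n. ?b j i)"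
    proof (rule member_le_sum)
      show "0 \<le> (\<Prod>i<n. ?b k i)" if "k \<in> {..n} - {j}" for k
        using that pos by (intro prod_nonneg ballI less_imp_le) auto
    qed (use j in auto)
  qed
  also have "(\<Sum>j\<le>n. \<Prod>i<n. ?b j i) = real (n + 1) * mixture n x"
    unfolding mixture by simp
  finally have "ln (2 * (1 + real n) / \<delta>) < ln (real (n + 1) * mixture n x)"
    by (simp add: threshold_def)
  moreover have "0 < mixture n x" unfolding mixture
    using pos by (intro divide_pos_pos sum_pos prod_pos) auto
  ultimately have "2 * (1 + real n) / \<delta> < real (n + 1) * mixture n x"
    using \<delta> by (subst (asm) ln_less_cancel_iff) auto
  moreover have "2 * (1 + real n) / \<delta> = real (n + 1) * (2 / \<delta>)" by simp
  ultimately have "real (n + 1) * (2 / \<delta>) < real (n + 1) * mixture n x" by linarith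
  then have "2 / \<delta> < mixture n x" by (subst (asm) mult_less_cancel_left_pos) simp_all
  then show ?thesis by simp
qed

definition miss :: "nat \<Rightarrow> real \<Rightarrow> (nat \<Rightarrow> real) set" where
  "miss n \<delta> = {x \<in> space S. in_unit n x \<and>
     gap \<nu> e < near_endpoint (emp n x) e (rate n \<delta>)}"

lemma miss_sets [measurable]:
  assumes "0 < n" shows "miss n \<delta> \<in> sets S"
proof -
  note in_unit_measurable[of n S, OF coord_measurable, measurable]
    near_endpoint_empirical_measurable[of n S, OF coord_measurable assms e, of "rate n \<delta>", measurable]
  have "miss n \<delta> = {x \<in> space S. in_unit n x \<and>
     gap \<nu> e < (if in_unit n x then near_endpoint (emp n x) e (rate n \<delta>) else 0)}"
    by (auto simp: miss_def)
  also have "\<dots> \<in> sets S" by measurable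
  finally show ?thesis .
qed

text \<open>
Markov's inequality for the mixture. If the true gap is \<open>0\<close>, all samples equal \<open>e\<close> almost surely and
the interval does not miss.
\<close>

lemma emeasure_miss:
  assumes n: "0 < n" and \<delta>: "0 < \<delta>"
  shows "emeasure S (miss n \<delta>) \<le> ennreal (\<delta> / 2)"
proof (cases "gap \<nu> e = 0")
  case True
  have i: "integrable \<nu> (\<lambda>x. \<bar>x - e\<bar>)" by (rule gap_eq_nn_integral(2)[OF \<nu> e])
  have "AE x in \<nu>. \<bar>x - e\<bar> = 0"
    using True integral_nonneg_eq_0_iff_AE[OF i] by (simp add: gap_def)
  then have "AE x in S. \<forall>i. \<bar>x i - e\<bar> = 0" by (rule iid_AE[OF prob_space_axioms])
  then have "AE x in S. x \<notin> miss n \<delta>"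
  proof eventually_elim
    case (elim x)
    show ?case
    proof
      assume "x \<in> miss n \<delta>"
      then have u: "in_unit n x" and m: "gap \<nu> e < near_endpoint (emp n x) e (rate n \<delta>)"
        by (auto simp: miss_def)
      interpret E: unit_side "emp n x" e by (rule unit_side_empirical[OF n u e])
      have "gap (emp n x) e = 0" unfolding gap_empirical using elim by simp
      then show False using m E.near_endpoint_bounds(2)[of "rate n \<delta>"] True by simp
    qed
  qed
  then have "emeasure S (miss n \<delta>) = 0" by (rule AE_iff_measurable[THEN iffD1, rotated 2]) (use miss_sets[OF n] in \<open>auto simp: miss_def\<close>)
  then show ?thesis by simp
next
  case False
  then have g: "0 < gap \<nu> e" using gap_bounds by simp
  have [measurable]: "mixture n \<in> borel_measurable S" unfolding mixture_def by measurable
  have "emeasure S (miss n \<delta>) \<le> emeasure S {x \<in> space S. 1 \<le> ennreal (\<delta> / 2) * ennreal (mixture n x)}"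
  proof (rule emeasure_mono)
    show "miss n \<delta> \<subseteq> {x \<in> space S. 1 \<le> ennreal (\<delta> / 2) * ennreal (mixture n x)}"
    proof
      fix x assume x: "x \<in> miss n \<delta>"
      then have "2 / \<delta> \<le> mixture n x" using mixture_ge[OF n _ \<delta> _ g, of x] by (auto simp: miss_def)
      then have "1 \<le> \<delta> / 2 * mixture n x" using \<delta> by (simp add: field_simps)
      then have "ennreal 1 \<le> ennreal (\<delta> / 2 * mixture n x)" by (rule ennreal_leI)
      moreover have "ennreal (\<delta> / 2 * mixture n x) = ennreal (\<delta> / 2) * ennreal (mixture n x)"
        using \<delta> by (intro ennreal_mult') simp
      ultimately show "x \<in> {x \<in> space S. 1 \<le> ennreal (\<delta> / 2) * ennreal (mixture n x)}"
        using x by (simp only: ennreal_1) (simp add: miss_def)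
    qed
  qed measurable
  also have "\<dots> \<le> ennreal (\<delta> / 2) * (\<integral>\<^sup>+x. ennreal (mixture n x) * indicator (space S) x \<partial>S)"
    by (rule nn_integral_Markov_inequality) auto
  also have "(\<integral>\<^sup>+x. ennreal (mixture n x) * indicator (space S) x \<partial>S) = (\<integral>\<^sup>+x. ennreal (mixture n x) \<partial>S)"
    by (intro nn_integral_cong) simp
  also have "ennreal (\<delta> / 2) * \<dots> \<le> ennreal (\<delta> / 2) * 1"
    by (intro mult_left_mono nn_integral_mixture g n) simp
  finally show ?thesis by simp
qed

end

section \<open>Weak laws of large numbers\<close>

lemma iid_weak_law_bounded:
  fixes f :: "real \<Rightarrow> real"
  assumes M: "prob_space M" and s: "sets M = sets borel" and "f \<in> borel_measurable borel"
    and ab: "AE x in M. f x \<in> {a..b}" "a < b" and \<epsilon>: "0 < \<epsilon>"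
  shows "(\<lambda>n. measure (iid M)
      {x \<in> space (\<Pi>\<^sub>M i\<in>UNIV. M). \<epsilon> \<le> \<bar>(\<Sum>i<n. f (x i)) / real n - (\<integral>x. f x \<partial>M)\<bar>}) \<longlonglongrightarrow> 0"
    (is "?p \<longlonglongrightarrow> 0")
proof -
  let ?S = "iid M"
  interpret M: prob_space M by fact
  interpret S: prob_space ?S by (rule prob_space_iid[OF M])
  have f: "f \<in> borel_measurable M" using assms(3) measurable_cong_sets[OF s refl] by blast
  have "AE x in M. norm (f x) \<le> \<bar>a\<bar> + \<bar>b\<bar>" using ab(1) by eventually_elim auto
  then have int: "integrable M f" using f by (rule M.integrable_const_bound)
  have fi: "(\<lambda>x. f (x i)) \<in> borel_measurable ?S" for i
    by (rule measurable_compose[OF _ f]) simp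
  define q where "q = exp (- 2 * \<epsilon>\<^sup>2 / (b - a)\<^sup>2)"
  have q: "0 \<le> q" "q < 1" using \<epsilon> ab by (auto simp: q_def)
  have bound: "?p n \<le> 2 * q ^ n" if n: "0 < n" for n
  proof -
    interpret Hoeffding_ineq_iid ?S "{..<n}" "\<lambda>i x. f (x i)" "\<lambda>x. f (x 0)" a b "\<integral>x. f x \<partial>M"
    proof unfold_locales
      show "distr ?S borel (\<lambda>x. f (x i)) = distr ?S borel (\<lambda>x. f (x 0))" for i
        using distr_distr[OF f, of "\<lambda>x. x i" ?S] distr_distr[OF f, of "\<lambda>x. x 0" ?S]
        by (simp add: iid_distr_coord[OF M] comp_def)
      show "AE x in ?S. f (x 0) \<in> {a..b}" using iid_AE[OF M ab(1)] by eventually_elim simp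
      show "(\<integral>x. f x \<partial>M) \<equiv> \<integral>x. f (x 0) \<partial>?S"
        by (rule eq_reflection) (simp add: iid_integral_coord[OF M int])
    qed (use fi iid_indep_vars[OF M f n] in auto)
    have "?p n \<le> 2 * exp (- 2 * real n * \<epsilon>\<^sup>2 / (b - a)\<^sup>2)"
      using Hoeffding_ineq_abs_ge'[of \<epsilon>] \<epsilon> ab(2) n by auto
    also have "- 2 * real n * \<epsilon>\<^sup>2 / (b - a)\<^sup>2 = real n * (- 2 * \<epsilon>\<^sup>2 / (b - a)\<^sup>2)" by simp
    finally show ?thesis by (simp only: exp_of_nat_mult q_def)
  qed
  have "(\<lambda>n. 2 * q ^ n) \<longlonglongrightarrow> 2 * 0" using q by (intro tendsto_mult_left LIMSEQ_realpow_zero)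
  then show ?thesis
    by (intro tendsto_sandwich[of "\<lambda>_. 0" ?p sequentially "\<lambda>n. 2 * q ^ n"])
      (use bound in \<open>auto simp: eventually_sequentially intro!: exI[of _ 1]\<close>)
qed

locale cost =
  fixes C :: "real measure"
  assumes C: "cost_distribution C" and mean_pos: "0 < mean C"
begin

sublocale C: prob_space C using C by (simp add: cost_distribution_def)

lemma sets_C [measurable_cong]: "sets C = sets borel"
  and AE_pos: "AE c in C. 0 < c" and integrable_C: "integrable C (\<lambda>c. c)"
  using C by (auto simp: cost_distribution_def)

abbreviation T :: "(nat \<Rightarrow> real) measure" where "T \<equiv> iid C"

sublocale T: prob_space T by (rule prob_space_iid[OF C.prob_space_axioms])

lemma coord_measurable: "(\<lambda>x. x i) \<in> borel_measurable T"
  by (rule iid_coord_measurable[OF sets_C])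

text \<open>
Costs have finite mean but possibly infinite variance, so the weak law is obtained by truncation: a
truncated cost is bounded, and the neglected part has small expectation.
\<close>

definition trunc :: "nat \<Rightarrow> real \<Rightarrow> real" where "trunc m c = max 0 (min c (real m))"

lemma trunc_measurable [measurable]: "trunc m \<in> borel_measurable borel"
  unfolding trunc_def by measurable

lemma AE_T_pos: "AE c in T. \<forall>i. 0 < c i"
  by (rule iid_AE[OF C.prob_space_axioms AE_pos])

lemma trunc_le: "0 < c \<Longrightarrow> trunc m c \<le> c"
  by (auto simp: trunc_def)

lemma trunc_mean: "(\<lambda>m. \<integral>c. trunc m c \<partial>C) \<longlonglongrightarrow> mean C"
  unfolding mean_def
proof (rule integral_dominated_convergence[where w = "\<lambda>c. \<bar>c\<bar>"])
  show "integrable C (\<lambda>c. \<bar>c\<bar>)" using integrable_C by simp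
  show "AE c in C. (\<lambda>m. trunc m c) \<longlonglongrightarrow> c"
    using AE_pos
  proof eventually_elim
    case (elim c)
    obtain N where N: "c \<le> real N" using real_arch_simple by blast
    have "\<forall>\<^sub>F m in sequentially. trunc m c = c"
      using N elim by (auto simp: eventually_sequentially trunc_def min_def intro!: exI[of _ N])
    then show ?case by (rule tendsto_eventually)
  qed
  show "AE c in C. norm (trunc m c) \<le> \<bar>c\<bar>" for m
    by (auto simp: trunc_def)
qed measurable

lemma integrable_trunc: "integrable C (trunc m)"
  by (rule C.integrable_const_bound[where B = "real m"]) (auto simp: trunc_def)

lemma trunc_mean_le: "(\<integral>c. trunc m c \<partial>C) \<le> mean C"
  unfolding mean_def
  by (rule integral_mono_AE[OF integrable_trunc integrable_C])
    (use AE_pos trunc_le in \<open>auto elim!: eventually_mono\<close>)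

lemma trunc_weak_law:
  assumes "0 < \<epsilon>" "0 < m"
  shows "(\<lambda>n. measure T {c \<in> space T. \<epsilon> \<le> \<bar>(\<Sum>i<n. trunc m (c i)) / real n - (\<integral>c. trunc m c \<partial>C)\<bar>}) \<longlonglongrightarrow> 0"
  by (rule iid_weak_law_bounded[OF C.prob_space_axioms sets_C, where a = 0 and b = "real m"])
    (use assms in \<open>auto simp: trunc_def\<close>)

lemma sum_cost_lower:
  assumes r: "r < mean C"
  shows "(\<lambda>n. measure T {c \<in> space T. (\<Sum>i<n. c i) \<le> r * real n}) \<longlonglongrightarrow> 0" (is "?p \<longlonglongrightarrow> 0")
proof -
  note coord_measurable[measurable]
  have "\<forall>\<^sub>F m in sequentially. r < (\<integral>c. trunc m c \<partial>C) \<and> 0 < m"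
    using order_tendstoD(1)[OF trunc_mean r] eventually_gt_at_top by eventually_elim auto
  then obtain m where m: "r < (\<integral>c. trunc m c \<partial>C)" "0 < m" by (auto simp: eventually_sequentially)
  define \<epsilon> where "\<epsilon> = (\<integral>c. trunc m c \<partial>C) - r"
  have \<epsilon>: "0 < \<epsilon>" using m by (simp add: \<epsilon>_def)
  let ?q = "\<lambda>n. measure T {c \<in> space T. \<epsilon> \<le> \<bar>(\<Sum>i<n. trunc m (c i)) / real n - (\<integral>c. trunc m c \<partial>C)\<bar>}"
  have "?p n \<le> ?q n" if n: "0 < n" for n
  proof (rule T.finite_measure_mono_AE)
    show "AE c in T. c \<in> {c \<in> space T. (\<Sum>i<n. c i) \<le> r * real n} \<longrightarrow>
      c \<in> {c \<in> space T. \<epsilon> \<le> \<bar>(\<Sum>i<n. trunc m (c i)) / real n - (\<integral>c. trunc m c \<partial>C)\<bar>}"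
      using AE_T_pos
    proof eventually_elim
      case (elim c)
      have le: "(\<Sum>i<n. trunc m (c i)) \<le> (\<Sum>i<n. c i)" using elim trunc_le by (intro sum_mono) auto
      show ?case
      proof safe
        assume "(\<Sum>i<n. c i) \<le> r * real n"
        then have "(\<Sum>i<n. trunc m (c i)) / real n \<le> r" using le n by (simp add: field_simps)
        then show "\<epsilon> \<le> \<bar>(\<Sum>i<n. trunc m (c i)) / real n - (\<integral>c. trunc m c \<partial>C)\<bar>"
          by (simp add: \<epsilon>_def)
      qed
    qed
  qed measurable
  then show ?thesis
    by (intro tendsto_sandwich[OF _ _ tendsto_const trunc_weak_law[OF \<epsilon> m(2)]])
      (auto simp: eventually_sequentially intro!: exI[of _ 1])
qed

text \<open>
The neglected part of the costs is controlled in mean by Markov's inequality.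
\<close>

lemma sum_cost_upper:
  assumes r: "mean C < r"
  shows "(\<lambda>n. measure T {c \<in> space T. r * real n \<le> (\<Sum>i<n. c i)}) \<longlonglongrightarrow> 0" (is "?p \<longlonglongrightarrow> 0")
proof (rule LIMSEQ_I)
  fix \<rho> :: real assume \<rho>: "0 < \<rho>"
  define \<eta> where "\<eta> = (r - mean C) / 2"
  have \<eta>: "0 < \<eta>" using r by (simp add: \<eta>_def)
  have "mean C - \<rho> * \<eta> / 2 < mean C" using \<rho> \<eta> by simp
  from order_tendstoD(1)[OF trunc_mean this]
  have "\<forall>\<^sub>F m in sequentially. mean C - \<rho> * \<eta> / 2 < (\<integral>c. trunc m c \<partial>C) \<and> 0 < m"
    using eventually_gt_at_top by eventually_elim auto
  then obtain m where m: "mean C - \<rho> * \<eta> / 2 < (\<integral>c. trunc m c \<partial>C)" "0 < m"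
    by (auto simp: eventually_sequentially)
  define rest where "rest c = max 0 (c - trunc m c)" for c
  have [measurable]: "rest \<in> borel_measurable borel" unfolding rest_def by measurable
  have rest_nonneg: "0 \<le> rest c" and le_rest: "c \<le> trunc m c + rest c" for c
    by (auto simp: rest_def)
  have rest_int: "(\<integral>c. rest c \<partial>C) < \<rho> * \<eta> / 2" "integrable C rest"
  proof -
    have ae: "AE c in C. rest c = c - trunc m c" using AE_pos by eventually_elim (use trunc_le in \<open>auto simp: max_def rest_def\<close>)
    have "(\<integral>c. rest c \<partial>C) = (\<integral>c. c - trunc m c \<partial>C)" by (rule integral_cong_AE[OF _ _ ae]) (use sets_C in \<open>auto intro!: borel_measurable_diff simp: measurable_cong_sets[OF sets_C refl]\<close>)
    then show "(\<integral>c. rest c \<partial>C) < \<rho> * \<eta> / 2"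
      using m integrable_C integrable_trunc by (simp add: mean_def)
    show "integrable C rest" unfolding rest_def using integrable_C integrable_trunc by auto
  qed
  note coord_measurable[measurable]
  let ?A = "\<lambda>n. {c \<in> space T. \<eta> \<le> \<bar>(\<Sum>i<n. trunc m (c i)) / real n - (\<integral>c. trunc m c \<partial>C)\<bar>}"
  let ?B = "\<lambda>n. {c \<in> space T. real n * \<eta> \<le> (\<Sum>i<n. rest (c i))}"
  have B: "measure T (?B n) \<le> \<rho> / 2" if n: "0 < n" for n
  proof -
    note coord = iid_integral_coord[OF C.prob_space_axioms rest_int(2)]
    have "measure T (?B n) \<le> (\<integral>c. (\<Sum>i<n. rest (c i)) \<partial>T) / (real n * \<eta>)"
    proof (rule integral_Markov_inequality_measure)
      show "integrable T (\<lambda>c. \<Sum>i<n. rest (c i))"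
        by (rule Bochner_Integration.integrable_sum) (rule coord(1))
      show "AE c in T. 0 \<le> (\<Sum>i<n. rest (c i))" by (simp add: sum_nonneg rest_nonneg)
    qed (use n \<eta> in auto)
    also have "(\<integral>c. (\<Sum>i<n. rest (c i)) \<partial>T) = real n * (\<integral>c. rest c \<partial>C)"
      by (subst Bochner_Integration.integral_sum) (use coord in auto)
    also have "\<dots> / (real n * \<eta>) = (\<integral>c. rest c \<partial>C) / \<eta>" using n by simp
    also have "\<dots> \<le> \<rho> / 2" using rest_int(1) \<eta> by (simp add: field_simps)
    finally show ?thesis .
  qed
  have "\<forall>\<^sub>F n in sequentially. measure T (?A n) < \<rho> / 2"
    using order_tendstoD(2)[OF trunc_weak_law[OF \<eta> m(2)], of "\<rho> / 2"] \<rho> by simp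
  then have "\<forall>\<^sub>F n in sequentially. ?p n < \<rho>"
    using eventually_gt_at_top[of 0]
  proof eventually_elim
    case (elim n)
    have "?p n \<le> measure T (?A n \<union> ?B n)"
    proof (rule T.finite_measure_mono)
      show "{c \<in> space T. r * real n \<le> (\<Sum>i<n. c i)} \<subseteq> ?A n \<union> ?B n"
      proof safe
        fix c assume c: "r * real n \<le> (\<Sum>i<n. c i)" "\<not> real n * \<eta> \<le> (\<Sum>i<n. rest (c i))"
        have "(\<Sum>i<n. c i) \<le> (\<Sum>i<n. trunc m (c i) + rest (c i))" by (intro sum_mono le_rest)
        then have "r * real n \<le> (\<Sum>i<n. trunc m (c i)) + (\<Sum>i<n. rest (c i))"
          using c by (simp add: sum.distrib)
        then have "(r - \<eta>) * real n \<le> (\<Sum>i<n. trunc m (c i))" using c by (simp add: algebra_simps)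
        then have "r - \<eta> \<le> (\<Sum>i<n. trunc m (c i)) / real n" using elim by (simp add: field_simps)
        moreover have "r - \<eta> = mean C + \<eta>" by (simp add: \<eta>_def field_simps)
        ultimately show "\<eta> \<le> \<bar>(\<Sum>i<n. trunc m (c i)) / real n - (\<integral>c. trunc m c \<partial>C)\<bar>"
          using trunc_mean_le[of m] by simp
      qed
    qed measurable
    also have "\<dots> \<le> measure T (?A n) + measure T (?B n)" by (rule measure_Un_le) measurable
    also have "\<dots> < \<rho>" using elim B[of n] by simp
    finally show ?case .
  qed
  then show "\<exists>N. \<forall>n\<ge>N. norm (?p n - 0) < \<rho>"
    by (auto simp: eventually_sequentially)
qed

end

section \<open>The number of affordable samples\<close>

lemma num_samples_eq_Max:
  fixes b :: real and c :: "nat \<Rightarrow> real"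
  defines "S \<equiv> {n. 1 \<le> n \<and> (\<Sum>i<n. c i) \<le> b}"
  shows "num_samples b c = (if S = {} then 0 else Max S)"
  by (simp only: num_samples_def Sup_nat_def S_def)

lemma num_samples_eq_iff:
  assumes "finite {n. 1 \<le> n \<and> (\<Sum>i<n. c i) \<le> b}"
  shows "num_samples b c = k \<longleftrightarrow>
    (\<forall>n. 1 \<le> n \<and> (\<Sum>i<n. c i) \<le> b \<longrightarrow> n \<le> k) \<and> (k = 0 \<or> (\<Sum>i<k. c i) \<le> b)"
proof -
  define S where "S = {n. 1 \<le> n \<and> (\<Sum>i<n. c i) \<le> b}"
  have fin: "finite S" using assms by (simp add: S_def)
  have n: "num_samples b c = (if S = {} then 0 else Max S)"
    unfolding S_def by (rule num_samples_eq_Max)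
  have S: "m \<in> S \<longleftrightarrow> 1 \<le> m \<and> (\<Sum>i<m. c i) \<le> b" for m by (simp add: S_def)
  show ?thesis
  proof (cases "S = {}")
    case True
    then show ?thesis using S n by auto
  next
    case False
    then have "Max S = k \<longleftrightarrow> k \<in> S \<and> (\<forall>m\<in>S. m \<le> k)" using Max_eq_iff[OF fin False] by auto
    moreover have "k \<in> S \<longleftrightarrow> k = 0 \<or> (\<Sum>i<k. c i) \<le> b" if "\<forall>m\<in>S. m \<le> k"
      using that False S by (cases k) fastforce+
    ultimately show ?thesis using n False S by auto
  qed
qed

text \<open>
This also holds on the null event that infinitely many samples are affordable: then the partial sums
never exceed the budget.
\<close>

lemma cost_le_budget_if_less_num_samples:
  assumes pos: "\<And>i. 0 < c i" and "k < num_samples b c"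
  shows "(\<Sum>i<k. c i) \<le> b"
proof -
  define S where "S = {n. 1 \<le> n \<and> (\<Sum>i<n. c i) \<le> b}"
  have "\<exists>m\<in>S. k \<le> m"
  proof (cases "finite S")
    case True
    have n: "num_samples b c = (if S = {} then 0 else Max S)"
      unfolding S_def by (rule num_samples_eq_Max)
    then have "S \<noteq> {}" using assms(2) by (cases "S = {}") auto
    then have "Max S \<in> S" "num_samples b c = Max S" using True n by simp_all
    then show ?thesis using assms(2) by (intro bexI[of _ "Max S"]) auto
  next
    case False
    then show ?thesis unfolding infinite_nat_iff_unbounded_le by auto
  qed
  then obtain m where m: "k \<le> m" "(\<Sum>i<m. c i) \<le> b" by (auto simp: S_def)
  have "(\<Sum>i<k. c i) \<le> (\<Sum>i<m. c i)"
    by (rule sum_mono2) (use m pos in \<open>auto simp: less_imp_le\<close>)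
  then show ?thesis using m by simp
qed

text \<open>
If \<open>k\<close> samples are affordable but the reported number is smaller, then the set of affordable numbers
is infinite and its \<^const>\<open>Sup\<close> is unspecified. In that case every partial sum stays within the
budget, which is unlikely by \<open>sum_cost_lower\<close>.
\<close>

lemma cost_le_budget_if_num_samples_less:
  assumes pos: "\<And>i. 0 < c i" and k: "num_samples b c < k" "(\<Sum>i<k. c i) \<le> b"
  shows "(\<Sum>i<m. c i) \<le> b"
proof -
  define S where "S = {n. 1 \<le> n \<and> (\<Sum>i<n. c i) \<le> b}"
  have "k \<in> S" using k by (auto simp: S_def)
  have "infinite S"
  proof
    assume fin: "finite S"
    then have "k \<le> Max S" using \<open>k \<in> S\<close> by simp
    moreover have "num_samples b c = Max S"
      using \<open>k \<in> S\<close> num_samples_eq_Max[of b c] unfolding S_def by auto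
    ultimately show False using k by simp
  qed
  then obtain j where j: "m \<le> j" "j \<in> S" unfolding infinite_nat_iff_unbounded_le by auto
  have "(\<Sum>i<m. c i) \<le> (\<Sum>i<j. c i)"
    by (rule sum_mono2) (use j pos in \<open>auto simp: less_imp_le\<close>)
  then show ?thesis using j by (simp add: S_def)
qed

context cost
begin

text \<open>
On the event that infinitely many samples are affordable, \<^const>\<open>num_samples\<close> is one fixed
unspecified number, so this event causes no harm.
\<close>

lemma num_samples_measurable [measurable]: "num_samples b \<in> measurable T (count_space UNIV)"
proof (rule measurable_count_space_eq2_countable[THEN iffD2], safe)
  note coord_measurable[measurable]
  fix k :: nat
  (* Max of an infinite set, an unspecified number *)
  define k0 where "k0 = (the None :: nat)"
  let ?fin = "\<lambda>c. \<exists>N. \<forall>n. 1 \<le> n \<and> (\<Sum>i<n. c i) \<le> b \<longrightarrow> n \<le> N"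
  have eq: "num_samples b c = k \<longleftrightarrow>
     (if ?fin c then (\<forall>n. 1 \<le> n \<and> (\<Sum>i<n. c i) \<le> b \<longrightarrow> n \<le> k) \<and> (k = 0 \<or> (\<Sum>i<k. c i) \<le> b)
      else k = k0)" for c
  proof -
    have fin: "?fin c \<longleftrightarrow> finite {n. 1 \<le> n \<and> (\<Sum>i<n. c i) \<le> b}"
      unfolding finite_nat_set_iff_bounded_le by auto
    show ?thesis
    proof (cases "?fin c")
      case True
      then show ?thesis using num_samples_eq_iff[of c b k] fin by simp
    next
      case False
      then have inf: "infinite {n. 1 \<le> n \<and> (\<Sum>i<n. c i) \<le> b}" using fin by blast
      then have "{n. 1 \<le> n \<and> (\<Sum>i<n. c i) \<le> b} \<noteq> {}" by (rule infinite_imp_nonempty)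
      then have "num_samples b c = Max {n. 1 \<le> n \<and> (\<Sum>i<n. c i) \<le> b}"
        using num_samples_eq_Max[of b c] by (simp only: if_False)
      then have "num_samples b c = k0" using Max.infinite[OF inf] by (simp only: k0_def)
      then show ?thesis using False by auto
    qed
  qed
  have "num_samples b -` {k} \<inter> space T = {c \<in> space T. (if ?fin c then (\<forall>n. 1 \<le> n \<and> (\<Sum>i<n. c i) \<le> b \<longrightarrow> n \<le> k) \<and> (k = 0 \<or> (\<Sum>i<k. c i) \<le> b)
      else k = k0)}"
    using eq by blast
  also have "\<dots> \<in> sets T" by measurable
  finally show "num_samples b -` {k} \<inter> space T \<in> sets T" .
qed auto

text \<open>
The number of samples leaves the window only if the first \<open>n0\<close> samples are too expensive or the
first \<open>n1\<close> samples too cheap; both are large deviations of the average cost once the budget is so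
large that rounding to integers does not matter.
\<close>

lemma num_samples_concentration:
  assumes \<epsilon>: "0 < \<epsilon>" "\<epsilon> < 1"
  shows "((\<lambda>b. measure T {c \<in> space T. \<not> ((1 - \<epsilon>) * b / mean C \<le> real (num_samples b c) \<and>
      real (num_samples b c) \<le> (1 + \<epsilon>) * b / mean C)}) \<longlongrightarrow> 0) at_top" (is "(?p \<longlongrightarrow> 0) at_top")
proof -
  note coord_measurable[measurable]
  let ?m = "mean C"
  (* The factors with \<epsilon> / 2 leave room for rounding x0 and x1 to integers: the rounding error
     is at most mean C, which is below \<epsilon> * b / 2 for a large budget b. *)
  define r0 where "r0 = ?m / (1 - \<epsilon> / 2)"
  define r1 where "r1 = ?m / (1 + \<epsilon> / 2)"
  have r0: "?m < r0" using mean_pos \<epsilon> by (simp add: r0_def field_simps)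
  have r1: "r1 < ?m" using mean_pos \<epsilon> by (simp add: r1_def field_simps)
  define n0 where "n0 b = Suc (nat \<lfloor>(1 - \<epsilon>) * b / ?m\<rfloor>)" for b
  define n1 where "n1 b = nat \<lfloor>(1 + \<epsilon>) * b / ?m\<rfloor>" for b
  have "filterlim (\<lambda>b::real. (1 - \<epsilon>) / ?m * b) at_top at_top" "filterlim (\<lambda>b::real. (1 + \<epsilon>) / ?m * b) at_top at_top"
    by (rule filterlim_tendsto_pos_mult_at_top[OF tendsto_const _ filterlim_ident],
        use mean_pos \<epsilon> in simp)+
  then have n0: "filterlim n0 at_top at_top" and n1: "filterlim n1 at_top at_top"
    unfolding n0_def n1_def
    by (auto intro!: filterlim_compose[OF filterlim_nat_sequentially] filterlim_compose[OF filterlim_Suc]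
        filterlim_compose[OF filterlim_floor_sequentially] simp: mult.commute)
  let ?P0 = "\<lambda>n. measure T {c \<in> space T. r0 * real n \<le> (\<Sum>i<n. c i)}"
  let ?P1 = "\<lambda>n. measure T {c \<in> space T. (\<Sum>i<n. c i) \<le> r1 * real n}"
  have lim: "((\<lambda>b. ?P0 (n0 b) + ?P1 (n1 b)) \<longlongrightarrow> 0 + 0) at_top"
    by (intro tendsto_add filterlim_compose[OF sum_cost_upper[OF r0] n0] filterlim_compose[OF sum_cost_lower[OF r1] n1])
  have "\<forall>\<^sub>F b in at_top. ?p b \<le> ?P0 (n0 b) + ?P1 (n1 b)"
    using eventually_ge_at_top[of "2 * ?m / \<epsilon>"] eventually_gt_at_top[of 0]
  proof eventually_elim
    case (elim b)
    define x0 where "x0 = (1 - \<epsilon>) * b / ?m"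
    define x1 where "x1 = (1 + \<epsilon>) * b / ?m"
    have x: "0 \<le> x0" "0 \<le> x1" using elim \<epsilon> mean_pos by (auto simp: x0_def x1_def)
    have n0x: "x0 \<le> real (n0 b)" "real (n0 b) \<le> x0 + 1"
    proof -
      have "real (n0 b) = real_of_int \<lfloor>x0\<rfloor> + 1" using x by (simp add: n0_def x0_def[symmetric])
      then show "x0 \<le> real (n0 b)" "real (n0 b) \<le> x0 + 1" by linarith+
    qed
    have n1x: "real (n1 b) \<le> x1" "x1 - 1 \<le> real (n1 b)"
      using x floor_correct[of x1] by (auto simp: n1_def x1_def[symmetric])
    have eb: "?m \<le> \<epsilon> * b / 2" using elim \<epsilon> by (simp add: field_simps)
    have le0: "r0 * real (n0 b) \<le> b"
    proof -
      have "?m * real (n0 b) \<le> ?m * (x0 + 1)" using n0x mean_pos by (intro mult_left_mono) auto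
      also have "\<dots> = (1 - \<epsilon>) * b + ?m" using mean_pos by (simp add: x0_def distrib_left)
      also have "\<dots> \<le> b * (1 - \<epsilon> / 2)" using eb by (simp add: algebra_simps)
      finally show ?thesis unfolding r0_def using \<epsilon> by (simp add: field_simps)
    qed
    have le1: "b \<le> r1 * real (n1 b)"
    proof -
      have "b * (1 + \<epsilon> / 2) \<le> (1 + \<epsilon>) * b - ?m" using eb by (simp add: algebra_simps)
      also have "\<dots> = ?m * (x1 - 1)" using mean_pos by (simp add: x1_def right_diff_distrib)
      also have "\<dots> \<le> ?m * real (n1 b)" using n1x mean_pos by (intro mult_left_mono) auto
      finally show ?thesis unfolding r1_def using \<epsilon> by (simp add: field_simps)
    qed
    let ?A = "{c \<in> space T. r0 * real (n0 b) \<le> (\<Sum>i<n0 b. c i)}"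
    let ?B = "{c \<in> space T. (\<Sum>i<n1 b. c i) \<le> r1 * real (n1 b)}"
    have "?p b \<le> measure T (?A \<union> ?B)"
    proof (rule T.finite_measure_mono_AE)
      show "AE c in T. c \<in> {c \<in> space T. \<not> ((1 - \<epsilon>) * b / mean C \<le> real (num_samples b c) \<and>
          real (num_samples b c) \<le> (1 + \<epsilon>) * b / mean C)} \<longrightarrow> c \<in> ?A \<union> ?B"
        using AE_T_pos
      proof eventually_elim
        case (elim c)
        then have pos: "0 < c i" for i by simp
        show ?case
          unfolding x0_def[symmetric] x1_def[symmetric]
        proof (intro impI, elim CollectE conjE)
          assume c: "c \<in> space T" "\<not> (x0 \<le> real (num_samples b c) \<and> real (num_samples b c) \<le> x1)"
          then consider "real (num_samples b c) < x0" | "x1 < real (num_samples b c)" by linarith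
          then show "c \<in> ?A \<union> ?B"
          proof cases
            case 1
            then have lt: "num_samples b c < n0 b" using n0x by linarith
            show ?thesis
            proof (cases "(\<Sum>i<n0 b. c i) \<le> b")
              case True
              then have "(\<Sum>i<n1 b. c i) \<le> b" by (rule cost_le_budget_if_num_samples_less[OF pos lt])
              then show ?thesis using c le1 by simp
            qed (use c le0 in simp)
          next
            case 2
            then have "n1 b < num_samples b c" using n1x by linarith
            then have "(\<Sum>i<n1 b. c i) \<le> b" by (rule cost_le_budget_if_less_num_samples[OF pos])
            then show ?thesis using c le1 by simp
          qed
        qed
      qed
    qed measurable
    also have "\<dots> \<le> ?P0 (n0 b) + ?P1 (n1 b)" by (rule measure_Un_le) measurable
    finally show ?case .
  qed
  then show ?thesis
    by (intro tendsto_sandwich[OF _ _ tendsto_const lim[simplified]]) auto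
qed

end

section \<open>Convergence of the empirical endpoint at a deterministic threshold\<close>

context unit_side
begin

sublocale S: prob_space S by (rule prob_space_iid[OF prob_space_axioms])

definition above :: "nat \<Rightarrow> real \<Rightarrow> real \<Rightarrow> (nat \<Rightarrow> real) set" where
  "above n v a = {x \<in> space S. in_unit n x \<and> a < near_endpoint (emp n x) e v}"

definition below :: "nat \<Rightarrow> real \<Rightarrow> real \<Rightarrow> (nat \<Rightarrow> real) set" where
  "below n v a = {x \<in> space S. in_unit n x \<and> near_endpoint (emp n x) e v < a}"

lemma above_below_sets:
  assumes "0 < n" shows "above n v a \<in> sets S" "below n v a \<in> sets S"
proof -
  note in_unit_measurable[of n S, OF coord_measurable, measurable]
    near_endpoint_empirical_measurable[of n S, OF coord_measurable assms e, of v, measurable]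
  let ?f = "\<lambda>x. if in_unit n x then near_endpoint (emp n x) e v else 0"
  have "above n v a = {x \<in> space S. in_unit n x \<and> a < ?f x}" by (auto simp: above_def)
  also have "\<dots> \<in> sets S" by measurable
  finally show "above n v a \<in> sets S" .
  have "below n v a = {x \<in> space S. in_unit n x \<and> ?f x < a}" by (auto simp: below_def)
  also have "\<dots> \<in> sets S" by measurable
  finally show "below n v a \<in> sets S" .
qed

lemma near_endpoint_antimono:
  assumes "v \<le> w" shows "near_endpoint \<nu> e w \<le> near_endpoint \<nu> e v"
  unfolding near_endpoint_def
proof (rule cInf_superset_mono)
  show "bdd_below (insert (gap \<nu> e) {a. a < gap \<nu> e \<and> KL_near \<nu> e a \<le> ereal w})"
    by (rule near_endpoint_bdd)
  show "insert (gap \<nu> e) {a. a < gap \<nu> e \<and> KL_near \<nu> e a \<le> ereal v}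
    \<subseteq> insert (gap \<nu> e) {a. a < gap \<nu> e \<and> KL_near \<nu> e a \<le> ereal w}"
    using assms by (auto elim: order_trans)
qed simp

lemma above_mono:
  assumes "0 < n" "v \<le> w" "a \<le> a'" shows "above n w a' \<subseteq> above n v a"
proof
  fix x assume x: "x \<in> above n w a'"
  then interpret E: unit_side "emp n x" e
    using unit_side_empirical[OF assms(1) _ e] by (auto simp: above_def)
  show "x \<in> above n v a"
    using x assms(3) E.near_endpoint_antimono[OF assms(2)] by (auto simp: above_def)
qed

lemma below_mono:
  assumes "0 < n" "w \<le> v" "a' \<le> a" shows "below n w a' \<subseteq> below n v a"
proof
  fix x assume x: "x \<in> below n w a'"
  then interpret E: unit_side "emp n x" e
    using unit_side_empirical[OF assms(1) _ e] by (auto simp: below_def)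
  show "x \<in> below n v a"
    using x assms(3) E.near_endpoint_antimono[OF assms(2)] by (auto simp: below_def)
qed

definition gap_dev :: "nat \<Rightarrow> real \<Rightarrow> (nat \<Rightarrow> real) set" where
  "gap_dev n \<eta> = {x \<in> space S. \<eta> \<le> \<bar>gap (emp n x) e - gap \<nu> e\<bar>}"

definition growth_dev :: "nat \<Rightarrow> real \<Rightarrow> real \<Rightarrow> real \<Rightarrow> (nat \<Rightarrow> real) set" where
  "growth_dev n a t \<eta> =
     {x \<in> space S. \<eta> \<le> \<bar>growth (emp n x) e a t - growth \<nu> e a t\<bar>}"

lemma dev_sets [measurable]: "gap_dev n \<eta> \<in> sets S" "growth_dev n a t \<eta> \<in> sets S"
  unfolding gap_dev_def growth_dev_def gap_empirical growth_empirical by measurable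

lemma gap_dev_tendsto: "0 < \<eta> \<Longrightarrow> (\<lambda>n. measure S (gap_dev n \<eta>)) \<longlonglongrightarrow> 0"
  unfolding gap_dev_def gap_empirical gap_def[of \<nu>]
  by (rule iid_weak_law_bounded[OF prob_space_axioms sets_\<nu>, where a = 0 and b = 1])
    (use AE_unit e in \<open>auto simp del: atLeastAtMost_iff elim!: eventually_mono, auto\<close>)

lemma growth_dev_tendsto:
  assumes a: "0 < a" "a \<le> 1" and t: "0 \<le> t" "t < 1" and \<eta>: "0 < \<eta>"
  shows "(\<lambda>n. measure S (growth_dev n a t \<eta>)) \<longlonglongrightarrow> 0"
  unfolding growth_dev_def growth_empirical growth_def[of \<nu>]
proof (rule iid_weak_law_bounded[OF prob_space_axioms sets_\<nu> _ _ _ \<eta>])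
  show "AE x in \<nu>. ln (bet e a t x) \<in> {ln (1 - t)..ln (1 / a) + 1}"
    using AE_unit by eventually_elim (use ln_bet_bounds[OF a t] in fastforce)
  have "ln (1 - t) \<le> 0" using t by simp
  moreover have "0 \<le> ln (1 / a)" using a by simp
  ultimately show "ln (1 - t) < ln (1 / a) + 1" by linarith
qed measurable

lemma measure_tendsto_0_mono:
  assumes "\<And>n::nat. 0 < n \<Longrightarrow> A n \<subseteq> B n" "\<And>n. B n \<in> sets S" "(\<lambda>n. measure S (B n)) \<longlonglongrightarrow> 0"
  shows "(\<lambda>n. measure S (A n)) \<longlonglongrightarrow> 0"
proof (rule tendsto_sandwich[OF _ _ tendsto_const assms(3)])
  show "\<forall>\<^sub>F n in sequentially. measure S (A n) \<le> measure S (B n)"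
    using eventually_gt_at_top[of 0] by eventually_elim (intro S.finite_measure_mono assms)
qed simp

lemma measure_Un_tendsto_0:
  assumes "(\<lambda>n::nat. measure S (A n)) \<longlonglongrightarrow> 0" "(\<lambda>n. measure S (B n)) \<longlonglongrightarrow> 0"
    and "\<And>n. A n \<in> sets S" "\<And>n. B n \<in> sets S"
  shows "(\<lambda>n. measure S (A n \<union> B n)) \<longlonglongrightarrow> 0"
proof (rule tendsto_sandwich[OF _ _ tendsto_const])
  show "\<forall>\<^sub>F n in sequentially. measure S (A n \<union> B n) \<le> measure S (A n) + measure S (B n)"
    by (intro always_eventually allI measure_Un_le assms)
  show "(\<lambda>n. measure S (A n) + measure S (B n)) \<longlonglongrightarrow> 0"
    using tendsto_add[OF assms(1,2)] by simp
qed simp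

text \<open>
If the averages of the finitely many bets of a fine grid are close to their expectations, then the
empirical dual value at \<open>a\<close> exceeds the true one by little, so \<open>a\<close> is admissible.
\<close>

lemma above_tendsto_0:
  assumes a: "0 < a" "a < gap \<nu> e" and v: "max_growth \<nu> e a < v"
  shows "(\<lambda>n. measure S (above n v a)) \<longlonglongrightarrow> 0"
proof -
  have a1: "a \<le> 1" using a gap_bounds by simp
  define \<eta> where "\<eta> = (v - max_growth \<nu> e a) / 2"
  have \<eta>: "0 < \<eta>" "2 * \<eta> = v - max_growth \<nu> e a" using v by (simp_all add: \<eta>_def)
  obtain N where N: "0 < N" "1 / real N < \<eta>"
    using reals_Archimedean[OF \<eta>(1)] by (metis inverse_eq_divide zero_less_Suc)
  let ?t = "\<lambda>j. real j / real (N + 1)"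
  have t: "0 \<le> ?t j" "?t j < 1" if "j \<le> N" for j using that by auto
  let ?D = "\<lambda>n. \<Union>j\<in>{..N}. growth_dev n a (?t j) \<eta>"
  have D: "(\<lambda>n. measure S (?D n)) \<longlonglongrightarrow> 0"
  proof (rule tendsto_sandwich[OF _ _ tendsto_const])
    show "\<forall>\<^sub>F n in sequentially. measure S (?D n) \<le> (\<Sum>j\<le>N. measure S (growth_dev n a (?t j) \<eta>))"
      by (intro always_eventually allI S.finite_measure_subadditive_finite) auto
    show "(\<lambda>n. \<Sum>j\<le>N. measure S (growth_dev n a (?t j) \<eta>)) \<longlonglongrightarrow> 0"
      by (intro tendsto_null_sum growth_dev_tendsto[OF a(1) a1 _ _ \<eta>(1)]) auto
  qed simp
  show ?thesis
  proof (rule measure_tendsto_0_mono[of _ "\<lambda>n. gap_dev n (gap \<nu> e - a) \<union> ?D n"])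
    show "(\<lambda>n. measure S (gap_dev n (gap \<nu> e - a) \<union> ?D n)) \<longlonglongrightarrow> 0"
      by (rule measure_Un_tendsto_0[OF gap_dev_tendsto D]) (use a in auto)
    show "gap_dev n (gap \<nu> e - a) \<union> ?D n \<in> sets S" for n by auto
    fix n :: nat assume n: "0 < n"
    show "above n v a \<subseteq> gap_dev n (gap \<nu> e - a) \<union> ?D n"
    proof
      fix x assume x: "x \<in> above n v a"
      let ?E = "emp n x"
      interpret E: unit_side ?E e using unit_side_empirical[OF n _ e] x by (auto simp: above_def)
      show "x \<in> gap_dev n (gap \<nu> e - a) \<union> ?D n"
      proof (rule ccontr)
        assume no: "x \<notin> gap_dev n (gap \<nu> e - a) \<union> ?D n"
        have sp: "x \<in> space S" using x by (simp add: above_def)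
        have g: "a < gap ?E e" using no sp by (auto simp: gap_dev_def)
        have close: "growth ?E e a (?t j) < growth \<nu> e a (?t j) + \<eta>" if "j \<le> N" for j
        proof -
          have "x \<notin> growth_dev n a (?t j) \<eta>" using no that by blast
          then show ?thesis using sp unfolding growth_dev_def by (simp only: mem_Collect_eq simp_thms)
        qed
        have "max_growth ?E e a \<le> v"
        proof (rule E.max_growth_leI)
          fix t :: real assume tt: "0 \<le> t" "t < 1"
          obtain j where j: "j \<le> N" "growth ?E e a t \<le> growth ?E e a (?t j) + ln (1 + 1 / real N)"
            using E.growth_le_grid[OF N(1) tt a(1) a1] by auto
          have "ln (1 + 1 / real N) \<le> 1 / real N" by (rule ln_add_one_self_le_self) simp
          moreover have "growth \<nu> e a (?t j) \<le> max_growth \<nu> e a"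
            by (rule growth_le_max_growth[OF a(1) a1 t[OF j(1)]])
          ultimately have "growth ?E e a t \<le> max_growth \<nu> e a + 2 * \<eta>"
            using j(2) close[OF j(1)] N(2) by linarith
          then show "growth ?E e a t \<le> v" using \<eta>(2) by simp
        qed
        then have "near_endpoint ?E e v \<le> a" by (rule E.near_endpoint_le[OF a(1) g])
        then show False using x by (simp add: above_def)
      qed
    qed
  qed
qed

lemma above_subset_gap_dev:
  assumes n: "0 < n" shows "above n v a \<subseteq> gap_dev n (a - gap \<nu> e)"
proof
  fix x assume x: "x \<in> above n v a"
  then interpret E: unit_side "emp n x" e
    using unit_side_empirical[OF n _ e] by (auto simp: above_def)
  have "a < gap (emp n x) e"
    using x E.near_endpoint_bounds(2)[of v] by (simp add: above_def)
  then show "x \<in> gap_dev n (a - gap \<nu> e)" using x by (simp add: gap_dev_def above_def)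
qed

text \<open>
One bet whose expected growth exceeds \<open>v\<close> suffices to rule out \<open>a\<close> and every smaller candidate.
\<close>

lemma below_tendsto_0:
  assumes a: "0 < a" "a < gap \<nu> e" and v: "v < max_growth \<nu> e a"
  shows "(\<lambda>n. measure S (below n v a)) \<longlonglongrightarrow> 0"
proof -
  have a1: "a \<le> 1" using a gap_bounds by simp
  have "\<exists>t. 0 \<le> t \<and> t < 1 \<and> v < growth \<nu> e a t"
    using v max_growth_leI[of a v] by (meson not_less)
  then obtain t where t: "0 \<le> t" "t < 1" "v < growth \<nu> e a t" by auto
  define \<eta> where "\<eta> = growth \<nu> e a t - v"
  have \<eta>: "0 < \<eta>" using t by (simp add: \<eta>_def)
  show ?thesis
  proof (rule measure_tendsto_0_mono[of _ "\<lambda>n. gap_dev n (gap \<nu> e - a) \<union> growth_dev n a t \<eta>"])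
    show "(\<lambda>n. measure S (gap_dev n (gap \<nu> e - a) \<union> growth_dev n a t \<eta>)) \<longlonglongrightarrow> 0"
      by (rule measure_Un_tendsto_0[OF gap_dev_tendsto growth_dev_tendsto[OF a(1) a1 t(1,2) \<eta>]])
        (use a in auto)
    show "gap_dev n (gap \<nu> e - a) \<union> growth_dev n a t \<eta> \<in> sets S" for n by auto
    fix n :: nat assume n: "0 < n"
    show "below n v a \<subseteq> gap_dev n (gap \<nu> e - a) \<union> growth_dev n a t \<eta>"
    proof
      fix x assume x: "x \<in> below n v a"
      let ?E = "emp n x"
      interpret E: unit_side ?E e using unit_side_empirical[OF n _ e] x by (auto simp: below_def)
      show "x \<in> gap_dev n (gap \<nu> e - a) \<union> growth_dev n a t \<eta>"
      proof (rule ccontr)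
        assume no: "x \<notin> gap_dev n (gap \<nu> e - a) \<union> growth_dev n a t \<eta>"
        have sp: "x \<in> space S" using x by (simp add: below_def)
        have g: "a \<le> gap ?E e" using no sp by (auto simp: gap_dev_def)
        have "v < growth ?E e a t"
          using no sp by (auto simp: growth_dev_def abs_less_iff not_le \<eta>_def)
        also have "\<dots> \<le> max_growth ?E e a" by (rule E.growth_le_max_growth[OF a(1) a1 t(1,2)])
        finally have "a \<le> near_endpoint ?E e v" by (rule E.near_endpoint_ge[OF a(1) g])
        then show False using x by (simp add: below_def)
      qed
    qed
  qed
qed

end

section \<open>Random sample sizes and coverage\<close>

locale sampling = cost +
  fixes \<nu> :: "real measure"
  assumes \<nu>: "\<nu> \<in> prob_unit_interval"
begin

sublocale L: unit_side \<nu> 0 by unfold_locales (use \<nu> in auto)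
sublocale R: unit_side \<nu> 1 by unfold_locales (use \<nu> in auto)

abbreviation S :: "(nat \<Rightarrow> real) measure" where "S \<equiv> iid \<nu>"
abbreviation J :: "((nat \<Rightarrow> real) \<times> (nat \<Rightarrow> real)) measure" where "J \<equiv> joint_law \<nu> C"

sublocale J: pair_prob_space S T
  by (unfold_locales)

lemma J_eq: "J = S \<Otimes>\<^sub>M T" by (simp add: joint_law_def)

lemma random_index_sets:
  assumes A: "\<And>n. A n \<in> sets S" and N: "N \<in> measurable T (count_space (UNIV::nat set))"
  shows "{\<omega> \<in> space J. fst \<omega> \<in> A (N (snd \<omega>))} \<in> sets J"
proof -
  have sub: "A n \<subseteq> space S" for n using sets.sets_into_space[OF A] .
  have "{\<omega> \<in> space J. fst \<omega> \<in> A (N (snd \<omega>))} = (\<Union>n. A n \<times> (N -` {n} \<inter> space T))"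
    using sub by (fastforce simp: J_eq space_pair_measure)
  also have "\<dots> \<in> sets J"
    unfolding J_eq using A measurable_sets[OF N] by (intro sets.countable_UN' pair_measureI) auto
  finally show ?thesis .
qed

text \<open>
Conditionally on the costs the sample size is a constant, so bounds that hold for every good fixed
sample size carry over.
\<close>

lemma random_index_measure_le:
  assumes A: "\<And>n. A n \<in> sets S" and N: "N \<in> measurable T (count_space (UNIV::nat set))"
    and le: "\<And>n. n \<in> G \<Longrightarrow> measure S (A n) \<le> p" and p: "0 \<le> p"
  shows "measure J {\<omega> \<in> space J. fst \<omega> \<in> A (N (snd \<omega>))} \<le> p + measure T {c \<in> space T. N c \<notin> G}"
proof -
  let ?E = "{\<omega> \<in> space J. fst \<omega> \<in> A (N (snd \<omega>))}"
  note N[measurable]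
  have G: "{c \<in> space T. N c \<notin> G} \<in> sets T"
  proof -
    have "{c \<in> space T. N c \<notin> G} = N -` (- G) \<inter> space T" by auto
    then show ?thesis using measurable_sets[OF N] by simp
  qed
  have E: "?E \<in> sets (S \<Otimes>\<^sub>M T)" using random_index_sets[OF A N] by (simp add: J_eq)
  have "emeasure (S \<Otimes>\<^sub>M T) ?E = (\<integral>\<^sup>+c. emeasure S ((\<lambda>x. (x, c)) -` ?E) \<partial>T)"
    by (rule J.emeasure_pair_measure_alt2[OF E])
  also have "\<dots> \<le> (\<integral>\<^sup>+c. ennreal p + indicator {c \<in> space T. N c \<notin> G} c \<partial>T)"
  proof (rule nn_integral_mono)
    fix c assume c: "c \<in> space T"
    have "(\<lambda>x. (x, c)) -` ?E = A (N c)"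
      using c sets.sets_into_space[OF A, of "N c"] by (auto simp: J_eq space_pair_measure)
    moreover have "emeasure S (A (N c)) \<le> ennreal p + indicator {c \<in> space T. N c \<notin> G} c"
    proof (cases "N c \<in> G")
      case True
      then show ?thesis using ennreal_leI[OF le[OF True]] by (simp add: L.S.emeasure_eq_measure)
    next
      case False
      have "emeasure S (A (N c)) \<le> 1" by (rule L.S.emeasure_le_1)
      also have "1 \<le> ennreal p + 1" by simp
      finally show ?thesis using False c by simp
    qed
    ultimately show "emeasure S ((\<lambda>x. (x, c)) -` ?E) \<le> ennreal p + indicator {c \<in> space T. N c \<notin> G} c"
      by simp
  qed
  also have "\<dots> = ennreal p + emeasure T {c \<in> space T. N c \<notin> G}"
    using G by (subst nn_integral_add) (auto simp: T.emeasure_space_1)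
  also have "\<dots> = ennreal (p + measure T {c \<in> space T. N c \<notin> G})"
    using p by (simp add: T.emeasure_eq_measure)
  finally have "ennreal (J.prob ?E) \<le> ennreal (p + measure T {c \<in> space T. N c \<notin> G})"
    by (simp only: J.emeasure_eq_measure)
  then show ?thesis
    unfolding J_eq using p by (subst (asm) ennreal_le_iff) auto
qed

abbreviation \<pi> :: policy where "\<pi> \<equiv> KL_inf_policy prob_unit_interval threshold"

lemma endpoint_measurable [measurable]:
  "(\<lambda>x. fst (\<pi> \<delta> (sample n x))) \<in> borel_measurable S"
  "(\<lambda>x. snd (\<pi> \<delta> (sample n x))) \<in> borel_measurable S"
  by (intro KL_inf_policy_measurable iid_coord_measurable[OF R.sets_\<nu>])+

definition uncovered :: "real \<Rightarrow> nat \<Rightarrow> (nat \<Rightarrow> real) set" where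
  "uncovered \<delta> n = {x \<in> space S.
     \<not> (fst (\<pi> \<delta> (sample n x)) \<le> ereal (mean \<nu>) \<and> ereal (mean \<nu>) \<le> snd (\<pi> \<delta> (sample n x)))}"

lemma uncovered_sets: "uncovered \<delta> n \<in> sets S"
  unfolding uncovered_def by measurable

lemma measure_uncovered:
  assumes \<delta>: "0 < \<delta>"
  shows "measure S (uncovered \<delta> n) \<le> \<delta>"
proof (cases "n = 0")
  case True
  have "uncovered \<delta> n = {}"
    using True R.gap_bounds gap_mean[OF \<nu>]
    by (auto simp: uncovered_def KL_inf_policy_def Let_def zero_ereal_def one_ereal_def)
  then show ?thesis using \<delta> by simp
next
  case False
  then have n: "0 < n" by simp
  have "measure S (uncovered \<delta> n) \<le> measure S (L.miss n \<delta> \<union> R.miss n \<delta>)"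
  proof (rule L.S.finite_measure_mono_AE)
    show "AE x in S. x \<in> uncovered \<delta> n \<longrightarrow> x \<in> L.miss n \<delta> \<union> R.miss n \<delta>"
      using R.AE_in_unit
    proof eventually_elim
      case (elim x)
      then have "in_unit n x" by simp
      then show ?case
        by (auto simp: uncovered_def L.miss_def R.miss_def KL_inf_policy_sample[OF n] gap_mean[OF \<nu>])
    qed
    show "L.miss n \<delta> \<union> R.miss n \<delta> \<in> sets S" using L.miss_sets[OF n] R.miss_sets[OF n] by auto
  qed
  also have "\<dots> \<le> measure S (L.miss n \<delta>) + measure S (R.miss n \<delta>)"
    using L.miss_sets[OF n] R.miss_sets[OF n] by (intro measure_Un_le) auto
  also have "\<dots> \<le> \<delta> / 2 + \<delta> / 2"
    using L.emeasure_miss[OF n \<delta>] R.emeasure_miss[OF n \<delta>] \<delta>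
    by (intro add_mono) (auto simp: L.S.emeasure_eq_measure)
  finally show ?thesis by simp
qed

lemma coverage:
  assumes \<delta>: "0 < \<delta>"
  shows "1 - \<delta> \<le> measure J {\<omega> \<in> space J.
     ereal (mean \<nu>) \<in> {left_endpoint \<pi> b \<delta> \<omega>..right_endpoint \<pi> b \<delta> \<omega>}}"
proof -
  let ?U = "{\<omega> \<in> space J. fst \<omega> \<in> uncovered \<delta> (num_samples (b \<delta>) (snd \<omega>))}"
  have U: "?U \<in> sets J" by (intro random_index_sets uncovered_sets num_samples_measurable)
  have "measure J ?U \<le> \<delta> + measure T {c \<in> space T. num_samples (b \<delta>) c \<notin> UNIV}"
    by (rule random_index_measure_le) (use \<delta> measure_uncovered uncovered_sets num_samples_measurable in auto)
  then have "measure J ?U \<le> \<delta>" by simp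
  moreover have "measure J (space J - ?U) = 1 - measure J ?U"
    using U unfolding J_eq by (rule J.prob_compl)
  moreover have "space J - ?U = {\<omega> \<in> space J.
     ereal (mean \<nu>) \<in> {left_endpoint \<pi> b \<delta> \<omega>..right_endpoint \<pi> b \<delta> \<omega>}}"
    by (auto simp: uncovered_def left_endpoint_def right_endpoint_def J_eq space_pair_measure split_beta)
  ultimately show ?thesis by simp
qed

end

lemma KL_inf_policy_in_CI_policies:
  assumes "cost C"
  shows "KL_inf_policy prob_unit_interval threshold \<in> CI_policies prob_unit_interval C b"
  unfolding CI_policies_def
proof safe
  show "policy (KL_inf_policy prob_unit_interval threshold)" by (rule policy_KL_inf_policy)
  fix \<nu> :: "real measure" and \<delta> :: real
  assume \<nu>: "\<nu> \<in> prob_unit_interval" and \<delta>: "\<delta> \<in> {0<..<1}"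
  interpret cost C by fact
  interpret sampling C \<nu> by unfold_locales fact
  show "1 - \<delta> \<le> measure (joint_law \<nu> C)
          {\<omega> \<in> space (joint_law \<nu> C).
             ereal (mean \<nu>) \<in> {left_endpoint \<pi> b \<delta> \<omega>..right_endpoint \<pi> b \<delta> \<omega>}}"
    using coverage[of \<delta> b] \<delta> by simp
qed

section \<open>The threshold per sample\<close>

locale budget = cost +
  fixes b :: "real \<Rightarrow> real" and K :: ereal
  assumes b_top: "filterlim b at_top (at_right 0)"
    and K_nonneg: "0 \<le> K"
    and b_ratio: "((\<lambda>\<delta>. ereal (b \<delta> / ln (1 / \<delta>))) \<longlongrightarrow> K) (at_right 0)"
begin

text \<open>
With high probability: the number of samples lies in \<open>G \<delta>\<close> with probability tending to one.
\<close>

definition whp :: "(real \<Rightarrow> nat set) \<Rightarrow> bool" where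
  "whp G \<longleftrightarrow> ((\<lambda>\<delta>. measure T {c \<in> space T. num_samples (b \<delta>) c \<notin> G \<delta>}) \<longlongrightarrow> 0) (at_right 0)"

lemma num_samples_event: "{c \<in> space T. num_samples r c \<in> G} \<in> sets T"
proof -
  have "{c \<in> space T. num_samples r c \<in> G} = num_samples r -` G \<inter> space T" by auto
  then show ?thesis using measurable_sets[OF num_samples_measurable] by simp
qed

lemma whp_mono:
  assumes "whp G" "\<forall>\<^sub>F \<delta> in at_right 0. G \<delta> \<subseteq> H \<delta>" shows "whp H"
  unfolding whp_def
proof (rule tendsto_sandwich[OF _ _ tendsto_const assms(1)[unfolded whp_def]])
  show "\<forall>\<^sub>F \<delta> in at_right 0. measure T {c \<in> space T. num_samples (b \<delta>) c \<notin> H \<delta>}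
      \<le> measure T {c \<in> space T. num_samples (b \<delta>) c \<notin> G \<delta>}"
    using assms(2)
  proof eventually_elim
    case (elim \<delta>)
    show ?case
      using num_samples_event[of "b \<delta>" "- G \<delta>"] elim by (intro T.finite_measure_mono) auto
  qed
qed simp

lemma whp_Int:
  assumes "whp G" "whp H" shows "whp (\<lambda>\<delta>. G \<delta> \<inter> H \<delta>)"
  unfolding whp_def
proof (rule tendsto_sandwich[OF _ _ tendsto_const])
  show "((\<lambda>\<delta>. measure T {c \<in> space T. num_samples (b \<delta>) c \<notin> G \<delta>}
      + measure T {c \<in> space T. num_samples (b \<delta>) c \<notin> H \<delta>}) \<longlongrightarrow> 0) (at_right 0)"
    using tendsto_add[OF assms[unfolded whp_def]] by simp
  show "\<forall>\<^sub>F \<delta> in at_right 0. measure T {c \<in> space T. num_samples (b \<delta>) c \<notin> G \<delta> \<inter> H \<delta>}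
      \<le> measure T {c \<in> space T. num_samples (b \<delta>) c \<notin> G \<delta>}
      + measure T {c \<in> space T. num_samples (b \<delta>) c \<notin> H \<delta>}"
  proof (rule always_eventually, rule allI)
    fix \<delta>
    have "{c \<in> space T. num_samples (b \<delta>) c \<notin> G \<delta> \<inter> H \<delta>}
      = {c \<in> space T. num_samples (b \<delta>) c \<notin> G \<delta>} \<union> {c \<in> space T. num_samples (b \<delta>) c \<notin> H \<delta>}" by auto
    then show "measure T {c \<in> space T. num_samples (b \<delta>) c \<notin> G \<delta> \<inter> H \<delta>}
      \<le> measure T {c \<in> space T. num_samples (b \<delta>) c \<notin> G \<delta>}
      + measure T {c \<in> space T. num_samples (b \<delta>) c \<notin> H \<delta>}"
      using num_samples_event[of "b \<delta>" "- G \<delta>"] num_samples_event[of "b \<delta>" "- H \<delta>"]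
      by (simp only:) (intro measure_Un_le, auto)
  qed
qed simp

lemma whp_UNIV: "whp (\<lambda>\<delta>. UNIV)" by (simp add: whp_def)

lemma whp_window:
  assumes "0 < \<epsilon>" "\<epsilon> < 1"
  shows "whp (\<lambda>\<delta>. {n. (1 - \<epsilon>) * b \<delta> / mean C \<le> real n \<and> real n \<le> (1 + \<epsilon>) * b \<delta> / mean C})"
  using filterlim_compose[OF num_samples_concentration[OF assms] b_top] by (simp add: whp_def)

lemma whp_ge: "whp (\<lambda>\<delta>. {N..})"
proof (rule whp_mono[OF whp_window[of "1/2"]])
  have "\<forall>\<^sub>F \<delta> in at_right 0. 2 * mean C * real N \<le> b \<delta>"
    using b_top by (simp add: filterlim_at_top)
  then show "\<forall>\<^sub>F \<delta> in at_right 0. {n. (1 - 1/2) * b \<delta> / mean C \<le> real n \<and> real n \<le> (1 + 1/2) * b \<delta> / mean C} \<subseteq> {N..}"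
  proof eventually_elim
    case (elim \<delta>)
    then have "real N \<le> (1 - 1/2) * b \<delta> / mean C" using mean_pos by (simp add: field_simps)
    then show ?case by auto
  qed
qed auto

lemma ln_inverse_pos: "\<forall>\<^sub>F \<delta>::real in at_right 0. 0 < \<delta> \<and> 0 < ln (1 / \<delta>)"
  using eventually_at_right_real[of 0 "1::real"] by (auto elim!: eventually_mono simp: ln_div)

text \<open>
The limit of the threshold per sample is \<open>mean C / K\<close>. The two comparisons with this limit are stated
without dividing by \<open>K\<close>, which may be \<open>0\<close> or infinite.
\<close>

lemma whp_threshold_ge:
  assumes v: "0 < v" and K: "K < ereal (mean C / v)"
  shows "whp (\<lambda>\<delta>. {n. v \<le> threshold n \<delta> / real n})"
proof -
  obtain k where k: "K < ereal k" "k < mean C / v" using ereal_dense2[OF K] by auto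
  have k0: "0 < k" using K_nonneg k(1) by (metis ereal_less(2) le_less_trans)
  define \<epsilon> where "\<epsilon> = min (1/2) (mean C / (v * k) - 1)"
  have "1 < mean C / (v * k)" using k k0 v by (simp add: field_simps)
  then have \<epsilon>: "0 < \<epsilon>" "\<epsilon> < 1" "\<epsilon> \<le> mean C / (v * k) - 1" by (auto simp: \<epsilon>_def)
  then have ek: "(1 + \<epsilon>) * k / mean C \<le> 1 / v" using v k0 mean_pos by (simp add: field_simps)
  show ?thesis
  proof (rule whp_mono[OF whp_Int[OF whp_window[OF \<epsilon>(1,2)] whp_ge[of 1]]])
    have "\<forall>\<^sub>F \<delta> in at_right 0. ereal (b \<delta> / ln (1 / \<delta>)) < ereal k"
      by (rule order_tendstoD(2)[OF b_ratio k(1)])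
    then show "\<forall>\<^sub>F \<delta> in at_right 0. {n. (1 - \<epsilon>) * b \<delta> / mean C \<le> real n \<and> real n \<le> (1 + \<epsilon>) * b \<delta> / mean C} \<inter> {1..}
        \<subseteq> {n. v \<le> threshold n \<delta> / real n}"
      using ln_inverse_pos
    proof eventually_elim
      case (elim \<delta>)
      define l where "l = ln (1 / \<delta>)"
      have l: "0 < l" "b \<delta> < k * l" using elim by (auto simp: l_def field_simps)
      show ?case
      proof safe
        fix n assume n: "n \<ge> 1" "real n \<le> (1 + \<epsilon>) * b \<delta> / mean C"
        note n(2)
        also have "(1 + \<epsilon>) * b \<delta> / mean C \<le> (1 + \<epsilon>) * (k * l) / mean C"
          using l \<epsilon> mean_pos by (intro divide_right_mono mult_left_mono) auto
        also have "\<dots> = ((1 + \<epsilon>) * k / mean C) * l" by simp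
        also have "\<dots> \<le> 1 / v * l" using ek l by (intro mult_right_mono) auto
        finally have "v * real n \<le> l" using v by (simp add: field_simps)
        also have "l \<le> threshold n \<delta>"
        proof -
          have "1 / \<delta> \<le> 2 * (1 + real n) / \<delta>" using elim by (intro divide_right_mono) auto
          then have "l \<le> ln (2 * (1 + real n) / \<delta>)" unfolding l_def using elim by (intro ln_mono) auto
          then show ?thesis by (simp add: threshold_def)
        qed
        finally show "v \<le> threshold n \<delta> / real n" using n by (simp add: field_simps)
      qed
    qed
  qed
qed

lemma log_overhead_tendsto_0: "(\<lambda>n. (1 + ln (2 * (1 + real n))) / real n) \<longlonglongrightarrow> 0"
proof -
  have 1: "(\<lambda>n. (1 + ln 2) * (1 / real n)) \<longlonglongrightarrow> (1 + ln 2) * 0"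
    by (intro tendsto_intros lim_1_over_n)
  have 2: "(\<lambda>n. ln (real (Suc n)) / real (Suc n) * (1 + 1 / real n)) \<longlonglongrightarrow> 0 * (1 + 0)"
    by (intro tendsto_intros lim_1_over_n filterlim_compose[OF lim_ln_over_n filterlim_Suc])
  have "(\<lambda>n. (1 + ln 2) * (1 / real n) + ln (real (Suc n)) / real (Suc n) * (1 + 1 / real n)) \<longlonglongrightarrow> 0"
    using tendsto_add[OF 1 2] by simp
  then show ?thesis
  proof (rule Lim_transform_eventually)
    show "\<forall>\<^sub>F n in sequentially. (1 + ln 2) * (1 / real n) + ln (real (Suc n)) / real (Suc n) * (1 + 1 / real n)
        = (1 + ln (2 * (1 + real n))) / real n"
      using eventually_gt_at_top[of 0]
    proof eventually_elim
      case (elim n)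
      have "ln (real (Suc n)) / real (Suc n) * (1 + 1 / real n) = ln (real (Suc n)) / real n"
      proof -
        have "1 + 1 / real n = real (Suc n) / real n" using elim by (simp add: field_simps)
        then show ?thesis by simp
      qed
      moreover have "ln (2 * (1 + real n)) = ln 2 + ln (real (Suc n))" using ln_mult_pos[of 2 "1 + real n"] by simp
      ultimately show ?case by (simp add: add_divide_distrib)
    qed
  qed
qed

lemma whp_threshold_le:
  assumes v: "0 < v" and K: "ereal (mean C / v) < K"
  shows "whp (\<lambda>\<delta>. {n. 0 < n \<and> threshold n \<delta> / real n \<le> v})"
proof -
  obtain k where k: "mean C / v < k" "ereal k < K" using ereal_dense2[OF K] by auto
  have "0 < mean C / v" using mean_pos v by simp
  then have k0: "0 < k" using k by linarith
  (* The slack between mean C / K and v is split twice: w leaves v - w for the logarithmic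
     overhead of the threshold, and \<epsilon> is such that the lower end of the window is b / (k * w). *)
  have "mean C / k < v" using k k0 v by (simp add: field_simps)
  then obtain w where w: "mean C / k < w" "w < v" using dense by blast
  have w0: "0 < w" using w mean_pos k0 by (meson divide_pos_pos less_trans)
  define \<epsilon> where "\<epsilon> = 1 - mean C / (k * w)"
  have "mean C / (k * w) < 1" using w w0 k0 by (simp add: field_simps)
  moreover have "0 < mean C / (k * w)" using mean_pos k0 w0 by simp
  ultimately have \<epsilon>: "0 < \<epsilon>" "\<epsilon> < 1" unfolding \<epsilon>_def by linarith+
  have "\<forall>\<^sub>F n in sequentially. (1 + ln (2 * (1 + real n))) / real n < v - w"
    using order_tendstoD(2)[OF log_overhead_tendsto_0, of "v - w"] w by simp
  then obtain N where N: "\<And>n. N \<le> n \<Longrightarrow> (1 + ln (2 * (1 + real n))) / real n < v - w"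
    by (auto simp: eventually_sequentially)
  show ?thesis
  proof (rule whp_mono[OF whp_Int[OF whp_window[OF \<epsilon>] whp_ge[of "max 1 N"]]])
    have "\<forall>\<^sub>F \<delta> in at_right 0. ereal k < ereal (b \<delta> / ln (1 / \<delta>))"
      by (rule order_tendstoD(1)[OF b_ratio k(2)])
    then show "\<forall>\<^sub>F \<delta> in at_right 0. {n. (1 - \<epsilon>) * b \<delta> / mean C \<le> real n \<and> real n \<le> (1 + \<epsilon>) * b \<delta> / mean C} \<inter> {max 1 N..}
        \<subseteq> {n. 0 < n \<and> threshold n \<delta> / real n \<le> v}"
      using ln_inverse_pos
    proof eventually_elim
      case (elim \<delta>)
      define l where "l = ln (1 / \<delta>)"
      have l: "0 < l" "k * l < b \<delta>" using elim by (auto simp: l_def field_simps)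
      show ?case
      proof safe
        fix n assume n: "n \<ge> max 1 N" "(1 - \<epsilon>) * b \<delta> / mean C \<le> real n"
        show "0 < n" using n by simp
        have "(1 - \<epsilon>) * b \<delta> / mean C = b \<delta> / (k * w)"
          using mean_pos k0 w0 by (simp add: \<epsilon>_def)
        moreover have "k * l / (k * w) \<le> b \<delta> / (k * w)"
          using l k0 w0 by (intro divide_right_mono) auto
        ultimately have "l / w \<le> real n" using n k0 by simp
        then have lw: "l / real n \<le> w" using w0 n by (simp add: field_simps)
        have "threshold n \<delta> = (1 + ln (2 * (1 + real n))) + l"
          using elim by (simp add: threshold_def l_def ln_div)
        then have "threshold n \<delta> / real n = (1 + ln (2 * (1 + real n))) / real n + l / real n"
          by (simp add: add_divide_distrib)
        then show "threshold n \<delta> / real n \<le> v" using N[of n] lw n by simp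
      qed
    qed
  qed
qed

end

section \<open>Limiting endpoints\<close>

lemma tendsto_in_prob_unique:
  assumes M: "prob_space M" and Y: "\<And>\<delta>. Y \<delta> \<in> borel_measurable M"
    and 1: "tendsto_in_prob M Y (ereal r)" and 2: "tendsto_in_prob M Y l"
  shows "l = ereal r"
proof (rule ccontr)
  interpret prob_space M by fact
  note Y[measurable]
  assume ne: "l \<noteq> ereal r"
  have half: "((\<lambda>\<delta>. prob {\<omega> \<in> space M. ereal \<epsilon> < \<bar>Y \<delta> \<omega> - ereal r\<bar>}) \<longlongrightarrow> 0) (at_right 0)" if "0 < \<epsilon>" for \<epsilon>
    using 1 that by (simp add: tendsto_in_prob_def)
  have contr: False if "0 < \<epsilon>"
    and "\<And>\<delta>. space M \<subseteq> {\<omega> \<in> space M. ereal \<epsilon> < \<bar>Y \<delta> \<omega> - ereal r\<bar>} \<union> {\<omega> \<in> space M. P \<delta> \<omega>}"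
    and "((\<lambda>\<delta>. prob {\<omega> \<in> space M. P \<delta> \<omega>}) \<longlongrightarrow> 0) (at_right 0)"
    and [measurable]: "\<And>\<delta>. Measurable.pred M (P \<delta>)" for P and \<epsilon> :: real
  proof -
    have "1 \<le> prob {\<omega> \<in> space M. ereal \<epsilon> < \<bar>Y \<delta> \<omega> - ereal r\<bar>} + prob {\<omega> \<in> space M. P \<delta> \<omega>}" for \<delta>
    proof -
      have "prob (space M) \<le> prob ({\<omega> \<in> space M. ereal \<epsilon> < \<bar>Y \<delta> \<omega> - ereal r\<bar>} \<union> {\<omega> \<in> space M. P \<delta> \<omega>})"
        by (rule finite_measure_mono[OF that(2)]) measurable
      also have "\<dots> \<le> prob {\<omega> \<in> space M. ereal \<epsilon> < \<bar>Y \<delta> \<omega> - ereal r\<bar>} + prob {\<omega> \<in> space M. P \<delta> \<omega>}"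
        by (rule measure_Un_le) measurable
      finally show ?thesis by (simp add: prob_space)
    qed
    then have "(1::real) \<le> 0 + 0"
      by (intro tendsto_lowerbound[OF tendsto_add[OF half[OF that(1)] that(3)]] always_eventually) auto
    then show False by simp
  qed
  show False
  proof (cases l)
    case (real l')
    define \<epsilon> where "\<epsilon> = \<bar>l' - r\<bar> / 3"
    have \<epsilon>: "0 < \<epsilon>" using ne real by (simp add: \<epsilon>_def)
    show False
    proof (rule contr[OF \<epsilon>])
      show "((\<lambda>\<delta>. prob {\<omega> \<in> space M. ereal \<epsilon> < \<bar>Y \<delta> \<omega> - ereal l'\<bar>}) \<longlongrightarrow> 0) (at_right 0)"
        using 2 \<epsilon> real by (simp add: tendsto_in_prob_def)
      show "space M \<subseteq> {\<omega> \<in> space M. ereal \<epsilon> < \<bar>Y \<delta> \<omega> - ereal r\<bar>} \<union> {\<omega> \<in> space M. ereal \<epsilon> < \<bar>Y \<delta> \<omega> - ereal l'\<bar>}" for \<delta>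
      proof safe
        fix \<omega> assume *: "\<not> ereal \<epsilon> < \<bar>Y \<delta> \<omega> - ereal l'\<bar>"
        then obtain z where z: "Y \<delta> \<omega> = ereal z" by (cases "Y \<delta> \<omega>") auto
        have "\<bar>z - l'\<bar> \<le> \<epsilon>" using * z by simp
        moreover have "3 * \<epsilon> = \<bar>l' - r\<bar>" by (simp add: \<epsilon>_def)
        ultimately have "\<epsilon> < \<bar>z - r\<bar>" using \<epsilon> by linarith
        then show "ereal \<epsilon> < \<bar>Y \<delta> \<omega> - ereal r\<bar>" using z by simp
      qed
    qed measurable
  next
    case PInf
    show False
    proof (rule contr[OF zero_less_one])
      show "((\<lambda>\<delta>. prob {\<omega> \<in> space M. Y \<delta> \<omega> \<le> ereal (r + 2)}) \<longlongrightarrow> 0) (at_right 0)"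
        using 2 PInf by (simp add: tendsto_in_prob_def)
      show "space M \<subseteq> {\<omega> \<in> space M. ereal 1 < \<bar>Y \<delta> \<omega> - ereal r\<bar>} \<union> {\<omega> \<in> space M. Y \<delta> \<omega> \<le> ereal (r + 2)}" for \<delta>
      proof safe
        fix \<omega> assume "\<not> Y \<delta> \<omega> \<le> ereal (r + 2)"
        then show "ereal 1 < \<bar>Y \<delta> \<omega> - ereal r\<bar>" by (cases "Y \<delta> \<omega>") auto
      qed
    qed auto
  next
    case MInf
    show False
    proof (rule contr[OF zero_less_one])
      show "((\<lambda>\<delta>. prob {\<omega> \<in> space M. ereal (r - 2) \<le> Y \<delta> \<omega>}) \<longlongrightarrow> 0) (at_right 0)"
        using 2 MInf by (simp add: tendsto_in_prob_def)
      show "space M \<subseteq> {\<omega> \<in> space M. ereal 1 < \<bar>Y \<delta> \<omega> - ereal r\<bar>} \<union> {\<omega> \<in> space M. ereal (r - 2) \<le> Y \<delta> \<omega>}" for \<delta>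
      proof safe
        fix \<omega> assume "\<not> ereal (r - 2) \<le> Y \<delta> \<omega>"
        then show "ereal 1 < \<bar>Y \<delta> \<omega> - ereal r\<bar>" by (cases "Y \<delta> \<omega>") auto
      qed
    qed auto
  qed
qed

locale budgeted_sampling = sampling C \<nu> + budget C b K
  for C \<nu> :: "real measure" and b :: "real \<Rightarrow> real" and K :: ereal
begin

lemma random_index_tendsto_0:
  assumes A: "\<And>\<delta> n. A \<delta> n \<in> sets S" and G: "whp G"
    and le: "\<And>\<delta> n. n \<in> G \<delta> \<Longrightarrow> measure S (A \<delta> n) \<le> p n" and p: "p \<longlonglongrightarrow> 0"
  shows "((\<lambda>\<delta>. measure J {\<omega> \<in> space J. fst \<omega> \<in> A \<delta> (num_samples (b \<delta>) (snd \<omega>))}) \<longlongrightarrow> 0) (at_right 0)"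
proof (rule tendstoI)
  fix \<rho> :: real assume \<rho>: "0 < \<rho>"
  have "\<forall>\<^sub>F n in sequentially. p n < \<rho> / 2" using order_tendstoD(2)[OF p half_gt_zero[OF \<rho>]] .
  then obtain N where N: "\<And>n. N \<le> n \<Longrightarrow> p n < \<rho> / 2" by (auto simp: eventually_sequentially)
  have "whp (\<lambda>\<delta>. G \<delta> \<inter> {N..})" by (rule whp_Int[OF G whp_ge])
  then have "\<forall>\<^sub>F \<delta> in at_right 0. measure T {c \<in> space T. num_samples (b \<delta>) c \<notin> G \<delta> \<inter> {N..}} < \<rho> / 2"
    unfolding whp_def using order_tendstoD(2) \<rho> half_gt_zero by blast
  then show "\<forall>\<^sub>F \<delta> in at_right 0. dist (measure J {\<omega> \<in> space J. fst \<omega> \<in> A \<delta> (num_samples (b \<delta>) (snd \<omega>))}) 0 < \<rho>"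
  proof eventually_elim
    case (elim \<delta>)
    have "measure J {\<omega> \<in> space J. fst \<omega> \<in> A \<delta> (num_samples (b \<delta>) (snd \<omega>))}
      \<le> \<rho> / 2 + measure T {c \<in> space T. num_samples (b \<delta>) c \<notin> G \<delta> \<inter> {N..}}"
    proof (rule random_index_measure_le[OF A num_samples_measurable])
      fix n assume n: "n \<in> G \<delta> \<inter> {N..}"
      then show "measure S (A \<delta> n) \<le> \<rho> / 2" using le[of n \<delta>] N[of n] by auto
    qed (use \<rho> in simp)
    then show ?case using elim by simp
  qed
qed

end

locale budgeted_side = unit_side \<nu> e + budget C b K
  for \<nu> :: "real measure" and e :: real and C :: "real measure" and b :: "real \<Rightarrow> real" and K :: ereal
begin

text \<open>
The dual value at \<open>s\<close> crosses the level \<open>mean C / K\<close>. In this form the condition covers all budgets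
at once: \<open>s\<close> is \<open>0\<close> for \<open>K = 0\<close>, the gap of \<open>\<nu>\<close> for infinite \<open>K\<close>,
and for \<open>K\<close> positive and finite the solution of the equation if the gap of \<open>\<nu>\<close> is positive.
\<close>

definition limit_gap :: "real \<Rightarrow> bool" where
  "limit_gap s \<longleftrightarrow> 0 \<le> s \<and> s \<le> gap \<nu> e \<and>
     (\<forall>a. s < a \<and> a < gap \<nu> e \<longrightarrow> (\<exists>v>0. max_growth \<nu> e a < v \<and> K < ereal (mean C / v))) \<and>
     (\<forall>a. 0 < a \<and> a < s \<longrightarrow> (\<exists>v>0. v < max_growth \<nu> e a \<and> ereal (mean C / v) < K))"

lemma limit_gap_above:
  assumes s: "limit_gap s" and \<epsilon>: "0 < \<epsilon>"
  shows "\<exists>G p. whp G \<and> p \<longlonglongrightarrow> 0 \<and>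
    (\<forall>\<delta> n. 0 < n \<and> n \<in> G \<delta> \<longrightarrow> measure S (above n (rate n \<delta>) (s + \<epsilon>)) \<le> p n)"
proof (cases "s + \<epsilon> / 2 < gap \<nu> e")
  case True
  define a where "a = s + \<epsilon> / 2"
  have a: "0 < a" "a < gap \<nu> e" "s < a" "a \<le> s + \<epsilon>" using True s \<epsilon> by (auto simp: a_def limit_gap_def)
  then obtain v where v: "0 < v" "max_growth \<nu> e a < v" "K < ereal (mean C / v)"
    using s unfolding limit_gap_def by blast
  show ?thesis
  proof (intro exI conjI allI impI)
    show "whp (\<lambda>\<delta>. {n. v \<le> threshold n \<delta> / real n})" by (rule whp_threshold_ge[OF v(1,3)])
    show "(\<lambda>n. measure S (above n v a)) \<longlonglongrightarrow> 0" by (rule above_tendsto_0[OF a(1,2) v(2)])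
    fix \<delta> n assume n: "0 < n \<and> n \<in> {n. v \<le> threshold n \<delta> / real n}"
    then show "measure S (above n (rate n \<delta>) (s + \<epsilon>)) \<le> measure S (above n v a)"
      by (intro S.finite_measure_mono above_mono above_below_sets a) auto
  qed
next
  case False
  then have "gap \<nu> e < s + \<epsilon>" using \<epsilon> by simp
  then have "(\<lambda>n. measure S (gap_dev n (s + \<epsilon> - gap \<nu> e))) \<longlonglongrightarrow> 0" by (intro gap_dev_tendsto) simp
  moreover have "measure S (above n v (s + \<epsilon>)) \<le> measure S (gap_dev n (s + \<epsilon> - gap \<nu> e))" if "0 < n" for n v
    by (rule S.finite_measure_mono[OF above_subset_gap_dev[OF that]]) simp
  ultimately show ?thesis using whp_UNIV by blast
qed

lemma limit_gap_below:
  assumes s: "limit_gap s" and \<epsilon>: "0 < \<epsilon>"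
  shows "\<exists>G p. whp G \<and> p \<longlonglongrightarrow> 0 \<and>
    (\<forall>\<delta> n. 0 < n \<and> n \<in> G \<delta> \<longrightarrow> measure S (below n (rate n \<delta>) (s - \<epsilon>)) \<le> p n)"
proof (cases "0 < s - \<epsilon>")
  case True
  define a where "a = s - \<epsilon>"
  have a: "0 < a" "a < gap \<nu> e" "a < s" using True s \<epsilon> by (auto simp: a_def limit_gap_def)
  then obtain v where v: "0 < v" "v < max_growth \<nu> e a" "ereal (mean C / v) < K"
    using s unfolding limit_gap_def by blast
  show ?thesis
  proof (intro exI conjI allI impI)
    show "whp (\<lambda>\<delta>. {n. 0 < n \<and> threshold n \<delta> / real n \<le> v})" by (rule whp_threshold_le[OF v(1,3)])
    show "(\<lambda>n. measure S (below n v a)) \<longlonglongrightarrow> 0" by (rule below_tendsto_0[OF a(1,2) v(2)])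
    fix \<delta> n assume n: "0 < n \<and> n \<in> {n. 0 < n \<and> threshold n \<delta> / real n \<le> v}"
    then show "measure S (below n (rate n \<delta>) (s - \<epsilon>)) \<le> measure S (below n v a)"
      by (intro S.finite_measure_mono below_mono above_below_sets) (auto simp: a_def)
  qed
next
  case False
  have "below n v (s - \<epsilon>) = {}" if "0 < n" for n v
  proof (rule equals0I)
    fix x assume x: "x \<in> below n v (s - \<epsilon>)"
    then interpret E: unit_side "emp n x" e
      using unit_side_empirical[OF that _ e] by (auto simp: below_def)
    show False using x False E.near_endpoint_bounds(1)[of v] by (simp add: below_def)
  qed
  then show ?thesis using whp_UNIV by (intro exI[of _ "\<lambda>_. UNIV"] exI[of _ "\<lambda>_. 0"]) auto
qed

lemma limit_gap_infinite_budget: "K = \<infinity> \<Longrightarrow> limit_gap (gap \<nu> e)"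
  unfolding limit_gap_def
proof (intro conjI allI impI)
  fix a assume K: "K = \<infinity>" and "0 < a \<and> a < gap \<nu> e"
  then have "0 < max_growth \<nu> e a" using max_growth_pos by simp
  then obtain v where "0 < v" "v < max_growth \<nu> e a" using dense by blast
  then show "\<exists>v>0. v < max_growth \<nu> e a \<and> ereal (mean C / v) < K" using K by auto
qed (use gap_bounds in auto)

lemma limit_gap_no_budget: "K = 0 \<Longrightarrow> limit_gap 0"
  unfolding limit_gap_def
proof (intro conjI allI impI)
  fix a assume K: "K = 0"
  define v where "v = max 1 (max_growth \<nu> e a + 1)"
  have "0 < v" "max_growth \<nu> e a < v" by (auto simp: v_def)
  moreover from this have "K < ereal (mean C / v)" using K mean_pos by (simp add: zero_ereal_def)
  ultimately show "\<exists>v>0. max_growth \<nu> e a < v \<and> K < ereal (mean C / v)" by blast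
qed (use gap_bounds in auto)

lemma limit_gap_degenerate: "gap \<nu> e = 0 \<Longrightarrow> limit_gap 0"
  unfolding limit_gap_def by auto

lemma limit_gap_root:
  assumes k: "0 < k" "K = ereal k" and s: "0 < s" "s < gap \<nu> e" "max_growth \<nu> e s = mean C / k"
  shows "limit_gap s"
  unfolding limit_gap_def
proof (intro conjI allI impI)
  fix a assume a: "s < a \<and> a < gap \<nu> e"
  then have a': "max_growth \<nu> e a < mean C / k" "0 < mean C / k"
    using max_growth_strict_antimono[of s a] s mean_pos k by auto
  then obtain v where "max 0 (max_growth \<nu> e a) < v" "v < mean C / k"
    using dense[of "max 0 (max_growth \<nu> e a)" "mean C / k"] by auto
  then show "\<exists>v>0. max_growth \<nu> e a < v \<and> K < ereal (mean C / v)"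
    using k by (intro exI[of _ v]) (auto simp: field_simps)
next
  fix a assume a: "0 < a \<and> a < s"
  then have "mean C / k < max_growth \<nu> e a" using max_growth_strict_antimono[of a s] s by simp
  then obtain v where v: "mean C / k < v" "v < max_growth \<nu> e a" using dense by blast
  moreover have "0 < v" using v(1) mean_pos k by (meson divide_pos_pos less_trans)
  ultimately show "\<exists>v>0. v < max_growth \<nu> e a \<and> ereal (mean C / v) < K"
    using k by (intro exI[of _ v]) (auto simp: field_simps)
qed (use s in auto)

lemma ex_limit_gap: "\<exists>s. limit_gap s"
proof (cases "gap \<nu> e = 0")
  case False
  then have g: "0 < gap \<nu> e" using gap_bounds by simp
  show ?thesis
  proof (cases K)
    case (real k)
    show ?thesis
    proof (cases "k = 0")
      case True
      then show ?thesis using limit_gap_no_budget real by (auto simp: zero_ereal_def)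
    next
      case False
      then have k: "0 < k" using real K_nonneg by simp
      then obtain s where "0 < s" "s < gap \<nu> e" "max_growth \<nu> e s = mean C / k"
        using ex_max_growth_eq[OF g, of "mean C / k"] mean_pos by auto
      then show ?thesis using limit_gap_root[OF k real] by blast
    qed
  qed (use limit_gap_infinite_budget K_nonneg in auto)
qed (use limit_gap_degenerate in auto)

end

context budgeted_sampling
begin

sublocale L: budgeted_side \<nu> 0 C b K by unfold_locales
sublocale R: budgeted_side \<nu> 1 C b K by unfold_locales

text \<open>
Stated for an abstract endpoint \<open>y\<close>, since the right endpoint is \<open>1\<close> minus the distance that is
controlled here.
\<close>

lemma endpoint_tendsto:
  fixes Y :: "real \<Rightarrow> (nat \<Rightarrow> real) \<times> (nat \<Rightarrow> real) \<Rightarrow> ereal"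
  assumes side: "budgeted_side \<nu> e C b K" and s: "budgeted_side.limit_gap \<nu> e C K s"
    and y_meas: "\<And>\<delta> n. y \<delta> n \<in> borel_measurable S"
    and y: "\<And>\<delta> n x \<epsilon>. 0 < n \<Longrightarrow> in_unit n x \<Longrightarrow>
      ereal \<epsilon> < \<bar>y \<delta> n x - ereal r\<bar> \<longleftrightarrow>
        \<epsilon> < \<bar>near_endpoint (emp n x) e (rate n \<delta>) - s\<bar>"
    and Y: "\<And>\<delta> \<omega>. Y \<delta> \<omega> = y \<delta> (num_samples (b \<delta>) (snd \<omega>)) (fst \<omega>)"
  shows "tendsto_in_prob J Y (ereal r)"
proof -
  interpret Z: budgeted_side \<nu> e C b K by fact
  have "((\<lambda>\<delta>. measure J {\<omega> \<in> space J. ereal \<epsilon> < \<bar>Y \<delta> \<omega> - ereal r\<bar>}) \<longlongrightarrow> 0) (at_right 0)"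
    if \<epsilon>: "0 < \<epsilon>" for \<epsilon>
  proof -
    define A where "A \<delta> n = {x \<in> space S. ereal \<epsilon> < \<bar>y \<delta> n x - ereal r\<bar>}" for \<delta> n
    have A: "A \<delta> n \<in> sets S" for \<delta> n unfolding A_def using y_meas by measurable
    obtain G1 p1 where 1: "whp G1" "p1 \<longlonglongrightarrow> 0"
      "\<And>\<delta> n. 0 < n \<Longrightarrow> n \<in> G1 \<delta> \<Longrightarrow> measure S (Z.above n (rate n \<delta>) (s + \<epsilon>)) \<le> p1 n"
      using Z.limit_gap_above[OF s \<epsilon>] by blast
    obtain G2 p2 where 2: "whp G2" "p2 \<longlonglongrightarrow> 0"
      "\<And>\<delta> n. 0 < n \<Longrightarrow> n \<in> G2 \<delta> \<Longrightarrow> measure S (Z.below n (rate n \<delta>) (s - \<epsilon>)) \<le> p2 n"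
      using Z.limit_gap_below[OF s \<epsilon>] by blast
    have "((\<lambda>\<delta>. measure J {\<omega> \<in> space J. fst \<omega> \<in> A \<delta> (num_samples (b \<delta>) (snd \<omega>))}) \<longlongrightarrow> 0) (at_right 0)"
    proof (rule random_index_tendsto_0[OF A whp_Int[OF whp_Int[OF 1(1) 2(1)] whp_ge[of 1]]])
      show "(\<lambda>n. p1 n + p2 n) \<longlonglongrightarrow> 0" using tendsto_add[OF 1(2) 2(2)] by simp
      fix \<delta> n assume n: "n \<in> G1 \<delta> \<inter> G2 \<delta> \<inter> {1..}"
      then have n0: "0 < n" by simp
      let ?a = "Z.above n (rate n \<delta>) (s + \<epsilon>)"
      let ?b = "Z.below n (rate n \<delta>) (s - \<epsilon>)"
      have "measure S (A \<delta> n) \<le> measure S (?a \<union> ?b)"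
      proof (rule L.S.finite_measure_mono_AE)
        show "AE x in S. x \<in> A \<delta> n \<longrightarrow> x \<in> ?a \<union> ?b"
          using R.AE_in_unit
        proof eventually_elim
          case (elim x)
          then have "in_unit n x" by simp
          from y[OF n0 this, of \<epsilon> \<delta>] this show ?case
            by (auto simp: A_def Z.above_def Z.below_def abs_if split: if_splits)
        qed
      qed (use Z.above_below_sets[OF n0] in auto)
      also have "\<dots> \<le> measure S ?a + measure S ?b"
        using Z.above_below_sets[OF n0] by (intro measure_Un_le) auto
      also have "\<dots> \<le> p1 n + p2 n" using 1(3)[OF n0] 2(3)[OF n0] n by (intro add_mono) auto
      finally show "measure S (A \<delta> n) \<le> p1 n + p2 n" .
    qed
    moreover have "{\<omega> \<in> space J. fst \<omega> \<in> A \<delta> (num_samples (b \<delta>) (snd \<omega>))}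
      = {\<omega> \<in> space J. ereal \<epsilon> < \<bar>Y \<delta> \<omega> - ereal r\<bar>}" for \<delta>
      by (auto simp: A_def Y J_eq space_pair_measure)
    ultimately show ?thesis by simp
  qed
  then show ?thesis by (simp add: tendsto_in_prob_def)
qed

lemma left_tendsto:
  assumes "L.limit_gap s" shows "tendsto_in_prob J (left_endpoint \<pi> b) (ereal s)"
proof (rule endpoint_tendsto[OF L.budgeted_side_axioms assms])
  show "(\<lambda>x. fst (\<pi> \<delta> (sample n x))) \<in> borel_measurable S" for \<delta> n by measurable
qed (auto simp: left_endpoint_def KL_inf_policy_sample split_beta)

lemma right_tendsto:
  assumes "R.limit_gap s" shows "tendsto_in_prob J (right_endpoint \<pi> b) (ereal (1 - s))"
proof (rule endpoint_tendsto[OF R.budgeted_side_axioms assms])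
  show "(\<lambda>x. snd (\<pi> \<delta> (sample n x))) \<in> borel_measurable S" for \<delta> n by measurable
qed (auto simp: right_endpoint_def KL_inf_policy_sample split_beta abs_minus_commute)

lemma endpoint_joint_measurable:
  "left_endpoint \<pi> b \<delta> \<in> borel_measurable J" "right_endpoint \<pi> b \<delta> \<in> borel_measurable J"
proof -
  have *: "(\<lambda>\<omega>. f (num_samples (b \<delta>) (snd \<omega>)) (fst \<omega>)) \<in> borel_measurable J"
    if f: "\<And>n. f n \<in> borel_measurable S" for f :: "nat \<Rightarrow> (nat \<Rightarrow> real) \<Rightarrow> ereal"
    unfolding J_eq
    by (rule measurable_compose_countable[where f = "\<lambda>n \<omega>. f n (fst \<omega>)"])
      (auto intro!: measurable_compose[OF measurable_fst f] measurable_compose[OF measurable_snd num_samples_measurable])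
  show "left_endpoint \<pi> b \<delta> \<in> borel_measurable J"
    using *[of "\<lambda>n x. fst (\<pi> \<delta> (sample n x))"] by (simp add: left_endpoint_def split_beta)
  show "right_endpoint \<pi> b \<delta> \<in> borel_measurable J"
    using *[of "\<lambda>n x. snd (\<pi> \<delta> (sample n x))"] by (simp add: right_endpoint_def split_beta)
qed

lemma prob_space_J: "prob_space J"
  unfolding J_eq by (rule J.prob_space_axioms)

lemma is_left_limit: "L.limit_gap s \<Longrightarrow> is_left_limit C b \<nu> \<pi> (ereal s)"
  unfolding is_left_limit_def using left_tendsto gap_mean[OF \<nu>] by (auto simp: L.limit_gap_def)

lemma is_right_limit: "R.limit_gap s \<Longrightarrow> is_right_limit C b \<nu> \<pi> (ereal (1 - s))"
  unfolding is_right_limit_def using right_tendsto gap_mean[OF \<nu>] by (auto simp: R.limit_gap_def)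

lemma mu_L_eq:
  assumes "L.limit_gap s" shows "mu_L C b \<nu> \<pi> = ereal s"
  unfolding mu_L_def
proof (rule the_equality)
  show "is_left_limit C b \<nu> \<pi> (ereal s)" by (rule is_left_limit[OF assms])
  fix l assume "is_left_limit C b \<nu> \<pi> l"
  then show "l = ereal s"
    using tendsto_in_prob_unique[OF prob_space_J endpoint_joint_measurable(1) left_tendsto[OF assms]]
    by (simp add: is_left_limit_def)
qed

lemma mu_R_eq:
  assumes "R.limit_gap s" shows "mu_R C b \<nu> \<pi> = ereal (1 - s)"
  unfolding mu_R_def
proof (rule the_equality)
  show "is_right_limit C b \<nu> \<pi> (ereal (1 - s))" by (rule is_right_limit[OF assms])
  fix l assume "is_right_limit C b \<nu> \<pi> l"
  then show "l = ereal (1 - s)"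
    using tendsto_in_prob_unique[OF prob_space_J endpoint_joint_measurable(2) right_tendsto[OF assms]]
    by (simp add: is_right_limit_def)
qed

lemma stable: "\<pi> \<in> stable_CI_policies prob_unit_interval C b \<nu>"
  unfolding stable_CI_policies_def
  using KL_inf_policy_in_CI_policies[OF cost_axioms] L.ex_limit_gap R.ex_limit_gap
    is_left_limit is_right_limit by blast

lemma infinite_budget_limits:
  assumes "K = \<infinity>" shows "mu_L C b \<nu> \<pi> = ereal (mean \<nu>)" "mu_R C b \<nu> \<pi> = ereal (mean \<nu>)"
  using mu_L_eq[OF L.limit_gap_infinite_budget[OF assms]]
    mu_R_eq[OF R.limit_gap_infinite_budget[OF assms]] gap_mean[OF \<nu>] by simp_all

lemma finite_budget_left:
  assumes k: "0 < k" "K = ereal k" and m: "0 < mean \<nu>"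
  shows "\<exists>!x. x < mean \<nu> \<and> KL_inf \<nu> prob_unit_interval x = ereal (mean C / k)" (is "\<exists>!x. ?P x")
    and "mu_L C b \<nu> \<pi> = ereal (mu_L_star prob_unit_interval \<nu> k (mean C))"
proof -
  have g: "0 < gap \<nu> 0" and ck: "0 < mean C / k" using m gap_mean[OF \<nu>] mean_pos k by auto
  have eq: "?P x \<longleftrightarrow> x < gap \<nu> 0 \<and> KL_near \<nu> 0 x = ereal (mean C / k)" for x
    using gap_mean[OF \<nu>] KL_inf_eq_KL_near(2)[of x \<nu>] by auto
  show ex1: "\<exists>!x. ?P x" unfolding eq by (rule L.ex1_KL_near[OF g ck])
  define s where "s = mu_L_star prob_unit_interval \<nu> k (mean C)"
  have "?P s" unfolding s_def mu_L_star_def by (rule theI'[OF ex1])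
  then have "s < gap \<nu> 0" "KL_near \<nu> 0 s = ereal (mean C / k)" by (auto simp: eq)
  then have "L.limit_gap s" using L.KL_near_eq_realD[OF g] by (intro L.limit_gap_root[OF k]) auto
  then show "mu_L C b \<nu> \<pi> = ereal (mu_L_star prob_unit_interval \<nu> k (mean C))"
    unfolding s_def[symmetric] by (rule mu_L_eq)
qed

lemma finite_budget_right:
  assumes k: "0 < k" "K = ereal k" and m: "mean \<nu> < 1"
  shows "\<exists>!x. mean \<nu> < x \<and> KL_inf \<nu> prob_unit_interval x = ereal (mean C / k)" (is "\<exists>!x. ?P x")
    and "mu_R C b \<nu> \<pi> = ereal (mu_R_star prob_unit_interval \<nu> k (mean C))"
proof -
  have g: "0 < gap \<nu> 1" and ck: "0 < mean C / k" using m gap_mean[OF \<nu>] mean_pos k by auto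
  let ?Q = "\<lambda>a. a < gap \<nu> 1 \<and> KL_near \<nu> 1 a = ereal (mean C / k)"
  have eq: "?P x \<longleftrightarrow> ?Q (1 - x)" for x
    using gap_mean[OF \<nu>] KL_inf_eq_KL_near(1)[of \<nu> x] by auto
  have "\<exists>!a. ?Q a" by (rule R.ex1_KL_near[OF g ck])
  then obtain a where a: "?Q a" "\<And>a'. ?Q a' \<Longrightarrow> a' = a" by blast
  show ex1: "\<exists>!x. ?P x"
  proof (rule ex1I[of _ "1 - a"])
    show "?P (1 - a)" unfolding eq using a(1) by simp
    fix x assume "?P x"
    then have "1 - x = a" unfolding eq by (rule a(2))
    then show "x = 1 - a" by simp
  qed
  define x where "x = mu_R_star prob_unit_interval \<nu> k (mean C)"
  have "?P x" unfolding x_def mu_R_star_def by (rule theI'[OF ex1])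
  then have "?Q (1 - x)" by (simp only: eq)
  then have "R.limit_gap (1 - x)" using R.KL_near_eq_realD[OF g, of "1 - x"] by (intro R.limit_gap_root[OF k]) auto
  from mu_R_eq[OF this] show "mu_R C b \<nu> \<pi> = ereal (mu_R_star prob_unit_interval \<nu> k (mean C))"
    by (simp add: x_def)
qed

end

theorem theorem8:
  fixes B :: "real measure set" and \<nu> C :: "real measure"
    and b :: "real \<Rightarrow> real" and K :: ereal and \<pi> :: policy
  defines "B \<equiv> prob_unit_interval"
    and "\<pi> \<equiv> KL_inf_policy B threshold"
  assumes "\<nu> \<in> B"
    and "cost_distribution C" and "0 < mean C"
    and "filterlim b at_top (at_right 0)"
    and "0 \<le> K" and "((\<lambda>\<delta>. ereal (b \<delta> / ln (1 / \<delta>))) \<longlongrightarrow> K) (at_right 0)"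
  shows "\<pi> \<in> stable_CI_policies B C b \<nu> \<and>
    (\<forall>k>0. K = ereal k \<longrightarrow>
       (mean \<nu> < 1 \<longrightarrow>
          (\<exists>!x. mean \<nu> < x \<and> KL_inf \<nu> B x = ereal (mean C / k)) \<and>
          mu_R C b \<nu> \<pi> = ereal (mu_R_star B \<nu> k (mean C))) \<and>
       (0 < mean \<nu> \<longrightarrow>
          (\<exists>!x. x < mean \<nu> \<and> KL_inf \<nu> B x = ereal (mean C / k)) \<and>
          mu_L C b \<nu> \<pi> = ereal (mu_L_star B \<nu> k (mean C)))) \<and>
    (K = \<infinity> \<longrightarrow> mu_R C b \<nu> \<pi> - mu_L C b \<nu> \<pi> = 0)"
proof -
  interpret E: budgeted_sampling C \<nu> b K
    by unfold_locales (use assms in auto)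
  show ?thesis
    unfolding \<pi>_def B_def
    using E.stable E.infinite_budget_limits E.finite_budget_left E.finite_budget_right
    by (simp add: zero_ereal_def)
qed

end
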